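(* Let $\omega=\langle\frac1n\rangle_{n\ge1}$ be the harmonic sequence and let $p>0$. (i) $$\widehat{(\omega)^p}=\begin{cases}F&\text{for }p>1,\\ \left(\langle\frac{n}{e^n}\rangle\right)&\text{for }p=1,\\ (\omega)^{p'}&\text{for }0<p<1,\text{ where }\frac1p-\frac1{p'}=1.\end{cases}$$ (ii) $\widehat{(\omega)^p}$ is am-stable if and only if $0<p<\frac12$.
   Context: $H$ is a separable infinite-dimensional complex Hilbert space. "Ideal" means a two-sided ideal of $B(H)$ contained in the compact operators; $F$ is the ideal of finite rank operators. $c_o^*$ is the set of nonnegative monotone nonincreasing sequences converging to $0$. $\Sigma(I):=\{s(X)\mid X\in I\}\subset c_o^*$, where $s(X)$ is the sequence of s-numbers (singular values) of $X$; an ideal is determined by $\Sigma(I)$. For $\xi\in c_o^*$, $(\xi)$ is the principal ideal generated by $\mathrm{diag}\,\xi$; $\eta\in\Sigma((\xi))$ iff $\eta=O(D_m\xi)$ for some $m\in\mathbb N$, where $(D_m\xi)_n:=\xi_{\lceil n/m\rceil}$. For $p>0$, $(\omega)^p=(\omega^p)$ is the principal ideal generated by the sequence $\omega^p=\langle n^{-p}\rangle$. For $\xi\in c_o^*$ put $(\xi_a)_n:=\frac1n\sum_{j=1}^n\xi_j$. The arithmetic mean $I_a$ of an ideal $I$ is the ideal with $\Sigma(I_a)=\{\xi\in c_o^*\mid\xi=O(\eta_a)\text{ for some }\eta\in\Sigma(I)\}$. $I$ is am-stable if $I=I_a$. For an ideal $I$, $\widehat I:=\bigcap\{J\mid J\text{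 an ideal},\ J_a\supset I_a\}$. *)

theory Defs
  imports "HOL-Analysis.Analysis"
begin

text \<open>Sequences indexed by \<open>n \<ge> 1\<close> are rendered as functions on \<^typ>\<open>nat\<close>
  shifted by one: \<open>\<xi> k\<close> is the term with index \<open>n = k + 1\<close>.\<close>

section \<open>Complex Hilbert spaces\<close>

text \<open>The inner product is conjugate-linear in its first argument.\<close>

class complex_hilbert = banach +
  fixes scaleC :: "complex \<Rightarrow> 'a \<Rightarrow> 'a"  (infixr "*\<^sub>C" 75)
    and cinner :: "'a \<Rightarrow> 'a \<Rightarrow> complex"
  assumes scaleC_add_right: "a *\<^sub>C (x + y) = a *\<^sub>C x + a *\<^sub>C y"
    and scaleC_add_left: "(a + b) *\<^sub>C x = a *\<^sub>C x + b *\<^sub>C x"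
    and scaleC_scaleC: "a *\<^sub>C b *\<^sub>C x = (a * b) *\<^sub>C x"
    and scaleR_scaleC: "r *\<^sub>R x = complex_of_real r *\<^sub>C x"
    and cinner_commute: "cinner x y = cnj (cinner y x)"
    and cinner_add_right: "cinner x (y + z) = cinner x y + cinner x z"
    and cinner_scaleC_right: "cinner x (a *\<^sub>C y) = a * cinner x y"
    and cinner_self_nonneg: "0 \<le> Re (cinner x x)"
    and norm_eq_sqrt_cinner: "norm x = sqrt (Re (cinner x x))"

global_interpretation cvec: vector_space "scaleC :: complex \<Rightarrow> 'a \<Rightarrow> 'a::complex_hilbert"
  defines cspan = cvec.span
    and cdim = cvec.dim
proof
  fix x :: 'a
  show "1 *\<^sub>C x = x"
    using scaleR_scaleC[of 1 x] by simp
qed (simp_all add: scaleC_add_right scaleC_add_left scaleC_scaleC)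

definition infinite_dimensional :: "'h::complex_hilbert itself \<Rightarrow> bool" where
  "infinite_dimensional _ \<longleftrightarrow> \<not> (\<exists>B :: 'h set. finite B \<and> cspan B = UNIV)"

definition orthonormal_basis :: "(nat \<Rightarrow> 'h::complex_hilbert) \<Rightarrow> bool" where
  "orthonormal_basis e \<longleftrightarrow>
     (\<forall>i j. cinner (e i) (e j) = (if i = j then 1 else 0)) \<and> closure (cspan (range e)) = UNIV"

section \<open>Operators and ideals\<close>

text \<open>The library type of bounded operators is only real-linear, so the algebra \<open>B(H)\<close> is
  the set of those that commute with complex scalars.\<close>

definition B_ops :: "('h::complex_hilbert \<Rightarrow>\<^sub>L 'h) set" where
  "B_ops = {T. \<forall>c x. blinfun_apply T (c *\<^sub>C x) = c *\<^sub>C blinfun_apply T x}"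

definition compact_ops :: "('h::complex_hilbert \<Rightarrow>\<^sub>L 'h) set" where
  "compact_ops = {T \<in> B_ops. compact (closure (blinfun_apply T ` cball 0 1))}"

definition finite_rank_ops :: "('h::complex_hilbert \<Rightarrow>\<^sub>L 'h) set" where
  "finite_rank_ops = {T \<in> B_ops. \<exists>B. finite B \<and> range (blinfun_apply T) \<subseteq> cspan B}"

text \<open>Closure under scalar multiples follows from closure under multiplication by
  scalar multiples of the identity.\<close>

definition is_ideal :: "('h::complex_hilbert \<Rightarrow>\<^sub>L 'h) set \<Rightarrow> bool" where
  "is_ideal I \<longleftrightarrow> I \<subseteq> compact_ops \<and> 0 \<in> I \<and> (\<forall>X\<in>I. \<forall>Y\<in>I. X + Y \<in> I) \<and>
     (\<forall>A\<in>B_ops. \<forall>X\<in>I. A o\<^sub>L X \<in> I \<and> X o\<^sub>L A \<in> I)"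

definition generated_ideal :: "('h::complex_hilbert \<Rightarrow>\<^sub>L 'h) \<Rightarrow> ('h \<Rightarrow>\<^sub>L 'h) set" where
  "generated_ideal X = \<Inter> {J. is_ideal J \<and> X \<in> J}"

definition diag :: "(nat \<Rightarrow> 'h::complex_hilbert) \<Rightarrow> (nat \<Rightarrow> real) \<Rightarrow> ('h \<Rightarrow>\<^sub>L 'h)" where
  "diag e \<xi> = Blinfun (\<lambda>x. \<Sum>n. (complex_of_real (\<xi> n) * cinner (e n) x) *\<^sub>C e n)"

definition principal_ideal ::
    "(nat \<Rightarrow> 'h::complex_hilbert) \<Rightarrow> (nat \<Rightarrow> real) \<Rightarrow> ('h \<Rightarrow>\<^sub>L 'h) set" where
  "principal_ideal e \<xi> = generated_ideal (diag e \<xi>)"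

section \<open>Singular numbers and characteristic sets\<close>

definition adj :: "('h::complex_hilbert \<Rightarrow>\<^sub>L 'h) \<Rightarrow> ('h \<Rightarrow>\<^sub>L 'h)" where
  "adj X = (THE Y. \<forall>x y. cinner (blinfun_apply Y x) y = cinner x (blinfun_apply X y))"

definition c0_star :: "(nat \<Rightarrow> real) set" where
  "c0_star = {\<xi>. (\<forall>n. 0 \<le> \<xi> n) \<and> decseq \<xi> \<and> \<xi> \<longlonglongrightarrow> 0}"

text \<open>For compact \<open>X\<close>: the square roots of the nonzero eigenvalues of \<open>X\<^sup>* X\<close> (that is, the
  nonzero eigenvalues of \<open>\<bar>X\<bar>\<close>) in decreasing order, repeated according to multiplicity and
  followed by zeros if there are only finitely many. These eigenspaces are finite-dimensional,
  so \<^const>\<open>cdim\<close> is their true dimension.\<close>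

definition s_numbers :: "('h::complex_hilbert \<Rightarrow>\<^sub>L 'h) \<Rightarrow> nat \<Rightarrow> real" where
  "s_numbers X = (THE s. s \<in> c0_star \<and>
     (\<forall>t>0. card {n. s n = t} =
        cdim {x. blinfun_apply (adj X o\<^sub>L X) x = complex_of_real (t\<^sup>2) *\<^sub>C x}))"

definition char_set :: "('h::complex_hilbert \<Rightarrow>\<^sub>L 'h) set \<Rightarrow> (nat \<Rightarrow> real) set" where
  "char_set I = {s_numbers X | X. X \<in> I}"

section \<open>Arithmetic means\<close>

definition arith_mean :: "(nat \<Rightarrow> real) \<Rightarrow> nat \<Rightarrow> real" where
  "arith_mean \<xi> k = (\<Sum>j\<le>k. \<xi> j) / real (k + 1)"

text \<open>\<open>\<xi> = O(\<eta>)\<close> for nonnegative sequences, with the bound required at every index; unlike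
  the eventual version, this makes the zero ideal its own arithmetic mean.\<close>

definition seq_bigo :: "(nat \<Rightarrow> real) \<Rightarrow> (nat \<Rightarrow> real) \<Rightarrow> bool" where
  "seq_bigo \<xi> \<eta> \<longleftrightarrow> (\<exists>C. \<forall>n. \<xi> n \<le> C * \<eta> n)"

definition am_ideal :: "('h::complex_hilbert \<Rightarrow>\<^sub>L 'h) set \<Rightarrow> ('h \<Rightarrow>\<^sub>L 'h) set" where
  "am_ideal I = (THE J. is_ideal J \<and>
     char_set J = {\<xi> \<in> c0_star. \<exists>\<eta> \<in> char_set I. seq_bigo \<xi> (arith_mean \<eta>)})"

definition am_stable :: "('h::complex_hilbert \<Rightarrow>\<^sub>L 'h) set \<Rightarrow> bool" where
  "am_stable I \<longleftrightarrow> I = am_ideal I"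

definition hat_ideal :: "('h::complex_hilbert \<Rightarrow>\<^sub>L 'h) set \<Rightarrow> ('h \<Rightarrow>\<^sub>L 'h) set" where
  "hat_ideal I = \<Inter> {J. is_ideal J \<and> am_ideal I \<subseteq> am_ideal J}"

definition omega :: "nat \<Rightarrow> real" where
  "omega k = 1 / real (k + 1)"

definition omega_pow :: "(nat \<Rightarrow> 'h::complex_hilbert) \<Rightarrow> real \<Rightarrow> ('h \<Rightarrow>\<^sub>L 'h) set" where
  "omega_pow e p = principal_ideal e (\<lambda>k. omega k powr p)"

end

theory Submission
  imports Defs "HOL-Real_Asymp.Real_Asymp"
begin

text \<open>A compact operator has a singular value decomposition, so it belongs to an ideal if and only
  if the diagonal operator of its s-numbers does. Hence ideals correspond to sets of sequences that
  are hereditary, additive and closed under \<open>D\<^sub>2\<close>, and everything is a statement about sequences.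

  Suppose that \<open>\<eta>\<close> decreases to \<open>0\<close> and \<open>\<omega>\<^sup>p = O(\<eta>\<^sub>a)\<close> (for \<open>p = 1\<close>, \<open>\<omega>\<^sub>a = O(\<eta>\<^sub>a)\<close>). The sum of
  the first \<open>n\<close> terms of \<open>\<eta>\<close> is then at least a multiple of \<open>n\<^bsup>1-p\<^esup>\<close> (of \<open>ln n\<close>), but the first
  \<open>m\<close> terms contribute only \<open>O(m)\<close>. For \<open>n\<close> so large that the bound exceeds this contribution the
  remaining terms, each at most the \<open>m\<close>-th one, must supply the rest, which bounds the \<open>m\<close>-th term
  below by a multiple of \<open>m\<^bsup>-p'\<^esup>\<close> (of \<open>e\<^bsup>-Lm\<^esup>\<close>). Conversely, given a sequence \<open>\<xi>\<close> outside the
  claimed principal ideal, a step sequence \<open>\<eta>\<close> satisfying the domination can be made to attain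
  this lower bound at infinitely many places, chosen where \<open>\<xi>\<close> is much larger. For \<open>p > 1\<close> the
  sequence is summable, and the domination only says that \<open>\<eta>\<close> is nonzero.\<close>

section \<open>Complex inner product spaces\<close>

text \<open>The exponent p' is what remains when n is eliminated: n^(1-p) has to exceed a multiple
  of m, so n is of order m^(1/(1-p)), and the m-th term is then at least of order n^(-p) =
  m^(-p/(1-p)). For p = 1 the sequence \<omega> alone would only say that \<eta> is nonzero, because
  1/n is already the arithmetic mean of (1, 0, 0, ...); the logarithm comes from the mean of
  \<omega>, which also lies in the arithmetic mean of (\<omega>). The rate L depends on \<eta>, but
  a dilation lowers any exponential rate as far as desired and also absorbs the factor n in n/e^n.

  The obstacle is that for p \<le> 1 the claimed ideal does not itself satisfy the condition imposed
  on J: the partial sums of its generator grow too slowly. No single J therefore yields the upper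
  bound. Every sequence outside the claimed ideal needs an \<eta> of its own, and the principal
  ideal of \<eta> misses that sequence only if all constants and all dilations are defeated by the
  same \<eta>. This is why the step sequence faces a larger constant and a larger dilation on every
  block.\<close>

lemma cinner_add_left: "cinner (x + y) z = cinner x z + cinner y z"
  by (metis cinner_add_right cinner_commute complex_cnj_add)

lemma cinner_scaleC_left: "cinner (a *\<^sub>C x) y = cnj a * cinner x y"
  by (metis cinner_commute cinner_scaleC_right complex_cnj_mult)

lemma cinner_self: "cinner x x = complex_of_real ((norm x)\<^sup>2)"
proof -
  have "Im (cinner x x) = 0"
    using arg_cong[OF cinner_commute[of x x], of Im] by simp
  moreover have "Re (cinner x x) = (norm x)\<^sup>2"
    by (simp add: norm_eq_sqrt_cinner cinner_self_nonneg)
  ultimately show ?thesis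
    by (simp add: complex_eq_iff)
qed

lemma cinner_scaleR_left: "cinner (r *\<^sub>R x) y = r *\<^sub>R cinner x y"
  by (simp add: scaleR_scaleC cinner_scaleC_left scaleR_conv_of_real)

lemma cinner_scaleR_right: "cinner x (r *\<^sub>R y) = r *\<^sub>R cinner x y"
  by (simp add: scaleR_scaleC cinner_scaleC_right scaleR_conv_of_real)

lemma cinner_zero_left [simp]: "cinner 0 x = 0"
  using cinner_scaleR_left[of 0 0 x] by simp

lemma cinner_zero_right [simp]: "cinner x 0 = 0"
  using cinner_scaleR_right[of x 0 0] by simp

lemma cinner_minus_right: "cinner x (- y) = - cinner x y"
  using cinner_scaleR_right[of x "-1" y] by simp

lemma cinner_diff_right: "cinner x (y - z) = cinner x y - cinner x z"
  using cinner_add_right[of x y "-z"] by (simp add: cinner_minus_right)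

lemma cinner_sum_right: "cinner x (\<Sum>i\<in>A. f i) = (\<Sum>i\<in>A. cinner x (f i))"
  by (induction A rule: infinite_finite_induct) (simp_all add: cinner_add_right)

lemma norm_sq_add: "(norm (x + y))\<^sup>2 = (norm x)\<^sup>2 + 2 * Re (cinner x y) + (norm y)\<^sup>2"
proof -
  have "Re (cinner (x + y) (x + y)) = Re (cinner x x) + 2 * Re (cinner x y) + Re (cinner y y)"
    using cinner_commute[of x y] by (simp add: cinner_add_left cinner_add_right)
  then show ?thesis
    by (simp add: cinner_self)
qed

lemma norm_sq_diff: "(norm (x - y))\<^sup>2 = (norm x)\<^sup>2 - 2 * Re (cinner x y) + (norm y)\<^sup>2"
  using norm_sq_add[of x "-y"] by (simp add: cinner_minus_right)

lemma norm_scaleC [simp]: "norm (a *\<^sub>C x) = cmod a * norm x"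
proof -
  have "complex_of_real ((norm (a *\<^sub>C x))\<^sup>2) = a * cnj a * complex_of_real ((norm x)\<^sup>2)"
    unfolding cinner_self[symmetric] by (simp add: cinner_scaleC_left cinner_scaleC_right)
  also have "\<dots> = complex_of_real ((cmod a * norm x)\<^sup>2)"
    unfolding complex_norm_square[symmetric] by (simp add: power_mult_distrib)
  finally have "complex_of_real ((norm (a *\<^sub>C x))\<^sup>2) = complex_of_real ((cmod a * norm x)\<^sup>2)" .
  then have "(norm (a *\<^sub>C x))\<^sup>2 = (cmod a * norm x)\<^sup>2"
    using of_real_eq_iff by blast
  then show ?thesis
    by (simp add: power2_eq_iff_nonneg)
qed

text \<open>Cauchy-Schwarz, from expanding the squared norm of r y - c x with r the squared norm of
  x and c the inner product. This is r times the component of y orthogonal to x, so no division is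
  required.\<close>

lemma norm_cinner_le: "cmod (cinner x y) \<le> norm x * norm y"
proof (cases "x = 0")
  case False
  define c where "c = cinner x y"
  define r where "r = (norm x)\<^sup>2"
  have r: "r > 0"
    using False by (simp add: r_def)
  have "(norm (of_real r *\<^sub>C y - c *\<^sub>C x))\<^sup>2 =
      r\<^sup>2 * (norm y)\<^sup>2 - 2 * r * (cmod c)\<^sup>2 + (cmod c)\<^sup>2 * r"
  proof -
    have "cinner (of_real r *\<^sub>C y) (c *\<^sub>C x) = of_real r * (c * cnj c)"
      using cinner_commute[of y x]
      by (simp add: cinner_scaleC_left cinner_scaleC_right c_def)
    also have "\<dots> = of_real (r * (cmod c)\<^sup>2)"
      by (simp add: complex_norm_square del: of_real_power)
    finally show ?thesis
      using r by (simp add: norm_sq_diff power_mult_distrib r_def[symmetric])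
  qed
  then have "0 \<le> r\<^sup>2 * (norm y)\<^sup>2 - r * (cmod c)\<^sup>2"
    using zero_le_power2[of "norm (of_real r *\<^sub>C y - c *\<^sub>C x)"] by (simp add: mult.commute)
  then have "r * (cmod c)\<^sup>2 \<le> r * (r * (norm y)\<^sup>2)"
    by (simp add: power2_eq_square mult_ac)
  then have "(cmod c)\<^sup>2 \<le> r * (norm y)\<^sup>2"
    using r by simp
  then have "(cmod c)\<^sup>2 \<le> (norm x * norm y)\<^sup>2"
    by (simp add: r_def power_mult_distrib)
  then show ?thesis
    unfolding c_def by (rule power2_le_imp_le) simp
qed simp

lemma bounded_bilinear_cinner: "bounded_bilinear cinner"
  by (rule bounded_bilinear.intro)
    (auto simp: cinner_add_left cinner_add_right cinner_scaleR_left cinner_scaleR_right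
      intro!: exI[of _ 1] norm_cinner_le)

lemmas bounded_linear_cinner_right = bounded_bilinear.bounded_linear_right[OF bounded_bilinear_cinner]

lemma cinner_eqI: "(\<And>y. cinner y x = cinner y z) \<Longrightarrow> x = z"
  using cinner_self[of "x - z"] by (simp add: cinner_diff_right)

lemma bounded_linear_scaleC_left: "bounded_linear (\<lambda>a. a *\<^sub>C x)"
  by (rule bounded_linear_intro[where K = "norm x"])
    (simp_all add: scaleC_add_left scaleR_scaleC scaleC_scaleC scaleR_conv_of_real)

lemma bounded_linear_scaleC_right: "bounded_linear (\<lambda>x. a *\<^sub>C x)"
  by (rule bounded_linear_intro[where K = "cmod a"])
    (simp_all add: scaleC_add_right scaleR_scaleC scaleC_scaleC mult_ac)

section \<open>Diagonal operators between orthogonal families\<close>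

definition orthofam :: "(nat \<Rightarrow> 'h::complex_hilbert) \<Rightarrow> bool" where
  "orthofam a \<longleftrightarrow> (\<forall>i j. i \<noteq> j \<longrightarrow> cinner (a i) (a j) = 0) \<and> (\<forall>i. norm (a i) \<le> 1)"

lemma orthofam_orth: "orthofam a \<Longrightarrow> i \<noteq> j \<Longrightarrow> cinner (a i) (a j) = 0"
  by (simp add: orthofam_def)

lemma orthofam_norm: "orthofam a \<Longrightarrow> norm (a i) \<le> 1"
  by (simp add: orthofam_def)

lemma norm_sq_orthosum:
  assumes "orthofam a" "finite A"
  shows "(norm (\<Sum>i\<in>A. c i *\<^sub>C a i))\<^sup>2 = (\<Sum>i\<in>A. (cmod (c i) * norm (a i))\<^sup>2)"
  using assms(2)
proof (induction A)
  case (insert k A)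
  have "cinner (a k) (a i) = 0" if "i \<in> A" for i
    using that insert.hyps by (intro orthofam_orth[OF assms(1)]) auto
  then have "cinner (c k *\<^sub>C a k) (\<Sum>i\<in>A. c i *\<^sub>C a i) = 0"
    by (simp add: cinner_sum_right cinner_scaleC_left cinner_scaleC_right)
  with insert show ?case
    by (simp add: norm_sq_add)
qed simp

text \<open>For vectors shorter than 1 the sum \<open>p\<close> is not the orthogonal projection of
  x, but its squared norm is still at most the real part of the inner product of x and
  \<open>p\<close>, which is all that the expansion of the norm of \<open>x - p\<close>
  requires.\<close>

lemma bessel_finite:
  assumes a: "orthofam a" and "finite A"
  shows "(\<Sum>i\<in>A. (cmod (cinner (a i) x))\<^sup>2) \<le> (norm x)\<^sup>2"
proof -
  define p where "p = (\<Sum>i\<in>A. cinner (a i) x *\<^sub>C a i)"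
  have "cinner x p = (\<Sum>i\<in>A. complex_of_real ((cmod (cinner (a i) x))\<^sup>2))"
    unfolding p_def cinner_sum_right
    using cinner_commute[of x] by (intro sum.cong refl)
      (simp add: cinner_scaleC_right complex_norm_square del: of_real_power)
  then have 1: "Re (cinner x p) = (\<Sum>i\<in>A. (cmod (cinner (a i) x))\<^sup>2)"
    by simp
  have 2: "(norm p)\<^sup>2 \<le> (\<Sum>i\<in>A. (cmod (cinner (a i) x))\<^sup>2)"
    unfolding p_def norm_sq_orthosum[OF assms]
    by (intro sum_mono power_mono mult_left_le orthofam_norm[OF a]) auto
  have "0 \<le> (norm (x - p))\<^sup>2"
    by simp
  with 1 2 show ?thesis
    by (simp add: norm_sq_diff)
qed

lemma bessel_summable:
  assumes "orthofam a"
  shows "summable (\<lambda>i. (cmod (cinner (a i) x))\<^sup>2)" "(\<Sum>i. (cmod (cinner (a i) x))\<^sup>2) \<le> (norm x)\<^sup>2"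
proof -
  show 1: "summable (\<lambda>i. (cmod (cinner (a i) x))\<^sup>2)"
    using bessel_finite[OF assms] by (intro summableI_nonneg_bounded[where x = "(norm x)\<^sup>2"]) auto
  show "(\<Sum>i. (cmod (cinner (a i) x))\<^sup>2) \<le> (norm x)\<^sup>2"
    by (rule suminf_le_const[OF 1]) (auto intro: bessel_finite[OF assms])
qed

text \<open>By Pythagoras the squared norm of a block of the vector series is at most the
  corresponding block of the scalar series; completeness of the space does the rest.\<close>

lemma summable_orthofam:
  assumes b: "orthofam b" and c: "summable (\<lambda>i. (cmod (c i))\<^sup>2)"
  shows "summable (\<lambda>i. c i *\<^sub>C b i)"
    and "(norm (\<Sum>i. c i *\<^sub>C b i))\<^sup>2 \<le> (\<Sum>i. (cmod (c i))\<^sup>2)"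
proof -
  have le: "(norm (\<Sum>i\<in>A. c i *\<^sub>C b i))\<^sup>2 \<le> (\<Sum>i\<in>A. (cmod (c i))\<^sup>2)" if "finite A" for A
    unfolding norm_sq_orthosum[OF b that]
    by (intro sum_mono power_mono mult_left_le orthofam_norm[OF b]) auto
  show 1: "summable (\<lambda>i. c i *\<^sub>C b i)"
    unfolding summable_Cauchy
  proof (intro allI impI)
    fix e :: real
    assume "e > 0"
    then have "e\<^sup>2 > 0"
      by simp
    with c[unfolded summable_Cauchy] obtain N
      where N: "\<And>m n. m \<ge> N \<Longrightarrow> norm (\<Sum>i = m..<n. (cmod (c i))\<^sup>2) < e\<^sup>2"
      by blast
    have "norm (\<Sum>i = m..<n. c i *\<^sub>C b i) < e" if "m \<ge> N" for m n
    proof -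
      have "(norm (\<Sum>i = m..<n. c i *\<^sub>C b i))\<^sup>2 < e\<^sup>2"
        using le[of "{m..<n}"] N[OF that, of n] by (simp add: sum_nonneg)
      then show ?thesis
        using \<open>e > 0\<close> by (simp add: power2_less_imp_less)
    qed
    then show "\<exists>N. \<forall>m\<ge>N. \<forall>n. norm (\<Sum>i = m..<n. c i *\<^sub>C b i) < e"
      by blast
  qed
  have "(\<lambda>n. (norm (\<Sum>i<n. c i *\<^sub>C b i))\<^sup>2) \<longlonglongrightarrow> (norm (\<Sum>i. c i *\<^sub>C b i))\<^sup>2"
    by (intro tendsto_intros summable_LIMSEQ 1)
  then show "(norm (\<Sum>i. c i *\<^sub>C b i))\<^sup>2 \<le> (\<Sum>i. (cmod (c i))\<^sup>2)"
    by (rule LIMSEQ_le_const2)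
      (auto intro!: exI[of _ 0] order_trans[OF le] sum_le_suminf[OF c])
qed

text \<open>The arguments are ordered target, coefficients, source, so that the inner families
  cancel in a composition as in a product of matrices. Diagonal operators, partial isometries
  between families and singular value decompositions all have this form.\<close>

definition opr ::
    "(nat \<Rightarrow> 'h::complex_hilbert) \<Rightarrow> (nat \<Rightarrow> real) \<Rightarrow> (nat \<Rightarrow> 'h) \<Rightarrow> ('h \<Rightarrow>\<^sub>L 'h)" where
  "opr b \<xi> a = Blinfun (\<lambda>x. \<Sum>n. (complex_of_real (\<xi> n) * cinner (a n) x) *\<^sub>C b n)"

lemma diag_eq_opr: "diag e \<xi> = opr e \<xi> e"
  by (simp add: diag_def opr_def)

context
  fixes a b :: "nat \<Rightarrow> 'h::complex_hilbert" and \<xi> :: "nat \<Rightarrow> real" and M :: real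
  assumes a: "orthofam a" and b: "orthofam b" and bnd: "\<forall>n. \<bar>\<xi> n\<bar> \<le> M"
begin

private lemma M: "\<bar>\<xi> n\<bar> \<le> M"
  using bnd by blast

lemma opr_summable: "summable (\<lambda>n. (complex_of_real (\<xi> n) * cinner (a n) x) *\<^sub>C b n)" (is ?A)
  and opr_sum_norm:
    "norm (\<Sum>n. (complex_of_real (\<xi> n) * cinner (a n) x) *\<^sub>C b n) \<le> M * norm x" (is ?B)
proof -
  have M0: "M \<ge> 0"
    using M[of 0] by linarith
  let ?c = "\<lambda>n. complex_of_real (\<xi> n) * cinner (a n) x"
  have le: "(cmod (?c n))\<^sup>2 \<le> M\<^sup>2 * (cmod (cinner (a n) x))\<^sup>2" for n
    unfolding norm_mult power_mult_distrib
    using M[of n] by (intro mult_right_mono) (auto simp: abs_le_square_iff[symmetric] M0)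
  have s: "summable (\<lambda>n. M\<^sup>2 * (cmod (cinner (a n) x))\<^sup>2)"
    by (intro summable_mult bessel_summable a)
  have c: "summable (\<lambda>n. (cmod (?c n))\<^sup>2)"
    by (rule summable_comparison_test'[OF s]) (use le in auto)
  show ?A
    by (rule summable_orthofam(1)[OF b c])
  have "(norm (\<Sum>n. ?c n *\<^sub>C b n))\<^sup>2 \<le> (\<Sum>n. (cmod (?c n))\<^sup>2)"
    by (rule summable_orthofam(2)[OF b c])
  also have "\<dots> \<le> (\<Sum>n. M\<^sup>2 * (cmod (cinner (a n) x))\<^sup>2)"
    by (rule suminf_le[OF le c s])
  also have "\<dots> = M\<^sup>2 * (\<Sum>n. (cmod (cinner (a n) x))\<^sup>2)"
    by (intro suminf_mult bessel_summable a)
  also have "\<dots> \<le> (M * norm x)\<^sup>2"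
    unfolding power_mult_distrib by (intro mult_left_mono bessel_summable a) auto
  finally show ?B
    by (rule power2_le_imp_le) (simp add: M0)
qed

lemma opr_apply: "blinfun_apply (opr b \<xi> a) x = (\<Sum>n. (complex_of_real (\<xi> n) * cinner (a n) x) *\<^sub>C b n)"
proof -
  have "bounded_linear (\<lambda>x. \<Sum>n. (complex_of_real (\<xi> n) * cinner (a n) x) *\<^sub>C b n)"
  proof (rule bounded_linear_intro[where K = M])
    show "(\<Sum>n. (complex_of_real (\<xi> n) * cinner (a n) (x + y)) *\<^sub>C b n) =
      (\<Sum>n. (complex_of_real (\<xi> n) * cinner (a n) x) *\<^sub>C b n) +
      (\<Sum>n. (complex_of_real (\<xi> n) * cinner (a n) y) *\<^sub>C b n)" for x y
      by (subst suminf_add[OF opr_summable opr_summable])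
        (simp add: cinner_add_right distrib_left scaleC_add_left)
    show "(\<Sum>n. (complex_of_real (\<xi> n) * cinner (a n) (r *\<^sub>R x)) *\<^sub>C b n) =
      r *\<^sub>R (\<Sum>n. (complex_of_real (\<xi> n) * cinner (a n) x) *\<^sub>C b n)" for r x
      by (subst suminf_scaleR_right[OF opr_summable])
        (simp add: scaleR_scaleC scaleC_scaleC cinner_scaleC_right mult_ac)
  qed (use opr_sum_norm in \<open>simp add: mult.commute\<close>)
  then show ?thesis
    unfolding opr_def by (simp add: bounded_linear_Blinfun_apply)
qed

lemma norm_opr_apply: "norm (blinfun_apply (opr b \<xi> a) x) \<le> M * norm x"
  unfolding opr_apply by (rule opr_sum_norm)

lemma opr_in_B_ops: "opr b \<xi> a \<in> B_ops"
  unfolding B_ops_def mem_Collect_eq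
proof (intro allI)
  fix c x
  show "blinfun_apply (opr b \<xi> a) (c *\<^sub>C x) = c *\<^sub>C blinfun_apply (opr b \<xi> a) x"
    unfolding opr_apply
    by (subst bounded_linear.suminf[OF bounded_linear_scaleC_right opr_summable])
      (simp add: cinner_scaleC_right scaleC_scaleC mult_ac)
qed

lemma cinner_opr_sums:
  "(\<lambda>n. complex_of_real (\<xi> n) * cinner (a n) x * cinner y (b n)) sums
     cinner y (blinfun_apply (opr b \<xi> a) x)"
proof -
  have "(\<lambda>n. cinner y ((complex_of_real (\<xi> n) * cinner (a n) x) *\<^sub>C b n)) sums
      cinner y (blinfun_apply (opr b \<xi> a) x)"
    unfolding opr_apply
    by (intro bounded_linear.sums[OF bounded_linear_cinner_right] summable_sums opr_summable)
  then show ?thesis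
    by (simp add: cinner_scaleC_right)
qed

lemma cinner_opr_basis:
  "cinner (b k) (blinfun_apply (opr b \<xi> a) x) = complex_of_real (\<xi> k * (norm (b k))\<^sup>2) * cinner (a k) x"
proof -
  have "(\<lambda>n. complex_of_real (\<xi> n) * cinner (a n) x * cinner (b k) (b n)) =
      (\<lambda>n. if n = k then complex_of_real (\<xi> k * (norm (b k))\<^sup>2) * cinner (a k) x else 0)"
    using orthofam_orth[OF b] by (auto simp: cinner_self)
  then show ?thesis
    using sums_unique2[OF cinner_opr_sums[of x "b k"]]
      sums_single[of k "\<lambda>_. complex_of_real (\<xi> k * (norm (b k))\<^sup>2) * cinner (a k) x"]
    by auto
qed

lemma opr_apply_basis:
  "blinfun_apply (opr b \<xi> a) (a k) = complex_of_real (\<xi> k * (norm (a k))\<^sup>2) *\<^sub>C b k"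
proof -
  have "(\<lambda>n. (complex_of_real (\<xi> n) * cinner (a n) (a k)) *\<^sub>C b n) =
      (\<lambda>n. if n = k then complex_of_real (\<xi> k * (norm (a k))\<^sup>2) *\<^sub>C b k else 0)"
    using orthofam_orth[OF a] by (auto simp: cinner_self)
  then show ?thesis
    unfolding opr_apply
    using sums_unique[OF sums_single[of k "\<lambda>_. complex_of_real (\<xi> k * (norm (a k))\<^sup>2) *\<^sub>C b k"]]
    by auto
qed

end

lemma cinner_adj_opr:
  assumes "orthofam a" "orthofam b" "\<forall>n. \<bar>\<xi> n\<bar> \<le> M"
  shows "cinner (blinfun_apply (opr a \<xi> b) x) y = cinner x (blinfun_apply (opr b \<xi> a) y)"
proof -
  have "(\<lambda>n. cnj (complex_of_real (\<xi> n) * cinner (b n) x * cinner y (a n))) sums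
      cnj (cinner y (blinfun_apply (opr a \<xi> b) x))"
    unfolding sums_cnj by (rule cinner_opr_sums[OF assms(2,1,3)])
  then have "(\<lambda>n. complex_of_real (\<xi> n) * cinner (a n) y * cinner x (b n)) sums
      cinner (blinfun_apply (opr a \<xi> b) x) y"
    unfolding complex_cnj_mult cinner_commute[symmetric] by (simp add: mult_ac)
  then show ?thesis
    by (rule sums_unique2[OF _ cinner_opr_sums[OF assms, of y x]])
qed

text \<open>Uniqueness holds because the inner product separates points. The definite description is
  thus resolved wherever an adjoint can be written down, without the Riesz representation
  theorem.\<close>

lemma adj_eqI:
  assumes "\<And>x y. cinner (blinfun_apply Y x) y = cinner x (blinfun_apply X y)"
  shows "adj X = Y"
  unfolding adj_def
proof (rule the_equality)
  fix Z
  assume Z: "\<forall>x y. cinner (blinfun_apply Z x) y = cinner x (blinfun_apply X y)"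
  show "Z = Y"
  proof (rule blinfun_eqI, rule cinner_eqI)
    fix x y
    show "cinner y (blinfun_apply Z x) = cinner y (blinfun_apply Y x)"
      using Z assms cinner_commute[of y "blinfun_apply Z x"] cinner_commute[of y "blinfun_apply Y x"]
      by simp
  qed
qed (use assms in blast)

lemma adj_opr:
  assumes "orthofam a" "orthofam b" "\<forall>n. \<bar>\<xi> n\<bar> \<le> M"
  shows "adj (opr b \<xi> a) = opr a \<xi> b"
  by (rule adj_eqI) (rule cinner_adj_opr[OF assms])

text \<open>The n-th coefficient along \<open>b\<close> carries the factor of the squared norm of
  \<open>b n\<close>; it equals 1 by hypothesis, except where the product of the coefficients
  vanishes anyway.\<close>

lemma opr_compose:
  assumes a: "orthofam a" and b: "orthofam b" and c: "orthofam c"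
    and \<xi>: "\<forall>n. \<bar>\<xi> n\<bar> \<le> M" and \<eta>: "\<forall>n. \<bar>\<eta> n\<bar> \<le> L"
    and 1: "\<And>n. \<eta> n * \<xi> n \<noteq> 0 \<Longrightarrow> norm (b n) = 1"
  shows "opr c \<eta> b o\<^sub>L opr b \<xi> a = opr c (\<lambda>n. \<eta> n * \<xi> n) a"
proof (rule blinfun_eqI)
  fix x
  have *: "\<forall>n. \<bar>\<eta> n * \<xi> n\<bar> \<le> L * M"
    unfolding abs_mult using \<xi> \<eta> by (intro allI mult_mono) (auto intro: order_trans[OF abs_ge_zero])
  show "blinfun_apply (opr c \<eta> b o\<^sub>L opr b \<xi> a) x = blinfun_apply (opr c (\<lambda>n. \<eta> n * \<xi> n) a) x"
    unfolding blinfun_apply_blinfun_compose opr_apply[OF a c *] opr_apply[OF b c \<eta>]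
      cinner_opr_basis[OF a b \<xi>]
  proof (rule suminf_cong)
    fix n
    show "(complex_of_real (\<eta> n) * (complex_of_real (\<xi> n * (norm (b n))\<^sup>2) * cinner (a n) x)) *\<^sub>C c n
        = (complex_of_real (\<eta> n * \<xi> n) * cinner (a n) x) *\<^sub>C c n"
      using 1[of n] by (cases "\<eta> n * \<xi> n = 0") auto
  qed
qed

section \<open>Compact operators\<close>

lemma B_opsD: "T \<in> B_ops \<Longrightarrow> blinfun_apply T (c *\<^sub>C x) = c *\<^sub>C blinfun_apply T x"
  by (simp add: B_ops_def)

lemma B_ops_zero: "0 \<in> B_ops"
  by (simp add: B_ops_def)

lemma B_ops_add: "S \<in> B_ops \<Longrightarrow> T \<in> B_ops \<Longrightarrow> S + T \<in> B_ops"
  by (simp add: B_ops_def blinfun.add_left scaleC_add_right)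

lemma B_ops_compose: "S \<in> B_ops \<Longrightarrow> T \<in> B_ops \<Longrightarrow> S o\<^sub>L T \<in> B_ops"
  by (simp add: B_ops_def)

lemma compact_opsD:
  assumes "T \<in> compact_ops"
  shows "T \<in> B_ops" "compact (closure (blinfun_apply T ` cball 0 1))"
  using assms by (auto simp: compact_ops_def)

lemma compact_opsI:
  assumes "T \<in> B_ops" "compact K" "blinfun_apply T ` cball 0 1 \<subseteq> K"
  shows "T \<in> compact_ops"
proof -
  have "closure (blinfun_apply T ` cball 0 1) \<subseteq> K"
    using assms by (intro closure_minimal compact_imp_closed)
  then have "closure (blinfun_apply T ` cball 0 1) = K \<inter> closure (blinfun_apply T ` cball 0 1)"
    by blast
  then have "compact (closure (blinfun_apply T ` cball 0 1))"
    using compact_Int_closed[OF assms(2) closed_closure] by metis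
  then show ?thesis
    using assms(1) by (simp add: compact_ops_def)
qed

lemma compact_ops_zero: "0 \<in> compact_ops"
  by (rule compact_opsI[OF B_ops_zero, of "{0}"]) auto

lemma compact_ops_add:
  assumes "S \<in> compact_ops" "T \<in> compact_ops"
  shows "S + T \<in> compact_ops"
proof (rule compact_opsI[OF B_ops_add])
  show "compact {x + y |x y. x \<in> closure (blinfun_apply S ` cball 0 1) \<and>
      y \<in> closure (blinfun_apply T ` cball 0 1)}"
    by (intro compact_sums compact_opsD assms)
  show "blinfun_apply (S + T) ` cball 0 1 \<subseteq> {x + y |x y. x \<in> closure (blinfun_apply S ` cball 0 1) \<and>
      y \<in> closure (blinfun_apply T ` cball 0 1)}"
    by (auto simp: blinfun.add_left) (metis closure_subset image_eqI mem_cball_0 subsetD)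
qed (use assms compact_opsD in auto)

lemma compact_ops_compose_left:
  assumes "A \<in> B_ops" "T \<in> compact_ops"
  shows "A o\<^sub>L T \<in> compact_ops"
proof (rule compact_opsI[OF B_ops_compose])
  show "compact (blinfun_apply A ` closure (blinfun_apply T ` cball 0 1))"
    by (intro compact_continuous_image compact_opsD assms linear_continuous_on blinfun.bounded_linear_right)
  show "blinfun_apply (A o\<^sub>L T) ` cball 0 1 \<subseteq> blinfun_apply A ` closure (blinfun_apply T ` cball 0 1)"
    using closure_subset by fastforce
qed (use assms compact_opsD in auto)

lemma compact_ops_compose_right:
  assumes A: "A \<in> B_ops" and T: "T \<in> compact_ops"
  shows "T o\<^sub>L A \<in> compact_ops"
proof (rule compact_opsI[OF B_ops_compose])
  \<comment> \<open>The radius exceeds \<open>norm A\<close> by 1 so that it is invertible even for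
    \<open>A = 0\<close>.\<close>
  let ?r = "norm A + 1"
  have r: "?r > 0"
    by (simp add: add_nonneg_pos)
  show "compact ((\<lambda>x. ?r *\<^sub>R x) ` closure (blinfun_apply T ` cball 0 1))"
    by (intro compact_scaling compact_opsD T)
  show "blinfun_apply (T o\<^sub>L A) ` cball 0 1 \<subseteq> (\<lambda>x. ?r *\<^sub>R x) ` closure (blinfun_apply T ` cball 0 1)"
  proof clarify
    fix x :: 'a
    assume "x \<in> cball 0 1"
    then have "norm (blinfun_apply A x) \<le> norm A"
      using norm_blinfun[of A x] mult_left_le[of "norm x" "norm A"] by simp
    then have "norm (inverse ?r *\<^sub>R blinfun_apply A x) \<le> 1"
      using r by (simp add: field_simps)
    then have "blinfun_apply T (inverse ?r *\<^sub>R blinfun_apply A x) \<in> closure (blinfun_apply T ` cball 0 1)"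
      using closure_subset by fastforce
    moreover have "blinfun_apply (T o\<^sub>L A) x = ?r *\<^sub>R blinfun_apply T (inverse ?r *\<^sub>R blinfun_apply A x)"
      using r by (simp add: blinfun.scaleR_right)
    ultimately show "blinfun_apply (T o\<^sub>L A) x \<in> (\<lambda>x. ?r *\<^sub>R x) ` closure (blinfun_apply T ` cball 0 1)"
      by blast
  qed
qed (use assms compact_opsD in auto)

text \<open>Total boundedness: a finite \<epsilon>/3-net for the image of the unit ball under
  \<open>S\<close> is a 2\<epsilon>/3-net for its image under \<open>T\<close>. Closed balls make
  the finite union closed, so that it contains the closure as well.\<close>

lemma compact_ops_limit:
  assumes T: "T \<in> B_ops"
    and lim: "\<And>\<epsilon>. \<epsilon> > 0 \<Longrightarrow>
      \<exists>S\<in>compact_ops. \<forall>x. norm x \<le> 1 \<longrightarrow> norm (blinfun_apply T x - blinfun_apply S x) \<le> \<epsilon>"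
  shows "T \<in> compact_ops"
proof -
  let ?A = "closure (blinfun_apply T ` cball 0 1)"
  have "\<exists>k. finite k \<and> ?A \<subseteq> (\<Union>x\<in>k. ball x \<epsilon>)" if "\<epsilon> > 0" for \<epsilon>
  proof -
    from lim[of "\<epsilon> / 3"] that obtain S where S: "S \<in> compact_ops"
      and le: "\<And>x. norm x \<le> 1 \<Longrightarrow> norm (blinfun_apply T x - blinfun_apply S x) \<le> \<epsilon> / 3"
      by auto
    have "\<forall>e>0. \<exists>k. finite k \<and> closure (blinfun_apply S ` cball 0 1) \<subseteq> (\<Union>x\<in>k. ball x e)"
      using compact_opsD(2)[OF S] unfolding compact_eq_totally_bounded by (rule conjunct2)
    from this[rule_format, of "\<epsilon> / 3"] that obtain k
      where k: "finite k" "closure (blinfun_apply S ` cball 0 1) \<subseteq> (\<Union>x\<in>k. ball x (\<epsilon> / 3))"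
      by auto
    have "blinfun_apply T ` cball 0 1 \<subseteq> (\<Union>x\<in>k. cball x (2 * \<epsilon> / 3))"
    proof clarify
      fix x :: 'a
      assume x: "x \<in> cball 0 1"
      then have "blinfun_apply S x \<in> closure (blinfun_apply S ` cball 0 1)"
        by (intro subsetD[OF closure_subset] imageI)
      then have "blinfun_apply S x \<in> (\<Union>x\<in>k. ball x (\<epsilon> / 3))"
        by (rule subsetD[OF k(2)])
      then obtain z where z: "z \<in> k" "dist z (blinfun_apply S x) < \<epsilon> / 3"
        by auto
      have "dist z (blinfun_apply T x) \<le>
          dist z (blinfun_apply S x) + dist (blinfun_apply S x) (blinfun_apply T x)"
        by (rule dist_triangle)
      also have "dist (blinfun_apply S x) (blinfun_apply T x) \<le> \<epsilon> / 3"
        using le[of x] x by (simp add: dist_norm norm_minus_commute)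
      finally have "blinfun_apply T x \<in> cball z (2 * \<epsilon> / 3)"
        using z(2) by simp
      with z(1) show "blinfun_apply T x \<in> (\<Union>x\<in>k. cball x (2 * \<epsilon> / 3))"
        by (rule UN_I)
    qed
    then have "?A \<subseteq> (\<Union>x\<in>k. cball x (2 * \<epsilon> / 3))"
      using k by (intro closure_minimal) auto
    also have "\<dots> \<subseteq> (\<Union>x\<in>k. ball x \<epsilon>)"
      using that by fastforce
    finally show ?thesis
      using k by blast
  qed
  then have "compact ?A"
    unfolding compact_eq_totally_bounded by (simp add: complete_eq_closed)
  with T show ?thesis
    by (simp add: compact_ops_def)
qed

lemma compact_bounded_combinations:
  fixes N :: nat
  shows "compact {\<Sum>n<N. c n *\<^sub>C b n | c. \<forall>n. cmod (c n) \<le> M}"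
proof (induction N)
  case 0
  have "{\<Sum>n<0. c n *\<^sub>C b n | c. \<forall>n. cmod (c n) \<le> M} \<subseteq> {0}"
    by auto
  then show ?case
    by (meson finite.emptyI finite_imp_compact finite_insert finite_subset)
next
  case (Suc N)
  have "{\<Sum>n<Suc N. c n *\<^sub>C b n | c. \<forall>n. cmod (c n) \<le> M} =
      {x + y | x y. x \<in> {\<Sum>n<N. c n *\<^sub>C b n | c. \<forall>n. cmod (c n) \<le> M} \<and>
        y \<in> (\<lambda>z. z *\<^sub>C b N) ` cball 0 M}" (is "?L = ?R")
  proof
    show "?L \<subseteq> ?R"
      by fastforce
    show "?R \<subseteq> ?L"
    proof clarify
      fix c :: "nat \<Rightarrow> complex" and z :: complex
      assume "\<forall>n. cmod (c n) \<le> M" "z \<in> cball 0 M"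
      then show "\<exists>d. (\<Sum>n<N. c n *\<^sub>C b n) + z *\<^sub>C b N = (\<Sum>n<Suc N. d n *\<^sub>C b n) \<and> (\<forall>n. cmod (d n) \<le> M)"
        by (intro exI[of _ "c(N := z)"]) auto
    qed
  qed
  moreover have "compact ?R"
    by (intro compact_sums Suc compact_continuous_image linear_continuous_on
        bounded_linear_scaleC_left) auto
  ultimately show ?case
    by simp
qed

lemma finite_rank_compact:
  fixes N :: nat
  assumes T: "T \<in> B_ops" and "\<And>x. norm x \<le> 1 \<Longrightarrow> \<forall>n. cmod (c x n) \<le> M"
    and "\<And>x. blinfun_apply T x = (\<Sum>n<N. c x n *\<^sub>C b n)"
  shows "T \<in> compact_ops"
  by (rule compact_opsI[OF T compact_bounded_combinations[where N = N and b = b and M = M]]) (use assms in fastforce)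

lemma c0_starD:
  assumes "\<xi> \<in> c0_star"
  shows "0 \<le> \<xi> n" "m \<le> n \<Longrightarrow> \<xi> n \<le> \<xi> m" "\<xi> \<longlonglongrightarrow> 0" "\<forall>n. \<bar>\<xi> n\<bar> \<le> \<xi> 0"
  using assms by (auto simp: c0_star_def decseq_def)

text \<open>Not decreasing in general, hence outside \<open>c0_star\<close>. The operator lemmas
  assume bounded coefficients only, so they cover such truncations.\<close>

definition tail :: "nat \<Rightarrow> (nat \<Rightarrow> real) \<Rightarrow> nat \<Rightarrow> real" where
  "tail N \<xi> n = (if n < N then 0 else \<xi> n)"

lemma tail_bound:
  assumes "\<xi> \<in> c0_star"
  shows "\<forall>n. \<bar>tail N \<xi> n\<bar> \<le> \<xi> N"
  using c0_starD[OF assms] by (auto simp: tail_def)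

lemma opr_split_tail:
  assumes \<xi>: "\<xi> \<in> c0_star" and a: "orthofam a" and b: "orthofam b"
  shows "blinfun_apply (opr b \<xi> a) x =
    (\<Sum>n<N. (complex_of_real (\<xi> n) * cinner (a n) x) *\<^sub>C b n) + blinfun_apply (opr b (tail N \<xi>) a) x"
proof -
  let ?f = "\<lambda>n. (complex_of_real (\<xi> n) * cinner (a n) x) *\<^sub>C b n"
  let ?g = "\<lambda>n. (complex_of_real (tail N \<xi> n) * cinner (a n) x) *\<^sub>C b n"
  have g: "?g sums blinfun_apply (opr b (tail N \<xi>) a) x"
    using opr_summable[OF a b tail_bound[OF \<xi>]] opr_apply[OF a b tail_bound[OF \<xi>]]
    by (simp add: summable_sums)
  have "(\<lambda>n. if n \<in> {..<N} then ?f n else 0) sums (\<Sum>n<N. ?f n)"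
    by (rule sums_If_finite_set) simp
  from sums_add[OF this g] have "(\<lambda>n. (if n \<in> {..<N} then ?f n else 0) + ?g n) sums
      ((\<Sum>n<N. ?f n) + blinfun_apply (opr b (tail N \<xi>) a) x)" .
  also have "(\<lambda>n. (if n \<in> {..<N} then ?f n else 0) + ?g n) = ?f"
    by (auto simp: tail_def)
  finally show ?thesis
    unfolding opr_apply[OF a b c0_starD(4)[OF \<xi>]] by (rule sums_unique[symmetric])
qed

text \<open>The upper half of the min-max principle: N linear conditions on x, namely orthogonality
  to the first N vectors of the source family, bring the norm down to the coefficient with index
  N.\<close>

lemma norm_opr_tail:
  assumes "\<xi> \<in> c0_star" "orthofam a" "orthofam b" "\<And>n. n < N \<Longrightarrow> cinner (a n) x = 0"
  shows "norm (blinfun_apply (opr b \<xi> a) x) \<le> \<xi> N * norm x"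
  using opr_split_tail[OF assms(1-3), of x N] norm_opr_apply[OF assms(2,3) tail_bound[OF assms(1), of N], of x]
    assms(4) by simp

lemma opr_compact:
  assumes \<xi>: "\<xi> \<in> c0_star" and a: "orthofam a" and b: "orthofam b"
  shows "opr b \<xi> a \<in> compact_ops"
proof (rule compact_ops_limit)
  note bd = c0_starD(4)[OF \<xi>]
  show "opr b \<xi> a \<in> B_ops"
    by (rule opr_in_B_ops[OF a b bd])
  fix \<epsilon> :: real
  assume "\<epsilon> > 0"
  from LIMSEQ_D[OF c0_starD(3)[OF \<xi>] this] obtain N where "\<bar>\<xi> N\<bar> < \<epsilon>"
    by force
  then have N: "\<xi> N \<le> \<epsilon>" by simp
  define \<eta> where "\<eta> = (\<lambda>n. if n < N then \<xi> n else 0)"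
  have \<eta>: "\<forall>n. \<bar>\<eta> n\<bar> \<le> \<xi> 0"
    using bd c0_starD(1)[OF \<xi>] by (auto simp: \<eta>_def)
  have \<eta>_apply: "blinfun_apply (opr b \<eta> a) x = (\<Sum>n<N. (complex_of_real (\<xi> n) * cinner (a n) x) *\<^sub>C b n)" for x
  proof -
    have "(\<Sum>n. (complex_of_real (\<eta> n) * cinner (a n) x) *\<^sub>C b n) =
        (\<Sum>n<N. (complex_of_real (\<eta> n) * cinner (a n) x) *\<^sub>C b n)"
      by (rule suminf_finite) (auto simp: \<eta>_def)
    then show ?thesis
      by (simp add: opr_apply[OF a b \<eta>]) (simp add: \<eta>_def)
  qed
  have "cmod (complex_of_real (\<xi> n) * cinner (a n) x) \<le> \<xi> 0" if "norm x \<le> 1" for n x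
  proof -
    have "cmod (cinner (a n) x) \<le> 1"
      using norm_cinner_le[of "a n" x] mult_mono[OF orthofam_norm[OF a, of n] that] by simp
    then show ?thesis
      using bd[rule_format, of n] c0_starD(1)[OF \<xi>, of 0]
      by (simp add: norm_mult) (metis mult.right_neutral mult_mono norm_ge_zero abs_ge_zero)
  qed
  then have "opr b \<eta> a \<in> compact_ops"
    by (intro finite_rank_compact[OF opr_in_B_ops[OF a b \<eta>] _ \<eta>_apply, where M = "\<xi> 0"]) auto
  moreover have "norm (blinfun_apply (opr b \<xi> a) x - blinfun_apply (opr b \<eta> a) x) \<le> \<epsilon>" if "norm x \<le> 1" for x
  proof -
    have "norm (blinfun_apply (opr b \<xi> a) x - blinfun_apply (opr b \<eta> a) x) \<le> \<xi> N * norm x"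
      using opr_split_tail[OF \<xi> a b, of x N] norm_opr_apply[OF a b tail_bound[OF \<xi>, of N], of x]
      by (simp add: \<eta>_apply)
    also have "\<dots> \<le> \<epsilon> * 1"
      using N that \<open>\<epsilon> > 0\<close> by (intro mult_mono) auto
    finally show ?thesis
      by simp
  qed
  ultimately show "\<exists>S\<in>compact_ops. \<forall>x. norm x \<le> 1 \<longrightarrow>
      norm (blinfun_apply (opr b \<xi> a) x - blinfun_apply S x) \<le> \<epsilon>"
    by blast
qed

section \<open>Singular value decomposition\<close>

text \<open>A maximising sequence of unit vectors may be assumed to have convergent images; the
  parallelogram law then makes the sequence itself Cauchy.\<close>

lemma compact_op_attains_norm:
  assumes X: "X \<in> compact_ops" and "X \<noteq> 0"
  shows "\<exists>f. norm f = 1 \<and> norm (blinfun_apply X f) = norm X"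
proof -
  define s where "s = norm X"
  have s: "s > 0"
    using assms by (simp add: s_def)
  have ex: "\<exists>x. norm x = 1 \<and> norm (blinfun_apply X x) > s - d" if "d > 0" for d
  proof (rule ccontr)
    assume "\<not> ?thesis"
    then have le: "norm (blinfun_apply X x) \<le> s - d" if "norm x = 1" for x
      using that by force
    have "norm (blinfun_apply X x) \<le> max 0 (s - d) * norm x" for x
    proof (cases "x = 0")
      case False
      have "norm (blinfun_apply X (inverse (norm x) *\<^sub>R x)) \<le> s - d"
        using False by (intro le) simp
      then have "norm (blinfun_apply X x) \<le> (s - d) * norm x"
        using False by (simp add: blinfun.scaleR_right field_simps)
      also have "\<dots> \<le> max 0 (s - d) * norm x"
        by (intro mult_right_mono) auto
      finally show ?thesis .
    qed simp
    then have "norm X \<le> max 0 (s - d)"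
      by (intro norm_blinfun_bound) auto
    then show False
      using that s by (simp add: s_def max_def split: if_splits)
  qed
  have "\<forall>n::nat. \<exists>x. norm x = 1 \<and> norm (blinfun_apply X x) > s - inverse (real (Suc n))"
    by (intro allI ex) simp
  then obtain x where x1: "\<And>n. norm (x n) = 1"
    and xs: "\<And>n. norm (blinfun_apply X (x n)) > s - inverse (real (Suc n))"
    by metis
  have "blinfun_apply X (x n) \<in> closure (blinfun_apply X ` cball 0 1)" for n
    using x1[of n] closure_subset by fastforce
  then obtain z r where r: "strict_mono (r :: nat \<Rightarrow> nat)"
    and z: "((\<lambda>n. blinfun_apply X (x n)) \<circ> r) \<longlonglongrightarrow> z"
    using seq_compactE[OF compact_imp_seq_compact[OF compact_opsD(2)[OF X]],
        of "\<lambda>n. blinfun_apply X (x n)"] by blast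
  define y where "y = x \<circ> r"
  have y1: "norm (y n) = 1" for n
    by (simp add: y_def x1)
  have yz: "(\<lambda>n. blinfun_apply X (y n)) \<longlonglongrightarrow> z"
    using z by (simp add: y_def o_def)
  have "(\<lambda>n. norm (blinfun_apply X (x n))) \<longlonglongrightarrow> s"
  proof (rule tendsto_sandwich)
    show "(\<lambda>n. s - inverse (real (Suc n))) \<longlonglongrightarrow> s"
      using tendsto_diff[OF tendsto_const LIMSEQ_inverse_real_of_nat, of s] by simp
    show "\<forall>\<^sub>F n in sequentially. norm (blinfun_apply X (x n)) \<le> s"
    proof (intro always_eventually allI)
      show "norm (blinfun_apply X (x n)) \<le> s" for n
        using norm_blinfun[of X "x n"] x1[of n] by (simp add: s_def)
    qed
  qed (use xs in \<open>auto intro: always_eventually less_imp_le\<close>)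
  then have "(\<lambda>n. norm (blinfun_apply X (y n))) \<longlonglongrightarrow> s"
    using LIMSEQ_subseq_LIMSEQ[OF _ r, of "\<lambda>n. norm (blinfun_apply X (x n))"] by (simp add: y_def o_def)
  then have nz: "norm z = s"
    using LIMSEQ_unique tendsto_norm[OF yz] by blast
  have "Cauchy y"
  proof (rule CauchyI)
    fix \<epsilon> :: real
    assume \<epsilon>: "\<epsilon> > 0"
    \<comment> \<open>With images within s t/2 of \<open>z\<close>, the norm of
      \<open>y m + y n\<close> is at least 2 - t, so the parallelogram law bounds the squared norm
      of the difference by 4 - (2 - t)^2 \<le> 4 t \<le> \<epsilon>^2/2. The minimum with 1 keeps 2
      - t positive.\<close>
    define t where "t = min 1 (\<epsilon>\<^sup>2 / 8)"
    have t: "t > 0" "t \<le> 1" "t \<le> \<epsilon>\<^sup>2 / 8"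
      using \<epsilon> by (auto simp: t_def)
    have "s * t / 2 > 0"
      using s t by simp
    from LIMSEQ_D[OF yz this] obtain M
      where M: "\<And>n. n \<ge> M \<Longrightarrow> norm (blinfun_apply X (y n) - z) < s * t / 2"
      by blast
    have "norm (y m - y n) < \<epsilon>" if "m \<ge> M" "n \<ge> M" for m n
    proof -
      have "2 * s = norm (z + z)"
        using nz by (simp flip: scaleR_2)
      also have "z + z = blinfun_apply X (y m + y n) - (blinfun_apply X (y m) - z) - (blinfun_apply X (y n) - z)"
        by (simp add: blinfun.add_right)
      also have "norm \<dots> \<le> norm (blinfun_apply X (y m + y n)) + norm (blinfun_apply X (y m) - z)
          + norm (blinfun_apply X (y n) - z)"
        using norm_triangle_ineq4[of
            "blinfun_apply X (y m + y n) - (blinfun_apply X (y m) - z)" "blinfun_apply X (y n) - z"]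
          norm_triangle_ineq4[of "blinfun_apply X (y m + y n)" "blinfun_apply X (y m) - z"]
        by linarith
      also have "\<dots> \<le> s * norm (y m + y n) + s * t"
        using M[OF that(1)] M[OF that(2)] norm_blinfun[of X "y m + y n"] by (simp add: s_def)
      finally have "s * 2 \<le> s * (norm (y m + y n) + t)"
        by (simp add: algebra_simps)
      then have "2 - t \<le> norm (y m + y n)"
        using s by simp
      then have "(2 - t)\<^sup>2 \<le> (norm (y m + y n))\<^sup>2"
        using t by (intro power_mono) auto
      moreover have "(2 - t)\<^sup>2 \<ge> 4 - 4 * t"
        by (simp add: power2_eq_square algebra_simps)
      moreover have "(norm (y m - y n))\<^sup>2 = 4 - (norm (y m + y n))\<^sup>2"
        by (simp add: norm_sq_add norm_sq_diff y1)
      moreover have "\<epsilon>\<^sup>2 > 0"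
        using \<epsilon> by simp
      ultimately have "(norm (y m - y n))\<^sup>2 < \<epsilon>\<^sup>2"
        using t by linarith
      then show ?thesis
        using \<epsilon> by (simp add: power2_less_imp_less)
    qed
    then show "\<exists>M. \<forall>m\<ge>M. \<forall>n\<ge>M. norm (y m - y n) < \<epsilon>"
      by blast
  qed
  then obtain f where f: "y \<longlonglongrightarrow> f"
    using Cauchy_convergent convergent_def by blast
  have "norm f = 1"
    using tendsto_norm[OF f] y1 by (simp add: LIMSEQ_const_iff)
  moreover have "(\<lambda>n. blinfun_apply X (y n)) \<longlonglongrightarrow> blinfun_apply X f"
    by (intro tendsto_intros f)
  then have "blinfun_apply X f = z"
    using yz LIMSEQ_unique by blast
  ultimately show ?thesis
    using nz s_def by auto
qed

text \<open>First-order optimality of the maximiser, that is, \<open>X\<^sup>*X f = \<parallel>X\<parallel>\<^sup>2 f\<close> without the adjoint.\<close>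

lemma cinner_maximiser:
  assumes X: "X \<in> B_ops" and f: "norm f = 1" and max: "norm (blinfun_apply X f) = norm X"
  shows "cinner (blinfun_apply X f) (blinfun_apply X y) = complex_of_real ((norm X)\<^sup>2) * cinner f y"
proof -
  define w where "w = y - cinner f y *\<^sub>C f"
  define c where "c = cinner (blinfun_apply X f) (blinfun_apply X w)"
  have fw: "cinner f w = 0"
    by (simp add: w_def cinner_diff_right cinner_scaleC_right cinner_self f)
  have "c = 0"
  proof (rule ccontr)
    assume "c \<noteq> 0"
    define K where "K = (norm X)\<^sup>2 * (norm w)\<^sup>2"
    \<comment> \<open>Moving from \<open>f\<close> along \<open>v\<close> increases the squared norm
      of the image by 2 t |c|^2 to first order, while the operator norm permits only t^2 |c|^2 K.
      Since t K < 1, this is impossible.\<close>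
    define t where "t = 1 / (K + 1)"
    have K: "K \<ge> 0"
      by (simp add: K_def)
    then have t: "t > 0"
      by (simp add: t_def)
    define v where "v = (complex_of_real t * cnj c) *\<^sub>C w"
    have 1: "cinner (blinfun_apply X f) (blinfun_apply X v) = complex_of_real (t * (cmod c)\<^sup>2)"
    proof -
      have "cinner (blinfun_apply X f) (blinfun_apply X v) = complex_of_real t * (c * cnj c)"
        by (simp add: v_def B_opsD[OF X] cinner_scaleC_right c_def)
      then show ?thesis
        by (simp add: complex_norm_square[symmetric] del: of_real_power)
    qed
    have "(norm (blinfun_apply X (f + v)))\<^sup>2 \<le> (norm X * norm (f + v))\<^sup>2"
      by (intro power_mono norm_blinfun) simp
    also have "\<dots> = (norm X)\<^sup>2 * (1 + (norm v)\<^sup>2)"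
      by (simp add: power_mult_distrib norm_sq_add f) (simp add: v_def cinner_scaleC_right fw)
    finally have "2 * (t * (cmod c)\<^sup>2) + (norm (blinfun_apply X v))\<^sup>2 \<le> (norm X)\<^sup>2 * (norm v)\<^sup>2"
      by (simp add: blinfun.add_right norm_sq_add 1 max distrib_left)
    then have "2 * (t * (cmod c)\<^sup>2) \<le> (norm X)\<^sup>2 * (norm v)\<^sup>2"
      using zero_le_power2[of "norm (blinfun_apply X v)"] by linarith
    also have "\<dots> = (t * (cmod c)\<^sup>2) * (t * K)"
      by (simp add: v_def K_def norm_mult power_mult_distrib power2_eq_square)
    finally have "2 \<le> t * K"
      using t \<open>c \<noteq> 0\<close> by (simp add: mult.commute[of 2])
    then show False
      using K by (simp add: t_def field_simps)
  qed
  then have "cinner (blinfun_apply X f) (blinfun_apply X y) =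
      cinner f y * cinner (blinfun_apply X f) (blinfun_apply X f)"
    by (simp add: c_def w_def blinfun.diff_right B_opsD[OF X] cinner_diff_right cinner_scaleC_right)
  then show ?thesis
    by (simp add: cinner_self max mult.commute)
qed

definition svd ::
    "('h::complex_hilbert \<Rightarrow>\<^sub>L 'h) \<Rightarrow> (nat \<Rightarrow> real) \<Rightarrow> (nat \<Rightarrow> 'h) \<Rightarrow> (nat \<Rightarrow> 'h) \<Rightarrow> bool" where
  "svd X s b a \<longleftrightarrow> X = opr b s a \<and> s \<in> c0_star \<and> orthofam b \<and> orthofam a \<and>
     (\<forall>n. s n \<noteq> 0 \<longrightarrow> norm (b n) = 1 \<and> norm (a n) = 1)"

lemma norm_sub_proj_le:
  assumes "norm f \<le> 1"
  shows "norm (x - cinner f x *\<^sub>C f) \<le> norm x"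
proof (rule power2_le_imp_le)
  have "cinner x (cinner f x *\<^sub>C f) = complex_of_real ((cmod (cinner f x))\<^sup>2)"
    using cinner_commute[of x f] by (simp add: cinner_scaleC_right complex_norm_square del: of_real_power)
  then have "(norm (x - cinner f x *\<^sub>C f))\<^sup>2 =
      (norm x)\<^sup>2 - 2 * (cmod (cinner f x))\<^sup>2 + (cmod (cinner f x))\<^sup>2 * (norm f)\<^sup>2"
    by (simp add: norm_sq_diff power_mult_distrib)
  also have "(cmod (cinner f x))\<^sup>2 * (norm f)\<^sup>2 \<le> (cmod (cinner f x))\<^sup>2"
    using assms by (intro mult_left_le) (auto simp: power_le_one)
  finally show "(norm (x - cinner f x *\<^sub>C f))\<^sup>2 \<le> (norm x)\<^sup>2"
    using zero_le_power2[of "cmod (cinner f x)"] by linarith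
qed simp

text \<open>For a unit vector this is the projection onto the orthogonal complement; for
  \<open>f = 0\<close> it is the identity, so the deflation below simply stands still once the
  operator has become 0.\<close>

definition coproj :: "'h::complex_hilbert \<Rightarrow> ('h \<Rightarrow>\<^sub>L 'h)" where
  "coproj f = Blinfun (\<lambda>x. x - cinner f x *\<^sub>C f)"

lemma coproj_apply: "blinfun_apply (coproj f) x = x - cinner f x *\<^sub>C f"
  unfolding coproj_def
  by (subst bounded_linear_Blinfun_apply)
    (intro bounded_linear_sub bounded_linear_ident bounded_linear_cinner_right
      bounded_linear_compose[OF bounded_linear_scaleC_left bounded_linear_cinner_right] refl)+

lemma coproj_B_ops: "coproj f \<in> B_ops"
  by (simp add: B_ops_def coproj_apply cinner_scaleC_right cvec.scale_right_diff_distrib scaleC_scaleC)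

text \<open>Deflation: a maximiser of the norm is projected away, and the norms of the successive
  remainders become the singular values. First-order optimality makes both the maximisers and their
  images orthogonal. If the norms had a positive limit L, the images would be an orthogonal sequence
  of vectors of length at least L inside a compact set, with no Cauchy subsequence.\<close>

lemma svd_exists:
  fixes X :: "'h::complex_hilbert \<Rightarrow>\<^sub>L 'h"
  assumes "X \<in> compact_ops"
  shows "\<exists>s b a. svd X s b a"
proof -
  have "\<forall>Y\<in>(compact_ops :: ('h \<Rightarrow>\<^sub>L 'h) set). \<exists>f.
      if Y = 0 then f = 0 else norm f = 1 \<and> norm (blinfun_apply Y f) = norm Y"
  proof
    fix Y :: "'h \<Rightarrow>\<^sub>L 'h"
    assume "Y \<in> compact_ops"
    then show "\<exists>f. if Y = 0 then f = 0 else norm f = 1 \<and> norm (blinfun_apply Y f) = norm Y"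
      using compact_op_attains_norm[of Y] by (cases "Y = 0") auto
  qed
  from bchoice[OF this] obtain g :: "('h \<Rightarrow>\<^sub>L 'h) \<Rightarrow> 'h" where g: "\<And>Y. Y \<in> compact_ops \<Longrightarrow>
      if Y = 0 then g Y = 0 else norm (g Y) = 1 \<and> norm (blinfun_apply Y (g Y)) = norm Y"
    by blast
  define Xs where "Xs k = ((\<lambda>Y. Y o\<^sub>L coproj (g Y)) ^^ k) X" for k
  have Xs_0: "Xs 0 = X" and Xs_Suc: "Xs (Suc k) = Xs k o\<^sub>L coproj (g (Xs k))" for k
    by (simp_all add: Xs_def)
  define f where "f k = g (Xs k)" for k
  define s where "s k = norm (Xs k)" for k
  define u where "u k = blinfun_apply (Xs k) (f k)" for k
  have Xs_C: "Xs k \<in> compact_ops" for k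
    by (induction k) (auto simp: Xs_0 Xs_Suc assms intro: compact_ops_compose_right coproj_B_ops)
  have Xs_B: "Xs k \<in> B_ops" for k
    using Xs_C compact_opsD by blast
  have f0: "f k = 0" if "s k = 0" for k
    using g[OF Xs_C[of k]] that by (simp add: f_def s_def)
  have f1: "norm (f k) = 1" if "s k \<noteq> 0" for k
    using g[OF Xs_C[of k]] that by (simp add: f_def s_def)
  have nu: "norm (u k) = s k" for k
    using g[OF Xs_C[of k]] f0[of k] by (cases "s k = 0") (auto simp: f_def s_def u_def)
  have f_le: "norm (f k) \<le> 1" for k
    using f0[of k] f1[of k] by (cases "s k = 0") auto
  have step: "blinfun_apply (Xs (Suc k)) x = blinfun_apply (Xs k) x - cinner (f k) x *\<^sub>C u k" for k x
    by (simp add: Xs_Suc coproj_apply blinfun.diff_right B_opsD[OF Xs_B] f_def u_def)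
  have "norm (coproj (f k)) \<le> 1" for k
    by (rule norm_blinfun_bound) (simp_all add: coproj_apply norm_sub_proj_le f_le)
  then have "s (Suc k) \<le> s k" for k
    using norm_blinfun_compose[of "Xs k" "coproj (f k)"] mult_left_le[of "norm (coproj (f k))" "norm (Xs k)"]
    by (auto simp: s_def Xs_Suc f_def intro: order_trans)
  then have dec: "decseq s"
    by (simp add: decseq_Suc_iff)
  have opt: "cinner (u k) (blinfun_apply (Xs k) y) = complex_of_real ((s k)\<^sup>2) * cinner (f k) y" for k y
  proof (cases "s k = 0")
    case False
    then show ?thesis
      using cinner_maximiser[OF Xs_B[of k] f1[OF False], where y = y] nu[of k] by (simp add: u_def s_def)
  qed (use nu[of k] in auto)
  \<comment> \<open>The source of orthogonality: whatever the k-th remainder annihilates is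
    orthogonal to its maximiser, and it annihilates all earlier maximisers.\<close>
  have ff': "cinner (f k) y = 0" if "blinfun_apply (Xs k) y = 0" for k y
    using opt[of k y] that f0[of k] by (cases "s k = 0") auto
  have Xf: "blinfun_apply (Xs k) (f j) = 0" if "j < k" for j k
    using that
  proof (induction k)
    case (Suc k)
    show ?case
    proof (cases "j = k")
      case True
      then show ?thesis
        using f0[of k] f1[of k] nu[of k]
        by (cases "s k = 0") (auto simp: step cinner_self u_def[symmetric])
    next
      case False
      then have "blinfun_apply (Xs k) (f j) = 0"
        using Suc by auto
      with ff'[OF this] show ?thesis
        by (simp add: step)
    qed
  qed simp
  have ff: "cinner (f k) (f j) = 0" if "j \<noteq> k" for j k
  proof (cases "j < k")
    case True
    then show ?thesis by (intro ff' Xf)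
  next
    case False
    then have "cinner (f j) (f k) = 0"
      using that by (intro ff' Xf) auto
    then show ?thesis
      using cinner_commute[of "f k" "f j"] by simp
  qed
  \<comment> \<open>Earlier projections do not move later maximisers. For \<open>j = 0\<close> this
    says that \<open>u k\<close> is the image of \<open>f k\<close> under the original operator,
    which makes its compactness applicable.\<close>
  have Xu: "blinfun_apply (Xs j) (f k) = u k" if "j \<le> k" for j k
    using that
  proof (induction rule: inc_induct)
    case (step j)
    then show ?case
      using ff[of k j] \<open>\<And>k x. blinfun_apply (Xs (Suc k)) x = _ k x\<close>[of j "f k"] by auto
  qed (simp add: u_def)
  have uu_less: "cinner (u j) (u k) = 0" if "j < k" for j k
    using opt[of j "f k"] Xu[of j k] ff[of k j] that by auto
  have uu: "cinner (u j) (u k) = 0" if "j \<noteq> k" for j k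
    using uu_less[of j k] uu_less[of k j] cinner_commute[of "u j" "u k"] that
    by (cases "j < k") auto
  have tele: "blinfun_apply X x = (\<Sum>j<k. cinner (f j) x *\<^sub>C u j) + blinfun_apply (Xs k) x" for k x
    by (induction k) (simp_all add: Xs_0 step)
  have s_nonneg: "s k \<ge> 0" for k
    by (simp add: s_def)
  obtain L where L: "s \<longlonglongrightarrow> L" "\<And>k. L \<le> s k"
    using decseq_convergent[OF dec, of 0] s_nonneg by blast
  have "L \<ge> 0"
    by (rule LIMSEQ_le_const[OF L(1)]) (use s_nonneg in auto)
  have "L = 0"
  proof (rule ccontr)
    assume "L \<noteq> 0"
    then have "L > 0"
      using \<open>L \<ge> 0\<close> by simp
    have Xf_eq: "u k = blinfun_apply X (f k)" for k
      using Xu[of 0 k] Xs_0 by simp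
    have "u k \<in> closure (blinfun_apply X ` cball 0 1)" for k
      unfolding Xf_eq by (intro subsetD[OF closure_subset] imageI) (simp add: f_le)
    then obtain z r where r: "strict_mono (r :: nat \<Rightarrow> nat)" and z: "(u \<circ> r) \<longlonglongrightarrow> z"
      using seq_compactE[OF compact_imp_seq_compact[OF compact_opsD(2)[OF assms]], of u] by blast
    then have "Cauchy (u \<circ> r)"
      using LIMSEQ_imp_Cauchy by blast
    from CauchyD[OF this \<open>L > 0\<close>] obtain M where "\<forall>m\<ge>M. \<forall>n\<ge>M. norm (u (r m) - u (r n)) < L"
      by auto
    then have "norm (u (r M) - u (r (Suc M))) < L"
      by simp
    then have "(norm (u (r M) - u (r (Suc M))))\<^sup>2 < L\<^sup>2"
      by (intro power_strict_mono) auto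
    moreover have "r M \<noteq> r (Suc M)"
      using r by (simp add: strict_mono_eq)
    then have "(norm (u (r M) - u (r (Suc M))))\<^sup>2 = (s (r M))\<^sup>2 + (s (r (Suc M)))\<^sup>2"
      using uu by (simp add: norm_sq_diff nu)
    moreover have "(s (r M))\<^sup>2 \<ge> L\<^sup>2"
      using L(2) \<open>L > 0\<close> by (intro power_mono) auto
    ultimately show False
      using zero_le_power2[of "s (r (Suc M))"] by linarith
  qed
  then have c0: "s \<in> c0_star"
    using L dec s_nonneg by (simp add: c0_star_def)
  \<comment> \<open>Because \<open>inverse 0 = 0\<close>, \<open>b k\<close> is a unit vector or,
    where \<open>s k = 0\<close>, the zero vector.\<close>
  define b where "b k = inverse (s k) *\<^sub>R u k" for k
  have b_norm: "norm (b k) = (if s k = 0 then 0 else 1)" for k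
    using s_nonneg[of k] by (simp add: b_def nu)
  have orf: "orthofam f"
    using ff f_le by (simp add: orthofam_def)
  have ob: "orthofam b"
    unfolding orthofam_def
    using b_norm uu by (auto simp: b_def cinner_scaleR_left cinner_scaleR_right)
  have sb: "complex_of_real (s k) *\<^sub>C b k = u k" for k
    using nu[of k] by (cases "s k = 0") (simp_all add: b_def flip: scaleR_scaleC)
  have "X = opr b s f"
  proof (rule blinfun_eqI)
    fix x :: 'h
    have "(\<lambda>k. s k * norm x) \<longlonglongrightarrow> 0"
      using tendsto_mult_right[OF c0_starD(3)[OF c0], of "norm x"] by simp
    then have "(\<lambda>k. blinfun_apply (Xs k) x) \<longlonglongrightarrow> 0"
      by (rule Lim_null_comparison[rotated]) (simp add: s_def norm_blinfun)
    from tendsto_diff[OF tendsto_const this, of "blinfun_apply X x"]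
    have "(\<lambda>k. blinfun_apply X x - blinfun_apply (Xs k) x) \<longlonglongrightarrow> blinfun_apply X x"
      by simp
    moreover have "blinfun_apply X x - blinfun_apply (Xs k) x = (\<Sum>j<k. cinner (f j) x *\<^sub>C u j)" for k
      using tele[of x k] by simp
    ultimately have "(\<lambda>k. cinner (f k) x *\<^sub>C u k) sums blinfun_apply X x"
      unfolding sums_def by simp
    then have "(\<lambda>k. (complex_of_real (s k) * cinner (f k) x) *\<^sub>C b k) sums blinfun_apply X x"
      by (simp add: scaleC_scaleC mult.commute flip: sb)
    then show "blinfun_apply X x = blinfun_apply (opr b s f) x"
      unfolding opr_apply[OF orf ob c0_starD(4)[OF c0]] by (rule sums_unique)
  qed
  then have "svd X s b f"
    using c0 orf ob b_norm f1 by (simp add: svd_def)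
  then show ?thesis
    by blast
qed

section \<open>Singular numbers\<close>

lemma finite_level:
  assumes "s \<in> c0_star" "v > 0"
  shows "finite {n. s n = v}"
proof -
  obtain N where "\<forall>n\<ge>N. norm (s n - 0) < v"
    using LIMSEQ_D[OF c0_starD(3)[OF assms(1)] assms(2)] by blast
  then have "{n. s n = v} \<subseteq> {..<N}"
    using assms(2) by (force simp: not_less[symmetric])
  then show ?thesis
    using finite_subset by blast
qed

text \<open>If the sequences agree below n and x n > y n, then y takes the value x n only at indices
  below n, by monotonicity. There x takes it too, and x takes it once more at n, so the
  multiplicities differ. This gives the uniqueness behind \<open>s_numbers\<close>.\<close>

lemma c0_star_eqI:
  assumes s: "s \<in> c0_star" and t: "t \<in> c0_star"
    and card: "\<And>v. v > 0 \<Longrightarrow> card {n. s n = v} = card {n. t n = v}"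
  shows "s = t"
proof -
  have le: "x n \<le> y n"
    if x: "x \<in> c0_star" and y: "y \<in> c0_star" and c: "\<And>v. v > 0 \<Longrightarrow> card {n. x n = v} = card {n. y n = v}"
      and eq: "\<And>j. j < n \<Longrightarrow> x j = y j" for x y :: "nat \<Rightarrow> real" and n
  proof (rule ccontr)
    assume "\<not> ?thesis"
    then have less: "y n < x n"
      by simp
    then have pos: "x n > 0"
      using c0_starD(1)[OF y, of n] by linarith
    have "{j. y j = x n} \<subseteq> {j. x j = x n} - {n}"
    proof
      fix j
      assume j: "j \<in> {j. y j = x n}"
      have "j < n"
      proof (rule ccontr)
        assume "\<not> ?thesis"
        then show False
          using c0_starD(2)[OF y, of n j] j less by simp
      qed
      then show "j \<in> {j. x j = x n} - {n}"
        using eq[of j] j by simp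
    qed
    then have "{j. y j = x n} \<subset> {j. x j = x n}"
      by blast
    then have "card {j. y j = x n} < card {j. x j = x n}"
      by (rule psubset_card_mono[OF finite_level[OF x pos]])
    then show False
      using c[OF pos] by simp
  qed
  have "s n = t n" for n
  proof (induction n rule: less_induct)
    case (less n)
    show ?case
    proof (rule order_antisym)
      show "s n \<le> t n"
        by (rule le[OF s t]) (use card less in auto)
      show "t n \<le> s n"
        by (rule le[OF t s]) (use card less in auto)
    qed
  qed
  then show ?thesis
    by blast
qed

lemma svdD:
  assumes "svd X s b a"
  shows "X = opr b s a" "s \<in> c0_star" "orthofam b" "orthofam a"
    "s n \<noteq> 0 \<Longrightarrow> norm (b n) = 1" "s n \<noteq> 0 \<Longrightarrow> norm (a n) = 1"
  using assms by (auto simp: svd_def)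

text \<open>The operator \<open>adj X o\<^sub>L X\<close> is diagonal along \<open>a\<close> with
  coefficients \<open>s n * s n\<close>. Comparing coefficients, an eigenvector for v^2 is
  orthogonal to each \<open>a k\<close> whose singular value is neither v nor 0, so its series
  reduces to a finite sum over the level set of v.\<close>

lemma cdim_eigenspace:
  assumes "svd X s b a" and v: "v > 0"
  shows "cdim {x. blinfun_apply (adj X o\<^sub>L X) x = complex_of_real (v\<^sup>2) *\<^sub>C x} = card {n. s n = v}"
proof -
  note svd = svdD[OF assms(1)]
  let ?K = "{n. s n = v}"
  let ?E = "{x. blinfun_apply (adj X o\<^sub>L X) x = complex_of_real (v\<^sup>2) *\<^sub>C x}"
  have K: "finite ?K"
    by (rule finite_level[OF svd(2) v])
  have bd: "\<forall>n. \<bar>s n\<bar> \<le> s 0"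
    by (rule c0_starD(4)[OF svd(2)])
  have bd2: "\<forall>n. \<bar>s n * s n\<bar> \<le> s 0 * s 0"
  proof
    fix n
    show "\<bar>s n * s n\<bar> \<le> s 0 * s 0"
      unfolding abs_mult using bd[rule_format, of n] by (intro mult_mono) auto
  qed
  have XX: "adj X o\<^sub>L X = opr a (\<lambda>n. s n * s n) a"
    unfolding svd(1) adj_opr[OF svd(4,3) bd]
    by (rule opr_compose[OF svd(4,3,4) bd bd]) (use svd(5) in auto)
  have norm_a: "norm (a n) = 1" if "n \<in> ?K" for n
    using svd(6)[of n] that v by simp
  have aa: "cinner (a i) (a j) = (if i = j then 1 else 0)" if "i \<in> ?K" for i j
    using orthofam_orth[OF svd(4), of i j] norm_a[OF that] by (cases "i = j") (simp_all add: cinner_self)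
  have inj: "inj_on a ?K"
  proof (rule inj_onI)
    fix i j
    assume "i \<in> ?K" "j \<in> ?K" "a i = a j"
    then show "i = j"
      using aa[of i i] aa[of i j] by (auto split: if_splits)
  qed
  have ind: "\<not> cvec.dependent (a ` ?K)"
  proof
    assume "cvec.dependent (a ` ?K)"
    then obtain u where u: "\<exists>x\<in>a ` ?K. u x \<noteq> 0" "(\<Sum>x\<in>a ` ?K. u x *\<^sub>C x) = 0"
      using cvec.dependent_finite[of "a ` ?K"] K by auto
    then obtain i where i: "i \<in> ?K" "u (a i) \<noteq> 0"
      by blast
    have "0 = cinner (a i) (\<Sum>k\<in>?K. u (a k) *\<^sub>C a k)"
      using u(2) by (simp add: sum.reindex[OF inj])
    also have "\<dots> = (\<Sum>k\<in>?K. if k = i then u (a i) else 0)"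
      unfolding cinner_sum_right
      by (intro sum.cong refl) (use aa[OF i(1)] in \<open>auto simp: cinner_scaleC_right\<close>)
    also have "\<dots> = u (a i)"
      using K i(1) by simp
    finally show False
      using i(2) by simp
  qed
  have sub: "a ` ?K \<subseteq> ?E"
  proof clarify
    fix n
    assume "v = s n"
    then show "blinfun_apply (adj X o\<^sub>L X) (a n) = complex_of_real ((s n)\<^sup>2) *\<^sub>C a n"
      unfolding XX opr_apply_basis[OF svd(4,4) bd2]
      using norm_a[of n] by (simp add: power2_eq_square)
  qed
  have "?E \<subseteq> cspan (a ` ?K)"
  proof
    fix x
    assume "x \<in> ?E"
    then have x: "blinfun_apply (opr a (\<lambda>n. s n * s n) a) x = complex_of_real (v\<^sup>2) *\<^sub>C x"
      by (simp add: XX)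
    have zero: "cinner (a k) x = 0" if "k \<notin> ?K" "s k \<noteq> 0" for k
    proof -
      have "complex_of_real (s k * s k) * cinner (a k) x = complex_of_real (v\<^sup>2) * cinner (a k) x"
        using cinner_opr_basis[OF svd(4,4) bd2, of k x] svd(6)[OF that(2)]
        by (auto simp: x cinner_scaleC_right)
      moreover have "s k * s k \<noteq> v\<^sup>2"
        using that v c0_starD(1)[OF svd(2), of k]
        by (auto simp flip: power2_eq_square simp: power2_eq_iff)
      ultimately show ?thesis
        using mult_cancel_right of_real_eq_iff by blast
    qed
    have "complex_of_real (v\<^sup>2) *\<^sub>C x = (\<Sum>n. (complex_of_real (s n * s n) * cinner (a n) x) *\<^sub>C a n)"
      using x by (simp add: opr_apply[OF svd(4,4) bd2])
    also have "\<dots> = (\<Sum>n\<in>?K. (complex_of_real (s n * s n) * cinner (a n) x) *\<^sub>C a n)"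
      by (rule suminf_finite[OF K]) (use zero in force)
    finally have "complex_of_real (v\<^sup>2) *\<^sub>C x \<in> cspan (a ` ?K)"
      by (simp only:) (intro cvec.span_sum cvec.span_scale cvec.span_base imageI)
    then have "inverse (complex_of_real (v\<^sup>2)) *\<^sub>C complex_of_real (v\<^sup>2) *\<^sub>C x \<in> cspan (a ` ?K)"
      by (rule cvec.span_scale)
    then show "x \<in> cspan (a ` ?K)"
      using v by simp
  qed
  then show ?thesis
    by (intro cvec.dim_unique[OF sub _ ind]) (simp_all add: card_image[OF inj])
qed

text \<open>From here on s-numbers are read off from any decomposition, and eigenspaces no longer
  occur.\<close>

lemma s_numbers_eq:
  assumes "svd X s b a"
  shows "s_numbers X = s"
  unfolding s_numbers_def
proof (rule the_equality)
  have eq: "(\<forall>v>0. card {n. t n = v} =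
      cdim {x. blinfun_apply (adj X o\<^sub>L X) x = complex_of_real (v\<^sup>2) *\<^sub>C x}) \<longleftrightarrow>
      (\<forall>v>0. card {n. t n = v} = card {n. s n = v})" for t
    by (simp only: cdim_eigenspace[OF assms] cong: imp_cong)
  show "s \<in> c0_star \<and> (\<forall>v>0. card {n. s n = v} =
      cdim {x. blinfun_apply (adj X o\<^sub>L X) x = complex_of_real (v\<^sup>2) *\<^sub>C x})"
    unfolding eq using svdD(2)[OF assms] by simp
  fix t
  assume t: "t \<in> c0_star \<and> (\<forall>v>0. card {n. t n = v} =
      cdim {x. blinfun_apply (adj X o\<^sub>L X) x = complex_of_real (v\<^sup>2) *\<^sub>C x})"
  show "t = s"
    by (rule c0_star_eqI) (use t[unfolded eq] svdD(2)[OF assms] in auto)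
qed

section \<open>Min-max inequalities for singular numbers\<close>

text \<open>Gaussian elimination: equation \<open>p\<close> has the pivot \<open>q\<close>, is
  solved for that unknown and substituted into the remaining equations, which leaves one equation
  and one unknown fewer.\<close>

lemma nontrivial_kernel:
  fixes \<phi> :: "'i \<Rightarrow> 'j \<Rightarrow> complex"
  assumes "finite I" "finite J" "card I < card J"
  shows "\<exists>c. (\<exists>j\<in>J. c j \<noteq> 0) \<and> (\<forall>i\<in>I. (\<Sum>j\<in>J. c j * \<phi> i j) = 0)"
  using assms
proof (induction I arbitrary: J \<phi> rule: finite_induct)
  case empty
  then show ?case
    by (intro exI[of _ "\<lambda>_. 1"]) (auto simp: card_gt_0_iff)
next
  case (insert p I)
  show ?case
  proof (cases "\<forall>j\<in>J. \<phi> p j = 0")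
    case True
    then show ?thesis
      using insert.IH[of J \<phi>] insert.hyps insert.prems by auto
  next
    case False
    then obtain q where q: "q \<in> J" "\<phi> p q \<noteq> 0"
      by blast
    have "card I < card (J - {q})"
      using insert.hyps insert.prems q by (simp add: card_Diff_singleton)
    with insert.IH[of "J - {q}" "\<lambda>i j. \<phi> i j - \<phi> i q * \<phi> p j / \<phi> p q"] insert.prems
    obtain c where c: "\<exists>j\<in>J - {q}. c j \<noteq> 0"
      "\<And>i. i \<in> I \<Longrightarrow> (\<Sum>j\<in>J - {q}. c j * (\<phi> i j - \<phi> i q * \<phi> p j / \<phi> p q)) = 0"
      by auto
    define d where "d = (\<Sum>j\<in>J - {q}. c j * \<phi> p j) / \<phi> p q"
    define c' where "c' = c(q := - d)"
    have sum: "(\<Sum>j\<in>J. c' j * \<phi> i j) = (\<Sum>j\<in>J - {q}. c j * \<phi> i j) - d * \<phi> i q" for i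
    proof -
      have "(\<Sum>j\<in>J - {q}. c' j * \<phi> i j) = (\<Sum>j\<in>J - {q}. c j * \<phi> i j)"
        by (intro sum.cong) (auto simp: c'_def)
      then show ?thesis
        using sum.remove[OF insert.prems(1) q(1), of "\<lambda>j. c' j * \<phi> i j"] by (simp add: c'_def)
    qed
    have "(\<Sum>j\<in>J. c' j * \<phi> i j) = 0" if "i \<in> I" for i
    proof -
      have "0 = (\<Sum>j\<in>J - {q}. c j * \<phi> i j - (c j * \<phi> p j) * (\<phi> i q / \<phi> p q))"
        using c(2)[OF that] by (simp add: algebra_simps)
      also have "\<dots> = (\<Sum>j\<in>J - {q}. c j * \<phi> i j) - d * \<phi> i q"
        by (simp add: sum_subtractf sum_distrib_right sum_divide_distrib d_def)
      finally show ?thesis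
        by (simp add: sum)
    qed
    moreover have "(\<Sum>j\<in>J. c' j * \<phi> p j) = 0"
      using q by (simp add: sum d_def)
    moreover have "\<exists>j\<in>J. c' j \<noteq> 0"
      using c(1) by (auto simp: c'_def)
    ultimately show ?thesis
      by (intro exI[of _ c']) auto
  qed
qed

definition clinear_form :: "('h::complex_hilbert \<Rightarrow> complex) \<Rightarrow> bool" where
  "clinear_form \<phi> \<longleftrightarrow> (\<forall>x y. \<phi> (x + y) = \<phi> x + \<phi> y) \<and> (\<forall>c x. \<phi> (c *\<^sub>C x) = c * \<phi> x)"

lemma clinear_form_cinner: "T \<in> B_ops \<Longrightarrow> clinear_form (\<lambda>x. cinner y (blinfun_apply T x))"
  by (simp add: clinear_form_def blinfun.add_right cinner_add_right B_opsD cinner_scaleC_right)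

lemma clinear_form_cinner': "clinear_form (cinner y)"
  by (simp add: clinear_form_def cinner_add_right cinner_scaleC_right)

lemma clinear_form_sum:
  assumes "clinear_form \<phi>"
  shows "\<phi> (\<Sum>i\<in>A. c i *\<^sub>C f i) = (\<Sum>i\<in>A. c i * \<phi> (f i))"
proof -
  have "\<phi> 0 = 0"
    using assms unfolding clinear_form_def by (metis cvec.scale_zero_left mult_zero_left)
  with assms show ?thesis
    by (induction A rule: infinite_finite_induct) (simp_all add: clinear_form_def)
qed

text \<open>The first N + 1 right singular vectors span a space on which \<open>X\<close> stretches
  every vector by at least \<open>s N\<close>, and N linear conditions leave a nonzero vector in it.
  The inequalities for sums, products and finite rank operators all come from a suitable choice of
  the forms.\<close>

lemma gelfand_bound:
  assumes svd: "svd X s b a" and \<phi>: "\<And>i. i < N \<Longrightarrow> clinear_form (\<phi> i)"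
    and le: "\<And>x. (\<And>i. i < N \<Longrightarrow> \<phi> i x = 0) \<Longrightarrow> norm (blinfun_apply X x) \<le> C * norm x"
    and "C \<ge> 0"
  shows "s N \<le> C"
proof (cases "s N = 0")
  case False
  note svd' = svdD[OF svd]
  have sN: "s N > 0"
    using False c0_starD(1)[OF svd'(2), of N] by simp
  have sj: "s N \<le> s j" if "j \<le> N" for j
    using c0_starD(2)[OF svd'(2) that] .
  have norm1: "norm (a j) = 1" "norm (b j) = 1" if "j \<le> N" for j
    using svd'(5,6)[of j] sj[OF that] sN by auto
  obtain c where c: "\<exists>j\<in>{..N}. c j \<noteq> 0" "\<forall>i\<in>{..<N}. (\<Sum>j\<in>{..N}. c j * \<phi> i (a j)) = 0"
    using nontrivial_kernel[of "{..<N}" "{..N}" "\<lambda>i j. \<phi> i (a j)"] by auto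
  define v where "v = (\<Sum>j\<le>N. c j *\<^sub>C a j)"
  have nv: "(norm v)\<^sup>2 = (\<Sum>j\<le>N. (cmod (c j))\<^sup>2)"
    unfolding v_def norm_sq_orthosum[OF svd'(4) finite_atMost] by (intro sum.cong) (auto simp: norm1)
  have X_B: "X \<in> B_ops"
    using opr_in_B_ops[OF svd'(4,3) c0_starD(4)[OF svd'(2)]] svd'(1) by simp
  have "blinfun_apply X v = (\<Sum>j\<le>N. (c j * complex_of_real (s j)) *\<^sub>C b j)"
    unfolding v_def blinfun.sum_right B_opsD[OF X_B]
    unfolding svd'(1) opr_apply_basis[OF svd'(4,3) c0_starD(4)[OF svd'(2)]]
    by (intro sum.cong) (auto simp: norm1)
  then have "(norm (blinfun_apply X v))\<^sup>2 = (\<Sum>j\<le>N. (cmod (c j))\<^sup>2 * (s j)\<^sup>2)"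
    using norm_sq_orthosum[OF svd'(3) finite_atMost, of "\<lambda>j. c j * complex_of_real (s j)" N]
    by (simp add: norm1 norm_mult power_mult_distrib)
  also have "\<dots> \<ge> (\<Sum>j\<le>N. (cmod (c j))\<^sup>2 * (s N)\<^sup>2)"
    using sj sN by (intro sum_mono mult_left_mono power_mono) auto
  finally have 1: "(s N * norm v)\<^sup>2 \<le> (norm (blinfun_apply X v))\<^sup>2"
    by (simp add: power_mult_distrib nv sum_distrib_left mult.commute)
  then have "s N * norm v \<le> norm (blinfun_apply X v)"
    by (rule power2_le_imp_le) simp
  also have "\<dots> \<le> C * norm v"
    by (rule le) (use c(2) in \<open>simp add: v_def clinear_form_sum[OF \<phi>]\<close>)
  finally have "s N * norm v \<le> C * norm v" .
  moreover have "norm v > 0"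
  proof -
    obtain k where "k \<le> N" "c k \<noteq> 0"
      using c(1) by auto
    then have "(\<Sum>j\<le>N. (cmod (c j))\<^sup>2) > 0"
      by (intro sum_pos2[of _ k]) auto
    then show ?thesis
      unfolding nv[symmetric] by simp
  qed
  ultimately show ?thesis
    by simp
qed (use assms in simp)

lemma svd_norm_le:
  assumes "svd X s b a" "\<And>n. n < N \<Longrightarrow> cinner (a n) x = 0"
  shows "norm (blinfun_apply X x) \<le> s N * norm x"
  using norm_opr_tail[OF svdD(2,4,3)[OF assms(1)] assms(2)] svdD(1)[OF assms(1)] by simp

text \<open>The forms are the first n right singular vectors of \<open>X\<close> together with the
  first m of \<open>Y\<close>; on their common kernel both summands are small.\<close>

lemma svd_add_le:
  assumes X: "svd X s b a" and Y: "svd Y t d c" and Z: "svd (X + Y) u g f"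
  shows "u (n + m) \<le> s n + t m"
proof (rule gelfand_bound[OF Z])
  let ?\<phi> = "\<lambda>i. if i < n then cinner (a i) else cinner (c (i - n))"
  show "clinear_form (?\<phi> i)" for i
    by (simp add: clinear_form_cinner')
  fix x
  assume 0: "\<And>i. i < n + m \<Longrightarrow> ?\<phi> i x = 0"
  have "cinner (a i) x = 0" if "i < n" for i
    using 0[of i] that by simp
  then have 1: "norm (blinfun_apply X x) \<le> s n * norm x"
    by (rule svd_norm_le[OF X])
  have "cinner (c i) x = 0" if "i < m" for i
    using 0[of "n + i"] that by simp
  then have 2: "norm (blinfun_apply Y x) \<le> t m * norm x"
    by (rule svd_norm_le[OF Y])
  show "norm (blinfun_apply (X + Y) x) \<le> (s n + t m) * norm x"
    using 1 2 norm_triangle_ineq[of "blinfun_apply X x" "blinfun_apply Y x"]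
    by (simp add: blinfun.add_left distrib_right)
qed (use c0_starD(1)[OF svdD(2)[OF X], of n] c0_starD(1)[OF svdD(2)[OF Y], of m] in simp)

lemma svd_compose_left_le:
  assumes X: "svd X s b a" and Z: "svd (A o\<^sub>L X) u g f"
  shows "u n \<le> norm A * s n"
proof (rule gelfand_bound[OF Z])
  show "clinear_form (cinner (a i))" for i
    by (rule clinear_form_cinner')
  fix x
  assume "\<And>i. i < n \<Longrightarrow> cinner (a i) x = 0"
  then have "norm (blinfun_apply X x) \<le> s n * norm x"
    by (rule svd_norm_le[OF X])
  then have "norm A * norm (blinfun_apply X x) \<le> norm A * (s n * norm x)"
    by (intro mult_left_mono) auto
  then show "norm (blinfun_apply (A o\<^sub>L X) x) \<le> norm A * s n * norm x"
    using norm_blinfun[of A "blinfun_apply X x"] by (simp add: mult.assoc)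
qed (use c0_starD(1)[OF svdD(2)[OF X], of n] in simp)

text \<open>The conditions for \<open>X\<close> are pulled back along \<open>A\<close>, which yields
  general linear forms instead of inner products with singular vectors.\<close>

lemma svd_compose_right_le:
  assumes X: "svd X s b a" and A: "A \<in> B_ops" and Z: "svd (X o\<^sub>L A) u g f"
  shows "u n \<le> norm A * s n"
proof (rule gelfand_bound[OF Z])
  show "clinear_form (\<lambda>x. cinner (a i) (blinfun_apply A x))" for i
    by (rule clinear_form_cinner[OF A])
  fix x
  assume "\<And>i. i < n \<Longrightarrow> cinner (a i) (blinfun_apply A x) = 0"
  then have "norm (blinfun_apply X (blinfun_apply A x)) \<le> s n * norm (blinfun_apply A x)"
    by (rule svd_norm_le[OF X])
  also have "\<dots> \<le> s n * (norm A * norm x)"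
    using c0_starD(1)[OF svdD(2)[OF X], of n] norm_blinfun by (intro mult_left_mono)
  finally show "norm (blinfun_apply (X o\<^sub>L A) x) \<le> norm A * s n * norm x"
    by (simp add: mult_ac)
qed (use c0_starD(1)[OF svdD(2)[OF X], of n] in simp)

section \<open>Finite rank operators\<close>

lemma gram_schmidt:
  fixes B :: "'h::complex_hilbert set"
  assumes "finite B"
  shows "\<exists>a N. orthofam a \<and> (\<forall>i. a i = 0 \<or> norm (a i) = 1) \<and> (\<forall>i\<ge>N. a i = 0) \<and>
    (\<forall>x\<in>cspan B. x = (\<Sum>i<N. cinner (a i) x *\<^sub>C a i))"
  using assms
proof (induction B)
  case empty
  show ?case
    by (intro exI[of _ "\<lambda>_. 0"] exI[of _ 0]) (auto simp: orthofam_def)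
next
  case (insert v B)
  then obtain a N where a: "orthofam a" "\<And>i. a i = 0 \<or> norm (a i) = 1" "\<And>i. i \<ge> N \<Longrightarrow> a i = 0"
    and rep: "\<And>x. x \<in> cspan B \<Longrightarrow> x = (\<Sum>i<N. cinner (a i) x *\<^sub>C a i)"
    by blast
  define w where "w = v - (\<Sum>i<N. cinner (a i) v *\<^sub>C a i)"
  define z where "z = inverse (norm w) *\<^sub>R w"
  have aw: "cinner (a k) w = 0" for k
  proof (cases "k < N")
    case True
    have "cinner (a k) (\<Sum>i<N. cinner (a i) v *\<^sub>C a i) =
        (\<Sum>i<N. if i = k then cinner (a k) v * cinner (a k) (a k) else 0)"
      unfolding cinner_sum_right
      by (intro sum.cong refl) (use orthofam_orth[OF a(1), of k] in \<open>auto simp: cinner_scaleC_right\<close>)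
    also have "\<dots> = cinner (a k) v"
      using True a(2)[of k] by (auto simp: cinner_self)
    finally show ?thesis
      by (simp add: w_def cinner_diff_right)
  qed (simp add: a(3))
  then have az: "cinner (a k) z = 0" for k
    by (simp add: z_def cinner_scaleR_right)
  then have za: "cinner z (a k) = 0" for k
    using cinner_commute[of z "a k"] by simp
  have nz: "z = 0 \<or> norm z = 1"
    by (cases "w = 0") (simp_all add: z_def)
  define a' where "a' = a(N := z)"
  have "orthofam a'"
    using a(1) az za nz by (auto simp: orthofam_def a'_def)
  moreover have "\<forall>i. a' i = 0 \<or> norm (a' i) = 1" "\<forall>i\<ge>Suc N. a' i = 0"
    using a nz by (auto simp: a'_def)
  moreover have "x = (\<Sum>i<Suc N. cinner (a' i) x *\<^sub>C a' i)" if x: "x \<in> cspan (insert v B)" for x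
  proof -
    have sum: "(\<Sum>i<Suc N. cinner (a' i) y *\<^sub>C a' i) =
        (\<Sum>i<N. cinner (a i) y *\<^sub>C a i) + cinner z y *\<^sub>C z" for y
      by (simp add: a'_def)
    obtain k where k: "x - k *\<^sub>C v \<in> cspan B"
      using x cvec.span_breakdown_eq by blast
    define y where "y = x - k *\<^sub>C v"
    have y: "y = (\<Sum>i<N. cinner (a i) y *\<^sub>C a i)"
      using rep[OF k] by (simp add: y_def)
    have "cinner z (\<Sum>i<N. cinner (a i) y *\<^sub>C a i) = 0"
      by (simp add: cinner_sum_right cinner_scaleC_right za)
    then have zy: "cinner z y = 0"
      using y by simp
    have "cinner z v = cinner z w"
      by (simp add: w_def cinner_diff_right cinner_sum_right cinner_scaleC_right za)
    also have "\<dots> = complex_of_real (inverse (norm w) * (norm w)\<^sup>2)"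
      by (simp add: z_def cinner_scaleR_left cinner_self scaleR_conv_of_real)
    also have "inverse (norm w) * (norm w)\<^sup>2 = norm w"
      by (cases "w = 0") (simp_all add: power2_eq_square)
    finally have "cinner z v *\<^sub>C z = norm w *\<^sub>R z"
      by (simp add: scaleR_scaleC)
    then have "cinner z v *\<^sub>C z = w"
      by (cases "w = 0") (simp_all add: z_def)
    then have v: "v = (\<Sum>i<N. cinner (a i) v *\<^sub>C a i) + cinner z v *\<^sub>C z"
      by (simp add: w_def)
    have x_eq: "x = y + k *\<^sub>C v"
      by (simp add: y_def)
    have "(\<Sum>i<Suc N. cinner (a' i) x *\<^sub>C a' i) =
        (\<Sum>i<N. cinner (a i) y *\<^sub>C a i) + k *\<^sub>C ((\<Sum>i<N. cinner (a i) v *\<^sub>C a i) + cinner z v *\<^sub>C z)"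
      unfolding sum x_eq
      by (simp add: cinner_add_right cinner_scaleC_right scaleC_add_left scaleC_add_right zy
          sum.distrib cvec.scale_sum_right scaleC_scaleC)
    also have "\<dots> = y + k *\<^sub>C v"
      using y v by simp
    finally show ?thesis
      using x_eq by simp
  qed
  ultimately show ?case
    by blast
qed

definition fin_seqs :: "(nat \<Rightarrow> real) set" where
  "fin_seqs = {\<xi> \<in> c0_star. \<exists>N. \<forall>n\<ge>N. \<xi> n = 0}"

text \<open>The coordinates of \<open>X x\<close> in an orthonormal system spanning the range are N
  linear forms of x whose common kernel is the kernel of \<open>X\<close>;
  \<open>gelfand_bound\<close> with constant 0 then gives \<open>s N = 0\<close>. Conversely, a
  decomposition with finitely many nonzero values is a finite sum.\<close>

lemma finite_rank_ops_eq: "finite_rank_ops = {X \<in> compact_ops. s_numbers X \<in> fin_seqs}"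
proof (intro set_eqI iffI)
  fix X :: "'h::complex_hilbert \<Rightarrow>\<^sub>L 'h"
  assume "X \<in> finite_rank_ops"
  then obtain B where X: "X \<in> B_ops" and B: "finite B" "range (blinfun_apply X) \<subseteq> cspan B"
    by (auto simp: finite_rank_ops_def)
  obtain a N where a: "orthofam a" and rep: "\<And>x. x \<in> cspan B \<Longrightarrow> x = (\<Sum>i<N. cinner (a i) x *\<^sub>C a i)"
    using gram_schmidt[OF B(1)] by blast
  have Xx: "blinfun_apply X x = (\<Sum>i<N. cinner (a i) (blinfun_apply X x) *\<^sub>C a i)" for x
    using rep[of "blinfun_apply X x"] B(2) by blast
  have bd: "cmod (cinner (a n) (blinfun_apply X x)) \<le> norm X" if "norm x \<le> 1" for n x
  proof -
    have "cmod (cinner (a n) (blinfun_apply X x)) \<le> 1 * (norm X * 1)"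
      using norm_cinner_le[of "a n" "blinfun_apply X x"] orthofam_norm[OF a, of n]
        norm_blinfun[of X x] that
      by (intro order_trans[OF norm_cinner_le] mult_mono order_trans[OF norm_blinfun]) auto
    then show ?thesis
      by simp
  qed
  have C: "X \<in> compact_ops"
    by (rule finite_rank_compact[OF X _ Xx]) (use bd in blast)
  obtain s b c where svd: "svd X s b c"
    using svd_exists[OF C] by blast
  have "s N \<le> 0"
  proof (rule gelfand_bound[OF svd])
    show "clinear_form (\<lambda>x. cinner (a i) (blinfun_apply X x))" for i
      by (rule clinear_form_cinner[OF X])
    fix x
    assume "\<And>i. i < N \<Longrightarrow> cinner (a i) (blinfun_apply X x) = 0"
    then have "(\<Sum>i<N. cinner (a i) (blinfun_apply X x) *\<^sub>C a i) = 0"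
      by simp
    then show "norm (blinfun_apply X x) \<le> 0 * norm x"
      using Xx[of x] by simp
  qed simp
  then have "\<forall>n\<ge>N. s n = 0"
    using c0_starD(1,2)[OF svdD(2)[OF svd]] by (meson order.trans order_antisym)
  then show "X \<in> {X \<in> compact_ops. s_numbers X \<in> fin_seqs}"
    using C svdD(2)[OF svd] by (auto simp: fin_seqs_def s_numbers_eq[OF svd])
next
  fix X :: "'h::complex_hilbert \<Rightarrow>\<^sub>L 'h"
  assume X: "X \<in> {X \<in> compact_ops. s_numbers X \<in> fin_seqs}"
  obtain s b a where svd: "svd X s b a"
    using svd_exists X by blast
  obtain N where N: "\<And>n. n \<ge> N \<Longrightarrow> s n = 0"
    using X by (auto simp: fin_seqs_def s_numbers_eq[OF svd])
  have "blinfun_apply X x = (\<Sum>n<N. (complex_of_real (s n) * cinner (a n) x) *\<^sub>C b n)" for x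
    unfolding svdD(1)[OF svd] opr_apply[OF svdD(4,3)[OF svd] c0_starD(4)[OF svdD(2)[OF svd]]]
    by (rule suminf_finite) (auto simp: N not_less)
  then have "blinfun_apply X x \<in> cspan (b ` {..<N})" for x
    by (simp only:) (intro cvec.span_sum cvec.span_scale cvec.span_base imageI)
  then have "range (blinfun_apply X) \<subseteq> cspan (b ` {..<N})"
    by blast
  then show "X \<in> finite_rank_ops"
    using X compact_opsD(1) unfolding finite_rank_ops_def by blast
qed

section \<open>Ideals and characteristic sets\<close>

lemma opr_add:
  assumes a: "orthofam a" and b: "orthofam b"
    and \<xi>: "\<forall>n. \<bar>\<xi> n\<bar> \<le> M" and \<eta>: "\<forall>n. \<bar>\<eta> n\<bar> \<le> L"
  shows "opr b (\<lambda>n. \<xi> n + \<eta> n) a = opr b \<xi> a + opr b \<eta> a"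
proof (rule blinfun_eqI)
  fix x
  have *: "\<forall>n. \<bar>\<xi> n + \<eta> n\<bar> \<le> M + L"
    using \<xi> \<eta> by (meson abs_triangle_ineq add_mono order_trans)
  show "blinfun_apply (opr b (\<lambda>n. \<xi> n + \<eta> n) a) x = blinfun_apply (opr b \<xi> a + opr b \<eta> a) x"
    unfolding blinfun.add_left opr_apply[OF a b *] opr_apply[OF a b \<xi>] opr_apply[OF a b \<eta>]
      suminf_add[OF opr_summable[OF a b \<xi>] opr_summable[OF a b \<eta>]]
    by (simp add: distrib_right scaleC_add_left)
qed

lemma orthofam_reindex: "orthofam a \<Longrightarrow> strict_mono g \<Longrightarrow> orthofam (\<lambda>n. a (g n))"
  by (simp add: orthofam_def strict_mono_eq)

lemma opr_reindex:
  assumes a: "orthofam a" and b: "orthofam b" and \<xi>: "\<forall>n. \<bar>\<xi> n\<bar> \<le> M"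
    and g: "strict_mono (g :: nat \<Rightarrow> nat)" and 0: "\<And>n. n \<notin> range g \<Longrightarrow> \<xi> n = 0"
  shows "opr (\<lambda>n. b (g n)) (\<lambda>n. \<xi> (g n)) (\<lambda>n. a (g n)) = opr b \<xi> a"
proof (rule blinfun_eqI)
  fix x
  have *: "\<forall>n. \<bar>\<xi> (g n)\<bar> \<le> M"
    using \<xi> by blast
  let ?f = "\<lambda>n. (complex_of_real (\<xi> n) * cinner (a n) x) *\<^sub>C b n"
  have "?f sums blinfun_apply (opr b \<xi> a) x"
    unfolding opr_apply[OF a b \<xi>] by (rule summable_sums[OF opr_summable[OF a b \<xi>]])
  then have "(\<lambda>n. ?f (g n)) sums blinfun_apply (opr b \<xi> a) x"
    by (subst sums_mono_reindex[OF g]) (use 0 in auto)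
  then show "blinfun_apply (opr (\<lambda>n. b (g n)) (\<lambda>n. \<xi> (g n)) (\<lambda>n. a (g n))) x = blinfun_apply (opr b \<xi> a) x"
    unfolding opr_apply[OF orthofam_reindex[OF a g] orthofam_reindex[OF b g] *]
    by (rule sums_unique[symmetric])
qed

section \<open>Characteristic sets of sequences\<close>

text \<open>With indices starting at 0, the dilation D_2 reads \<open>\<xi> (n div 2)\<close>, since
  the ceiling of (n + 1)/2 is n div 2 + 1. Multiples follow from addition and heredity, the other
  D_m from iterating D_2.\<close>

definition charset :: "(nat \<Rightarrow> real) set \<Rightarrow> bool" where
  "charset S \<longleftrightarrow> S \<subseteq> c0_star \<and> (\<lambda>_. 0) \<in> S \<and>
     (\<forall>\<xi>\<in>c0_star. \<forall>\<eta>\<in>S. (\<forall>n. \<xi> n \<le> \<eta> n) \<longrightarrow> \<xi> \<in> S) \<and>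
     (\<forall>\<xi>\<in>S. \<forall>\<eta>\<in>S. (\<lambda>n. \<xi> n + \<eta> n) \<in> S) \<and> (\<forall>\<xi>\<in>S. (\<lambda>n. \<xi> (n div 2)) \<in> S)"

lemma charset_c0: "charset S \<Longrightarrow> \<xi> \<in> S \<Longrightarrow> \<xi> \<in> c0_star"
  by (auto simp: charset_def)

lemma charset_zero: "charset S \<Longrightarrow> (\<lambda>_. 0) \<in> S"
  by (simp add: charset_def)

lemma charset_mono: "charset S \<Longrightarrow> \<eta> \<in> S \<Longrightarrow> \<xi> \<in> c0_star \<Longrightarrow> (\<And>n. \<xi> n \<le> \<eta> n) \<Longrightarrow> \<xi> \<in> S"
  by (auto simp: charset_def)

lemma charset_add: "charset S \<Longrightarrow> \<xi> \<in> S \<Longrightarrow> \<eta> \<in> S \<Longrightarrow> (\<lambda>n. \<xi> n + \<eta> n) \<in> S"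
  by (auto simp: charset_def)

lemma charset_div2: "charset S \<Longrightarrow> \<xi> \<in> S \<Longrightarrow> (\<lambda>n. \<xi> (n div 2)) \<in> S"
  by (auto simp: charset_def)

lemma c0_star_zero: "(\<lambda>_. 0) \<in> c0_star"
  by (simp add: c0_star_def decseq_def)

lemma c0_star_add:
  assumes "\<xi> \<in> c0_star" "\<eta> \<in> c0_star"
  shows "(\<lambda>n. \<xi> n + \<eta> n) \<in> c0_star"
  using assms tendsto_add[of \<xi> 0 sequentially \<eta> 0]
  by (auto simp: c0_star_def decseq_def intro: add_mono)

lemma c0_star_div:
  assumes "\<xi> \<in> c0_star" "m > 0"
  shows "(\<lambda>n. \<xi> (n div m)) \<in> c0_star"
proof -
  have "filterlim (\<lambda>n. n div m) at_top at_top"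
    unfolding filterlim_at_top
  proof
    fix Z :: nat
    show "\<forall>\<^sub>F n in sequentially. Z \<le> n div m"
      using assms(2) by (intro eventually_sequentiallyI[of "Z * m"]) (simp add: less_eq_div_iff_mult_less_eq)
  qed
  from filterlim_compose[OF c0_starD(3)[OF assms(1)] this] show ?thesis
    using c0_starD(1,2)[OF assms(1)] by (auto simp: c0_star_def decseq_def div_le_mono)
qed

lemma c0_starI:
  assumes "\<And>n. 0 \<le> \<xi> n" "\<And>n. \<xi> (Suc n) \<le> \<xi> n" "\<xi> \<longlonglongrightarrow> 0"
  shows "\<xi> \<in> c0_star"
  using assms by (simp add: c0_star_def decseq_Suc_iff)

lemma charset_scale:
  assumes S: "charset S" and \<eta>: "\<eta> \<in> S" and \<xi>: "\<xi> \<in> c0_star" and le: "\<And>n. \<xi> n \<le> C * \<eta> n"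
  shows "\<xi> \<in> S"
proof -
  note \<eta>c = charset_c0[OF S \<eta>]
  have mult: "(\<lambda>n. real k * \<eta> n) \<in> S" for k
  proof (induction k)
    case (Suc k)
    from charset_add[OF S this \<eta>] show ?case
      by (simp add: algebra_simps)
  qed (simp add: charset_zero[OF S])
  obtain k :: nat where k: "C \<le> real k"
    using real_arch_simple by blast
  show ?thesis
  proof (rule charset_mono[OF S mult \<xi>])
    show "\<xi> n \<le> real k * \<eta> n" for n
      using le[of n] mult_right_mono[OF k c0_starD(1)[OF \<eta>c, of n]] by simp
  qed
qed

lemma charset_div:
  assumes S: "charset S" and \<xi>: "\<xi> \<in> S" and m: "m > 0"
  shows "(\<lambda>n. \<xi> (n div m)) \<in> S"
proof -
  have pow: "(\<lambda>n. \<xi> (n div 2 ^ k)) \<in> S" for k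
  proof (induction k)
    case (Suc k)
    from charset_div2[OF S this] show ?case
      by (simp add: div_mult2_eq)
  qed (simp add: \<xi>)
  show ?thesis
  proof (rule charset_mono[OF S pow[of m] c0_star_div[OF charset_c0[OF S \<xi>] m]])
    show "\<xi> (n div m) \<le> \<xi> (n div 2 ^ m)" for n
      using m less_exp[of m] by (intro c0_starD(2)[OF charset_c0[OF S \<xi>]] div_le_mono2) auto
  qed
qed

definition seq_ideal :: "(nat \<Rightarrow> real) set \<Rightarrow> ('h::complex_hilbert \<Rightarrow>\<^sub>L 'h) set" where
  "seq_ideal S = {X \<in> compact_ops. s_numbers X \<in> S}"

lemma svd_s_numbers:
  assumes "X \<in> compact_ops"
  obtains b a where "svd X (s_numbers X) b a"
  using svd_exists[OF assms] s_numbers_eq by metis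

lemma s_numbers_c0: "X \<in> compact_ops \<Longrightarrow> s_numbers X \<in> c0_star"
  using svd_s_numbers svdD(2) by metis

lemma idealD:
  assumes "is_ideal I"
  shows "X \<in> I \<Longrightarrow> X \<in> compact_ops" "0 \<in> I" "X \<in> I \<Longrightarrow> Y \<in> I \<Longrightarrow> X + Y \<in> I"
    "A \<in> B_ops \<Longrightarrow> X \<in> I \<Longrightarrow> A o\<^sub>L X \<in> I" "A \<in> B_ops \<Longrightarrow> X \<in> I \<Longrightarrow> X o\<^sub>L A \<in> I"
  using assms unfolding is_ideal_def by blast+

lemma s_numbers_zero: "s_numbers (0 :: 'h::complex_hilbert \<Rightarrow>\<^sub>L 'h) = (\<lambda>_. 0)"
proof (rule s_numbers_eq)
  have "opr (\<lambda>_. 0) (\<lambda>_. 0) (\<lambda>_. 0) = (0 :: 'h \<Rightarrow>\<^sub>L 'h)"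
    by (rule blinfun_eqI, subst opr_apply[where M = 0]) (auto simp: orthofam_def)
  then show "svd (0 :: 'h \<Rightarrow>\<^sub>L 'h) (\<lambda>_. 0) (\<lambda>_. 0) (\<lambda>_. 0)"
    by (simp add: svd_def orthofam_def c0_star_zero)
qed

text \<open>Addition is where the dilation enters: the index n is at least twice n div 2, and at
  that double index the s-number of the sum is bounded by the two s-numbers at n div 2.\<close>

lemma is_ideal_seq_ideal:
  assumes S: "charset S"
  shows "is_ideal (seq_ideal S :: ('h::complex_hilbert \<Rightarrow>\<^sub>L 'h) set)"
  unfolding is_ideal_def
proof (intro conjI ballI)
  show "seq_ideal S \<subseteq> (compact_ops :: ('h \<Rightarrow>\<^sub>L 'h) set)"
    by (auto simp: seq_ideal_def)
  show "0 \<in> (seq_ideal S :: ('h \<Rightarrow>\<^sub>L 'h) set)"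
    by (simp add: seq_ideal_def compact_ops_zero s_numbers_zero charset_zero[OF S])
next
  fix X Y :: "'h \<Rightarrow>\<^sub>L 'h"
  assume "X \<in> seq_ideal S" "Y \<in> seq_ideal S"
  then have X: "X \<in> compact_ops" "s_numbers X \<in> S" and Y: "Y \<in> compact_ops" "s_numbers Y \<in> S"
    by (auto simp: seq_ideal_def)
  have XY: "X + Y \<in> compact_ops"
    by (rule compact_ops_add[OF X(1) Y(1)])
  obtain b a where svdX: "svd X (s_numbers X) b a"
    using svd_s_numbers[OF X(1)] .
  obtain d c where svdY: "svd Y (s_numbers Y) d c"
    using svd_s_numbers[OF Y(1)] .
  obtain g f where svdZ: "svd (X + Y) (s_numbers (X + Y)) g f"
    using svd_s_numbers[OF XY] .
  have "s_numbers (X + Y) \<in> S"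
  proof (rule charset_mono[OF S charset_div2[OF S charset_add[OF S X(2) Y(2)]] s_numbers_c0[OF XY]])
    fix n
    have "s_numbers (X + Y) n \<le> s_numbers (X + Y) (n div 2 + n div 2)"
      by (rule c0_starD(2)[OF s_numbers_c0[OF XY]]) auto
    also have "\<dots> \<le> s_numbers X (n div 2) + s_numbers Y (n div 2)"
      by (rule svd_add_le[OF svdX svdY svdZ])
    finally show "s_numbers (X + Y) n \<le> s_numbers X (n div 2) + s_numbers Y (n div 2)" .
  qed
  with XY show "X + Y \<in> seq_ideal S"
    by (simp add: seq_ideal_def)
next
  fix A X :: "'h \<Rightarrow>\<^sub>L 'h"
  assume A: "A \<in> B_ops" and "X \<in> seq_ideal S"
  then have X: "X \<in> compact_ops" "s_numbers X \<in> S"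
    by (auto simp: seq_ideal_def)
  obtain b a where svdX: "svd X (s_numbers X) b a"
    using svd_s_numbers[OF X(1)] .
  have AX: "A o\<^sub>L X \<in> compact_ops"
    by (rule compact_ops_compose_left[OF A X(1)])
  obtain d c where svdAX: "svd (A o\<^sub>L X) (s_numbers (A o\<^sub>L X)) d c"
    using svd_s_numbers[OF AX] .
  have XA: "X o\<^sub>L A \<in> compact_ops"
    by (rule compact_ops_compose_right[OF A X(1)])
  obtain g f where svdXA: "svd (X o\<^sub>L A) (s_numbers (X o\<^sub>L A)) g f"
    using svd_s_numbers[OF XA] .
  show "A o\<^sub>L X \<in> seq_ideal S"
    unfolding seq_ideal_def mem_Collect_eq
    using AX charset_scale[OF S X(2) s_numbers_c0[OF AX] svd_compose_left_le[OF svdX svdAX]] by blast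
  show "X o\<^sub>L A \<in> seq_ideal S"
    unfolding seq_ideal_def mem_Collect_eq
    using XA charset_scale[OF S X(2) s_numbers_c0[OF XA] svd_compose_right_le[OF svdX A svdXA]] by blast
qed

definition am_set :: "(nat \<Rightarrow> real) set \<Rightarrow> (nat \<Rightarrow> real) set" where
  "am_set S = {\<xi> \<in> c0_star. \<exists>\<eta>\<in>S. seq_bigo \<xi> (arith_mean \<eta>)}"

definition principal_set :: "(nat \<Rightarrow> real) \<Rightarrow> (nat \<Rightarrow> real) set" where
  "principal_set \<xi> = {\<eta> \<in> c0_star. \<exists>C. \<exists>m>0. \<forall>n. \<eta> n \<le> C * \<xi> (n div m)}"

lemma arith_mean_nonneg: "\<eta> \<in> c0_star \<Longrightarrow> 0 \<le> arith_mean \<eta> n"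
  by (simp add: arith_mean_def sum_nonneg c0_starD(1))

lemma arith_mean_add: "arith_mean (\<lambda>n. \<xi> n + \<eta> n) n = arith_mean \<xi> n + arith_mean \<eta> n"
  by (simp add: arith_mean_def sum.distrib add_divide_distrib)

lemma le_arith_mean:
  assumes "\<eta> \<in> c0_star"
  shows "\<eta> n \<le> arith_mean \<eta> n"
proof -
  have "(\<Sum>j\<le>n. \<eta> n) \<le> (\<Sum>j\<le>n. \<eta> j)"
    by (intro sum_mono c0_starD(2)[OF assms]) auto
  then show ?thesis
    by (simp add: arith_mean_def field_simps)
qed

lemma arith_mean_div2:
  assumes "\<eta> \<in> c0_star"
  shows "arith_mean \<eta> (n div 2) \<le> 2 * arith_mean \<eta> n"
proof -
  have "arith_mean \<eta> (n div 2) \<le> (\<Sum>j\<le>n. \<eta> j) / real (n div 2 + 1)"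
    unfolding arith_mean_def
    by (intro divide_right_mono sum_mono2) (use c0_starD(1)[OF assms] in auto)
  also have "\<dots> \<le> (\<Sum>j\<le>n. \<eta> j) / (real (n + 1) / 2)"
    by (intro divide_left_mono sum_nonneg) (use c0_starD(1)[OF assms] in auto)
  finally show ?thesis
    by (simp add: arith_mean_def mult.commute)
qed

lemma am_set_c0: "\<xi> \<in> am_set S \<Longrightarrow> \<xi> \<in> c0_star"
  by (simp add: am_set_def)

lemma am_setD:
  assumes "charset S" "\<xi> \<in> am_set S"
  shows "\<exists>\<eta>\<in>S. \<exists>C\<ge>0. \<forall>n. \<xi> n \<le> C * arith_mean \<eta> n"
proof -
  obtain \<eta> C where 1: "\<eta> \<in> S" "\<And>n. \<xi> n \<le> C * arith_mean \<eta> n"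
    using assms(2) by (auto simp: am_set_def seq_bigo_def)
  have "\<xi> n \<le> max C 0 * arith_mean \<eta> n" for n
    using 1(2)[of n] mult_right_mono[of C "max C 0" "arith_mean \<eta> n"]
      arith_mean_nonneg[OF charset_c0[OF assms(1) 1(1)], of n] by simp
  with 1(1) show ?thesis
    by (intro bexI[of _ \<eta>] exI[of _ "max C 0"]) simp_all
qed

lemma am_setI: "\<xi> \<in> c0_star \<Longrightarrow> \<eta> \<in> S \<Longrightarrow> (\<And>n. \<xi> n \<le> C * arith_mean \<eta> n) \<Longrightarrow> \<xi> \<in> am_set S"
  by (auto simp: am_set_def seq_bigo_def)

lemma charset_am_set:
  assumes S: "charset S"
  shows "charset (am_set S)"
  unfolding charset_def
proof (intro conjI ballI impI)
  show "am_set S \<subseteq> c0_star"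
    by (auto simp: am_set_def)
  show "(\<lambda>_. 0) \<in> am_set S"
    by (rule am_setI[OF c0_star_zero charset_zero[OF S], of 0]) simp
next
  fix \<xi> \<eta>
  assume \<xi>: "\<xi> \<in> c0_star" and \<eta>: "\<eta> \<in> am_set S" and le: "\<forall>n. \<xi> n \<le> \<eta> n"
  obtain \<zeta> C where z: "\<zeta> \<in> S" "\<And>n. \<eta> n \<le> C * arith_mean \<zeta> n"
    using am_setD[OF S \<eta>] am_set_c0[OF \<eta>] by blast
  show "\<xi> \<in> am_set S"
    by (rule am_setI[OF \<xi> z(1)]) (rule order_trans[OF le[rule_format] z(2)])
next
  fix \<xi> \<eta>
  assume \<xi>: "\<xi> \<in> am_set S" and \<eta>: "\<eta> \<in> am_set S"
  obtain \<xi>' C where 1: "\<xi> \<in> c0_star" "\<xi>' \<in> S" "C \<ge> 0" "\<And>n. \<xi> n \<le> C * arith_mean \<xi>' n"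
    using am_setD[OF S \<xi>] am_set_c0[OF \<xi>] by blast
  obtain \<eta>' D where 2: "\<eta> \<in> c0_star" "\<eta>' \<in> S" "D \<ge> 0" "\<And>n. \<eta> n \<le> D * arith_mean \<eta>' n"
    using am_setD[OF S \<eta>] am_set_c0[OF \<eta>] by blast
  have "\<xi> n + \<eta> n \<le> (C + D) * arith_mean (\<lambda>n. \<xi>' n + \<eta>' n) n" for n
  proof -
    have "0 \<le> C * arith_mean \<eta>' n" "0 \<le> D * arith_mean \<xi>' n"
      using 1(3) 2(3) arith_mean_nonneg[OF charset_c0[OF S 1(2)]] arith_mean_nonneg[OF charset_c0[OF S 2(2)]]
      by auto
    then show ?thesis
      using 1(4)[of n] 2(4)[of n] by (simp add: arith_mean_add algebra_simps)
  qed
  then show "(\<lambda>n. \<xi> n + \<eta> n) \<in> am_set S"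
    by (rule am_setI[OF c0_star_add[OF 1(1) 2(1)] charset_add[OF S 1(2) 2(2)]])
next
  fix \<xi>
  assume \<xi>: "\<xi> \<in> am_set S"
  obtain \<xi>' C where 1: "\<xi> \<in> c0_star" "\<xi>' \<in> S" "C \<ge> 0" "\<And>n. \<xi> n \<le> C * arith_mean \<xi>' n"
    using am_setD[OF S \<xi>] am_set_c0[OF \<xi>] by blast
  have "\<xi> (n div 2) \<le> (C * 2) * arith_mean \<xi>' n" for n
    using 1(4)[of "n div 2"] mult_left_mono[OF arith_mean_div2[OF charset_c0[OF S 1(2)], of n] 1(3)] by simp
  then show "(\<lambda>n. \<xi> (n div 2)) \<in> am_set S"
    by (rule am_setI[OF c0_star_div[OF 1(1)] 1(2), rotated]) simp
qed

lemma subset_am_set: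
  assumes "charset S"
  shows "S \<subseteq> am_set S"
proof
  fix \<xi>
  assume "\<xi> \<in> S"
  with le_arith_mean[OF charset_c0[OF assms this]] charset_c0[OF assms this] show "\<xi> \<in> am_set S"
    by (intro am_setI[of \<xi> \<xi> S 1]) simp_all
qed

lemma principal_set_c0: "\<eta> \<in> principal_set \<xi> \<Longrightarrow> \<eta> \<in> c0_star"
  by (simp add: principal_set_def)

lemma principal_setD:
  assumes "\<xi> \<in> c0_star" "\<eta> \<in> principal_set \<xi>"
  shows "\<exists>C\<ge>0. \<exists>m>0. \<forall>n. \<eta> n \<le> C * \<xi> (n div m)"
proof -
  obtain C m where 1: "m > 0" "\<And>n. \<eta> n \<le> C * \<xi> (n div m)"
    using assms(2) by (auto simp: principal_set_def)
  have "\<eta> n \<le> max C 0 * \<xi> (n div m)" for n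
    using 1(2)[of n] mult_right_mono[of C "max C 0" "\<xi> (n div m)"] c0_starD(1)[OF assms(1), of "n div m"]
    by simp
  with 1(1) show ?thesis
    by (intro exI[of _ "max C 0"] conjI exI[of _ m]) simp_all
qed

lemma principal_setI: "\<eta> \<in> c0_star \<Longrightarrow> m > 0 \<Longrightarrow> (\<And>n. \<eta> n \<le> C * \<xi> (n div m)) \<Longrightarrow> \<eta> \<in> principal_set \<xi>"
  by (auto simp: principal_set_def)

lemma charset_principal_set:
  assumes \<xi>: "\<xi> \<in> c0_star"
  shows "charset (principal_set \<xi>)"
  unfolding charset_def
proof (intro conjI ballI impI)
  show "principal_set \<xi> \<subseteq> c0_star"
    by (auto simp: principal_set_def)
  show "(\<lambda>_. 0) \<in> principal_set \<xi>"
    by (rule principal_setI[OF c0_star_zero, where m = 1 and C = 0]) auto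
next
  fix \<eta> \<zeta>
  assume \<eta>: "\<eta> \<in> c0_star" and \<zeta>: "\<zeta> \<in> principal_set \<xi>" and le: "\<forall>n. \<eta> n \<le> \<zeta> n"
  obtain C m where z: "m > 0" "\<And>n. \<zeta> n \<le> C * \<xi> (n div m)"
    using principal_setD[OF \<xi> \<zeta>] principal_set_c0[OF \<zeta>] by blast
  show "\<eta> \<in> principal_set \<xi>"
    by (rule principal_setI[OF \<eta> z(1)]) (rule order_trans[OF le[rule_format] z(2)])
next
  fix \<eta> \<zeta>
  assume \<eta>: "\<eta> \<in> principal_set \<xi>" and \<zeta>: "\<zeta> \<in> principal_set \<xi>"
  obtain C m where 1: "\<eta> \<in> c0_star" "C \<ge> 0" "m > 0" "\<And>n. \<eta> n \<le> C * \<xi> (n div m)"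
    using principal_setD[OF \<xi> \<eta>] principal_set_c0[OF \<eta>] by blast
  obtain D k where 2: "\<zeta> \<in> c0_star" "D \<ge> 0" "k > 0" "\<And>n. \<zeta> n \<le> D * \<xi> (n div k)"
    using principal_setD[OF \<xi> \<zeta>] principal_set_c0[OF \<zeta>] by blast
  have "\<eta> n + \<zeta> n \<le> (C + D) * \<xi> (n div max m k)" for n
  proof -
    have "\<xi> (n div m) \<le> \<xi> (n div max m k)" "\<xi> (n div k) \<le> \<xi> (n div max m k)"
      using 1(3) 2(3) by (auto intro!: c0_starD(2)[OF \<xi>] div_le_mono2)
    then have "C * \<xi> (n div m) \<le> C * \<xi> (n div max m k)" "D * \<xi> (n div k) \<le> D * \<xi> (n div max m k)"
      using 1(2) 2(2) by (auto intro: mult_left_mono)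
    then show ?thesis
      using 1(4)[of n] 2(4)[of n] by (simp add: algebra_simps)
  qed
  then show "(\<lambda>n. \<eta> n + \<zeta> n) \<in> principal_set \<xi>"
    by (rule principal_setI[OF c0_star_add[OF 1(1) 2(1)], rotated]) (use 1(3) in simp)
next
  fix \<eta>
  assume \<eta>: "\<eta> \<in> principal_set \<xi>"
  obtain C m where 1: "\<eta> \<in> c0_star" "C \<ge> 0" "m > 0" "\<And>n. \<eta> n \<le> C * \<xi> (n div m)"
    using principal_setD[OF \<xi> \<eta>] principal_set_c0[OF \<eta>] by blast
  show "(\<lambda>n. \<eta> (n div 2)) \<in> principal_set \<xi>"
  proof (rule principal_setI)
    show "(\<lambda>n. \<eta> (n div 2)) \<in> c0_star"
      by (rule c0_star_div[OF 1(1)]) simp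
    show "0 < 2 * m"
      using 1(3) by simp
    show "\<eta> (n div 2) \<le> C * \<xi> (n div (2 * m))" for n
      using 1(4)[of "n div 2"] by (simp add: div_mult2_eq)
  qed
qed

lemma self_in_principal_set: "\<xi> \<in> c0_star \<Longrightarrow> \<xi> \<in> principal_set \<xi>"
  by (rule principal_setI[where m = 1 and C = 1]) auto

lemma principal_set_least:
  assumes "charset S" "\<xi> \<in> S"
  shows "principal_set \<xi> \<subseteq> S"
proof
  fix \<eta>
  assume \<eta>: "\<eta> \<in> principal_set \<xi>"
  obtain C m where 1: "\<eta> \<in> c0_star" "C \<ge> 0" "m > 0" "\<And>n. \<eta> n \<le> C * \<xi> (n div m)"
    using principal_setD[OF charset_c0[OF assms] \<eta>] principal_set_c0[OF \<eta>] by blast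
  show "\<eta> \<in> S"
    by (rule charset_scale[OF assms(1) charset_div[OF assms 1(3)] 1(1,4)])
qed

lemma charset_fin_seqs: "charset fin_seqs"
  unfolding charset_def
proof (intro conjI ballI impI)
  show "fin_seqs \<subseteq> c0_star" "(\<lambda>_. 0) \<in> fin_seqs"
    by (auto simp: fin_seqs_def c0_star_zero)
next
  fix \<xi> \<eta>
  assume \<xi>: "\<xi> \<in> c0_star" and \<eta>: "\<eta> \<in> fin_seqs" and le: "\<forall>n. \<xi> n \<le> \<eta> n"
  obtain N where "\<forall>n\<ge>N. \<eta> n = 0"
    using \<eta> by (auto simp: fin_seqs_def)
  then have "\<forall>n\<ge>N. \<xi> n = 0"
    using le c0_starD(1)[OF \<xi>] by (metis order_antisym)
  with \<xi> show "\<xi> \<in> fin_seqs"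
    by (auto simp: fin_seqs_def)
next
  fix \<xi> \<eta>
  assume "\<xi> \<in> fin_seqs" "\<eta> \<in> fin_seqs"
  then obtain M N where 1: "\<xi> \<in> c0_star" "\<eta> \<in> c0_star" "\<forall>n\<ge>M. \<xi> n = 0" "\<forall>n\<ge>N. \<eta> n = 0"
    by (auto simp: fin_seqs_def)
  then have "\<forall>n\<ge>max M N. \<xi> n + \<eta> n = 0"
    by simp
  with c0_star_add[OF 1(1,2)] show "(\<lambda>n. \<xi> n + \<eta> n) \<in> fin_seqs"
    by (auto simp only: fin_seqs_def mem_Collect_eq)
next
  fix \<xi>
  assume "\<xi> \<in> fin_seqs"
  then obtain M where 1: "\<xi> \<in> c0_star" "\<forall>n\<ge>M. \<xi> n = 0"
    by (auto simp: fin_seqs_def)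
  then have "\<forall>n\<ge>2 * M. \<xi> (n div 2) = 0"
    by simp
  with c0_star_div[OF 1(1), of 2] show "(\<lambda>n. \<xi> (n div 2)) \<in> fin_seqs"
    by (auto simp only: fin_seqs_def mem_Collect_eq)
qed

section \<open>Transfer between ideals and characteristic sets\<close>

locale onb =
  fixes e :: "nat \<Rightarrow> 'h::complex_hilbert"
  assumes onb: "orthonormal_basis e"
begin

lemma norm_e: "norm (e n) = 1"
proof -
  have "cinner (e n) (e n) = 1"
    using onb by (simp add: orthonormal_basis_def)
  then show ?thesis
    unfolding cinner_self of_real_eq_1_iff by (simp add: power2_eq_1_iff) (use norm_ge_zero[of "e n"] in linarith)
qed

lemma orthofam_e: "orthofam e"
  using onb norm_e by (auto simp: orthofam_def orthonormal_basis_def)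

lemma svd_diag: "\<xi> \<in> c0_star \<Longrightarrow> svd (diag e \<xi>) \<xi> e e"
  by (simp add: svd_def diag_eq_opr orthofam_e norm_e)

lemma s_numbers_diag: "\<xi> \<in> c0_star \<Longrightarrow> s_numbers (diag e \<xi>) = \<xi>"
  by (rule s_numbers_eq[OF svd_diag])

lemma compact_diag: "\<xi> \<in> c0_star \<Longrightarrow> diag e \<xi> \<in> compact_ops"
  unfolding diag_eq_opr by (rule opr_compact) (auto simp: orthofam_e)

text \<open>The operators with coefficients \<open>k\<close> are partial isometries that carry the
  singular vectors to the basis and back. Multiplying by them on both sides turns \<open>X\<close>
  into the diagonal operator and conversely.\<close>

lemma svd_mem_iff:
  assumes I: "is_ideal I" and svd: "svd X s b a"
  shows "X \<in> I \<longleftrightarrow> diag e s \<in> I"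
proof -
  note svd' = svdD[OF svd]
  define k where "k n = (if s n = 0 then 0 else 1 :: real)" for n
  have k: "\<forall>n. \<bar>k n\<bar> \<le> 1"
    by (simp add: k_def)
  have s: "\<forall>n. \<bar>s n\<bar> \<le> s 0"
    by (rule c0_starD(4)[OF svd'(2)])
  have ks: "(\<lambda>n. k n * s n) = s" "(\<lambda>n. s n * k n) = s"
    by (auto simp: k_def)
  have 1: "opr b k e o\<^sub>L (diag e s o\<^sub>L opr e k a) = X"
    unfolding diag_eq_opr
    by (simp add: opr_compose[OF svd'(4) orthofam_e orthofam_e k s] norm_e ks
        opr_compose[OF svd'(4) orthofam_e svd'(3) s k] svd'(1))
  have "X o\<^sub>L opr a k e = opr b s e"
    using opr_compose[OF orthofam_e svd'(4,3) k s] svd'(6) by (simp add: svd'(1) ks)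
  then have 2: "opr e k b o\<^sub>L (X o\<^sub>L opr a k e) = diag e s"
    using opr_compose[OF orthofam_e svd'(3) orthofam_e s k] svd'(5) by (simp add: ks diag_eq_opr)
  have B: "opr b k e \<in> B_ops" "opr e k a \<in> B_ops" "opr a k e \<in> B_ops" "opr e k b \<in> B_ops"
    by (auto intro: opr_in_B_ops[OF _ _ k] orthofam_e svd'(3,4))
  show ?thesis
    using idealD(4,5)[OF I] B 1 2 by metis
qed

lemma char_set_eq:
  assumes I: "is_ideal I"
  shows "char_set I = {\<xi> \<in> c0_star. diag e \<xi> \<in> I}"
proof (intro set_eqI iffI)
  fix \<xi>
  assume "\<xi> \<in> char_set I"
  then obtain X where X: "X \<in> I" "\<xi> = s_numbers X"
    by (auto simp: char_set_def)
  have C: "X \<in> compact_ops"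
    by (rule idealD(1)[OF I X(1)])
  obtain b a where "svd X (s_numbers X) b a"
    using svd_s_numbers[OF C] .
  then show "\<xi> \<in> {\<xi> \<in> c0_star. diag e \<xi> \<in> I}"
    using svd_mem_iff[OF I] s_numbers_c0[OF C] X by auto
next
  fix \<xi>
  assume "\<xi> \<in> {\<xi> \<in> c0_star. diag e \<xi> \<in> I}"
  then show "\<xi> \<in> char_set I"
    unfolding char_set_def using s_numbers_diag[of \<xi>] by force
qed

lemma ideal_eq_seq_ideal:
  fixes I :: "('h \<Rightarrow>\<^sub>L 'h) set"
  assumes I: "is_ideal I"
  shows "I = seq_ideal (char_set I)"
proof (intro set_eqI iffI)
  fix X :: "'h \<Rightarrow>\<^sub>L 'h"
  assume "X \<in> I"
  then show "X \<in> seq_ideal (char_set I)"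
    using idealD(1)[OF I] by (auto simp: seq_ideal_def char_set_def)
next
  fix X :: "'h \<Rightarrow>\<^sub>L 'h"
  assume "X \<in> seq_ideal (char_set I)"
  then have C: "X \<in> compact_ops" and "s_numbers X \<in> char_set I"
    by (auto simp: seq_ideal_def)
  then have "diag e (s_numbers X) \<in> I"
    by (simp add: char_set_eq[OF I])
  then show "X \<in> I"
    using svd_mem_iff[OF I] svd_s_numbers[OF C] by blast
qed

lemma char_set_seq_ideal:
  assumes "charset S"
  shows "char_set (seq_ideal S :: ('h \<Rightarrow>\<^sub>L 'h) set) = S"
proof -
  have "diag e \<xi> \<in> seq_ideal S \<longleftrightarrow> \<xi> \<in> S" if "\<xi> \<in> c0_star" for \<xi>
    using that by (simp add: seq_ideal_def compact_diag s_numbers_diag)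
  then show ?thesis
    unfolding char_set_eq[OF is_ideal_seq_ideal[OF assms]] using charset_c0[OF assms] by blast
qed

text \<open>Heredity is multiplication by a diagonal contraction. The dilated sequence is a sum of
  two copies of \<xi>, one spread over the even and one over the odd basis vectors, and each copy is
  obtained from the diagonal operator by isometries.\<close>

lemma charset_char_set:
  fixes I :: "('h \<Rightarrow>\<^sub>L 'h) set"
  assumes I: "is_ideal I"
  shows "charset (char_set I)"
  unfolding charset_def char_set_eq[OF I]
proof (intro conjI ballI impI)
  show "{\<xi> \<in> c0_star. diag e \<xi> \<in> I} \<subseteq> c0_star"
    by blast
  have "opr e (\<lambda>_. 0) e = 0"
    by (rule blinfun_eqI, subst opr_apply[where M = 0]) (auto simp: orthofam_e)
  then show "(\<lambda>_. 0) \<in> {\<xi> \<in> c0_star. diag e \<xi> \<in> I}"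
    by (simp add: c0_star_zero diag_eq_opr idealD(2)[OF I])
next
  fix \<xi> \<eta>
  assume \<xi>: "\<xi> \<in> c0_star" and "\<eta> \<in> {\<xi> \<in> c0_star. diag e \<xi> \<in> I}" and le: "\<forall>n. \<xi> n \<le> \<eta> n"
  then have \<eta>: "\<eta> \<in> c0_star" "diag e \<eta> \<in> I"
    by auto
  \<comment> \<open>Where \<eta> vanishes so does \<xi>, so the value 0 of the quotient is the right
    one.\<close>
  define r where "r n = \<xi> n / \<eta> n" for n
  have r: "\<forall>n. \<bar>r n\<bar> \<le> 1"
    using le c0_starD(1)[OF \<xi>] c0_starD(1)[OF \<eta>(1)] by (auto simp: r_def divide_le_eq_1 less_le)
  have r\<eta>: "(\<lambda>n. r n * \<eta> n) = \<xi>"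
  proof
    fix n
    show "r n * \<eta> n = \<xi> n"
      using le[rule_format, of n] c0_starD(1)[OF \<xi>, of n] by (cases "\<eta> n = 0") (auto simp: r_def)
  qed
  have "opr e r e o\<^sub>L diag e \<eta> = diag e \<xi>"
    using opr_compose[OF orthofam_e orthofam_e orthofam_e c0_starD(4)[OF \<eta>(1)] r]
    by (simp add: norm_e r\<eta> diag_eq_opr)
  then have "diag e \<xi> \<in> I"
    using idealD(4)[OF I opr_in_B_ops[OF orthofam_e orthofam_e r] \<eta>(2)] by simp
  with \<xi> show "\<xi> \<in> {\<xi> \<in> c0_star. diag e \<xi> \<in> I}"
    by simp
next
  fix \<xi> \<eta>
  assume "\<xi> \<in> {\<xi> \<in> c0_star. diag e \<xi> \<in> I}" "\<eta> \<in> {\<xi> \<in> c0_star. diag e \<xi> \<in> I}"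
  then show "(\<lambda>n. \<xi> n + \<eta> n) \<in> {\<xi> \<in> c0_star. diag e \<xi> \<in> I}"
    using opr_add[OF orthofam_e orthofam_e c0_starD(4) c0_starD(4), of \<xi> \<eta>]
    by (simp add: c0_star_add diag_eq_opr idealD(3)[OF I])
next
  fix \<xi>
  assume "\<xi> \<in> {\<xi> \<in> c0_star. diag e \<xi> \<in> I}"
  then have \<xi>: "\<xi> \<in> c0_star" "diag e \<xi> \<in> I"
    by auto
  note bd = c0_starD(4)[OF \<xi>(1)]
  have sub: "opr (\<lambda>n. e (g n)) \<xi> (\<lambda>n. e (g n)) \<in> I" if g: "strict_mono (g :: nat \<Rightarrow> nat)" for g
  proof -
    let ?f = "\<lambda>n. e (g n)"
    have f: "orthofam ?f"
      by (rule orthofam_reindex[OF orthofam_e g])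
    have 1: "\<forall>n::nat. \<bar>1 :: real\<bar> \<le> 1"
      by simp
    have "opr ?f \<xi> ?f = opr ?f (\<lambda>_. 1) e o\<^sub>L (diag e \<xi> o\<^sub>L opr e (\<lambda>_. 1) ?f)"
      using opr_compose[OF f orthofam_e orthofam_e 1 bd] opr_compose[OF f orthofam_e f bd 1]
      by (simp add: norm_e diag_eq_opr)
    then show ?thesis
      using idealD(4,5)[OF I] \<xi>(2) opr_in_B_ops[OF orthofam_e f 1] opr_in_B_ops[OF f orthofam_e 1] by metis
  qed
  define \<alpha> where "\<alpha> n = (if even n then \<xi> (n div 2) else 0)" for n
  define \<beta> where "\<beta> n = (if odd n then \<xi> (n div 2) else 0)" for n
  have \<alpha>: "\<forall>n. \<bar>\<alpha> n\<bar> \<le> \<xi> 0" and \<beta>: "\<forall>n. \<bar>\<beta> n\<bar> \<le> \<xi> 0"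
    using bd c0_starD(1)[OF \<xi>(1)] by (auto simp: \<alpha>_def \<beta>_def)
  have g: "strict_mono (\<lambda>n::nat. 2 * n)" "strict_mono (\<lambda>n::nat. 2 * n + 1)"
    by (auto simp: strict_mono_def)
  have "opr (\<lambda>n. e (2 * n)) (\<lambda>n. \<alpha> (2 * n)) (\<lambda>n. e (2 * n)) = opr e \<alpha> e"
    by (rule opr_reindex[OF orthofam_e orthofam_e \<alpha> g(1)]) (auto simp: \<alpha>_def elim!: evenE)
  then have A: "opr e \<alpha> e \<in> I"
    using sub[OF g(1)] by (simp add: \<alpha>_def)
  have "opr (\<lambda>n. e (2 * n + 1)) (\<lambda>n. \<beta> (2 * n + 1)) (\<lambda>n. e (2 * n + 1)) = opr e \<beta> e"
    by (rule opr_reindex[OF orthofam_e orthofam_e \<beta> g(2)]) (auto simp: \<beta>_def elim!: oddE)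
  then have B: "opr e \<beta> e \<in> I"
    using sub[OF g(2)] by (simp add: \<beta>_def)
  have "(\<lambda>n. \<alpha> n + \<beta> n) = (\<lambda>n. \<xi> (n div 2))"
    by (auto simp: \<alpha>_def \<beta>_def)
  then have "diag e (\<lambda>n. \<xi> (n div 2)) = opr e \<alpha> e + opr e \<beta> e"
    using opr_add[OF orthofam_e orthofam_e \<alpha> \<beta>] by (simp add: diag_eq_opr)
  with idealD(3)[OF I A B] c0_star_div[OF \<xi>(1), of 2]
  show "(\<lambda>n. \<xi> (n div 2)) \<in> {\<xi> \<in> c0_star. diag e \<xi> \<in> I}"
    by simp
qed

lemma seq_ideal_subset_iff:
  assumes "charset S" "charset T"
  shows "(seq_ideal S :: ('h \<Rightarrow>\<^sub>L 'h) set) \<subseteq> seq_ideal T \<longleftrightarrow> S \<subseteq> T"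
proof
  assume "(seq_ideal S :: ('h \<Rightarrow>\<^sub>L 'h) set) \<subseteq> seq_ideal T"
  then have "char_set (seq_ideal S :: ('h \<Rightarrow>\<^sub>L 'h) set) \<subseteq> char_set (seq_ideal T :: ('h \<Rightarrow>\<^sub>L 'h) set)"
    by (auto simp: char_set_def)
  then show "S \<subseteq> T"
    by (simp add: char_set_seq_ideal assms)
qed (auto simp: seq_ideal_def)

lemma am_ideal_eq:
  fixes I :: "('h \<Rightarrow>\<^sub>L 'h) set"
  assumes I: "is_ideal I"
  shows "am_ideal I = seq_ideal (am_set (char_set I))"
  unfolding am_ideal_def am_set_def[symmetric]
proof (rule the_equality)
  note cs = charset_am_set[OF charset_char_set[OF I]]
  show "is_ideal (seq_ideal (am_set (char_set I)) :: ('h \<Rightarrow>\<^sub>L 'h) set) \<and>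
      char_set (seq_ideal (am_set (char_set I)) :: ('h \<Rightarrow>\<^sub>L 'h) set) = am_set (char_set I)"
    using is_ideal_seq_ideal[OF cs] char_set_seq_ideal[OF cs] by blast
next
  fix J :: "('h \<Rightarrow>\<^sub>L 'h) set"
  assume "is_ideal J \<and> char_set J = am_set (char_set I)"
  then show "J = seq_ideal (am_set (char_set I))"
    using ideal_eq_seq_ideal[of J] by simp
qed

lemma am_ideal_seq_ideal:
  assumes "charset S"
  shows "am_ideal (seq_ideal S :: ('h \<Rightarrow>\<^sub>L 'h) set) = seq_ideal (am_set S)"
  by (simp add: am_ideal_eq[OF is_ideal_seq_ideal[OF assms]] char_set_seq_ideal[OF assms])

lemma am_stable_seq_ideal:
  assumes "charset S"
  shows "am_stable (seq_ideal S :: ('h \<Rightarrow>\<^sub>L 'h) set) \<longleftrightarrow> am_set S \<subseteq> S"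
  unfolding am_stable_def am_ideal_seq_ideal[OF assms]
  using seq_ideal_subset_iff[OF assms charset_am_set[OF assms]]
    seq_ideal_subset_iff[OF charset_am_set[OF assms] assms] subset_am_set[OF assms]
  by (metis subset_antisym order_refl)

lemma principal_ideal_eq:
  assumes \<xi>: "\<xi> \<in> c0_star"
  shows "principal_ideal e \<xi> = seq_ideal (principal_set \<xi>)"
  unfolding principal_ideal_def generated_ideal_def
proof (rule order_antisym)
  note cs = charset_principal_set[OF \<xi>]
  show "\<Inter> {J. is_ideal J \<and> diag e \<xi> \<in> J} \<subseteq> seq_ideal (principal_set \<xi>)"
    using is_ideal_seq_ideal[OF cs] self_in_principal_set[OF \<xi>]
    by (intro Inter_lower) (simp add: seq_ideal_def compact_diag s_numbers_diag \<xi>)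
  show "seq_ideal (principal_set \<xi>) \<subseteq> \<Inter> {J. is_ideal J \<and> diag e \<xi> \<in> J}"
  proof (rule Inter_greatest)
    fix J
    assume "J \<in> {J. is_ideal J \<and> diag e \<xi> \<in> J}"
    then have J: "is_ideal J" "diag e \<xi> \<in> J"
      by auto
    have "principal_set \<xi> \<subseteq> char_set J"
      by (rule principal_set_least[OF charset_char_set[OF J(1)]]) (simp add: char_set_eq J \<xi>)
    then show "seq_ideal (principal_set \<xi>) \<subseteq> J"
      by (subst ideal_eq_seq_ideal[OF J(1)]) (auto simp: seq_ideal_def)
  qed
qed

text \<open>The set \<open>R\<close> in the upper bound may depend on \<xi>, because
  \<open>T\<close> need not satisfy the domination itself.\<close>

lemma hat_ideal_eq:
  assumes S: "charset S"
    and lower: "\<And>R. charset R \<Longrightarrow> am_set S \<subseteq> am_set R \<Longrightarrow> T \<subseteq> R"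
    and upper: "\<And>\<xi>. \<xi> \<in> c0_star \<Longrightarrow> \<xi> \<notin> T \<Longrightarrow> \<exists>R. charset R \<and> am_set S \<subseteq> am_set R \<and> \<xi> \<notin> R"
  shows "hat_ideal (seq_ideal S :: ('h \<Rightarrow>\<^sub>L 'h) set) = seq_ideal T"
  unfolding hat_ideal_def am_ideal_seq_ideal[OF S]
proof (rule order_antisym)
  show "seq_ideal T \<subseteq> \<Inter> {J. is_ideal J \<and> seq_ideal (am_set S) \<subseteq> am_ideal (J :: ('h \<Rightarrow>\<^sub>L 'h) set)}"
  proof (rule Inter_greatest)
    fix J :: "('h \<Rightarrow>\<^sub>L 'h) set"
    assume "J \<in> {J. is_ideal J \<and> seq_ideal (am_set S) \<subseteq> am_ideal J}"
    then have J: "is_ideal J" and sub: "(seq_ideal (am_set S) :: ('h \<Rightarrow>\<^sub>L 'h) set) \<subseteq> am_ideal J"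
      by auto
    note cs = charset_char_set[OF J]
    have "am_set S \<subseteq> am_set (char_set J)"
      using sub seq_ideal_subset_iff[OF charset_am_set[OF S] charset_am_set[OF cs]] am_ideal_eq[OF J]
      by simp
    from lower[OF cs this] show "seq_ideal T \<subseteq> J"
      by (subst ideal_eq_seq_ideal[OF J]) (auto simp: seq_ideal_def)
  qed
  show "\<Inter> {J. is_ideal J \<and> seq_ideal (am_set S) \<subseteq> am_ideal (J :: ('h \<Rightarrow>\<^sub>L 'h) set)} \<subseteq> seq_ideal T"
  proof
    fix X :: "'h \<Rightarrow>\<^sub>L 'h"
    assume "X \<in> \<Inter> {J. is_ideal J \<and> seq_ideal (am_set S) \<subseteq> am_ideal J}"
    then have X: "X \<in> J" if "is_ideal J" "seq_ideal (am_set S) \<subseteq> am_ideal J" for J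
      using that by blast
    \<comment> \<open>The ideal itself belongs to the family being intersected. This makes
      \<open>X\<close> compact, so that its s-numbers are meaningful.\<close>
    have "X \<in> seq_ideal S"
      by (rule X[OF is_ideal_seq_ideal[OF S]]) (simp add: am_ideal_seq_ideal[OF S])
    then have C: "X \<in> compact_ops"
      by (simp add: seq_ideal_def)
    have "s_numbers X \<in> T"
    proof (rule ccontr)
      assume "s_numbers X \<notin> T"
      from upper[OF s_numbers_c0[OF C] this] obtain R
        where R: "charset R" "am_set S \<subseteq> am_set R" "s_numbers X \<notin> R"
        by blast
      have "(seq_ideal (am_set S) :: ('h \<Rightarrow>\<^sub>L 'h) set) \<subseteq> am_ideal (seq_ideal R)"
        unfolding am_ideal_seq_ideal[OF R(1)] using R(2) by (auto simp: seq_ideal_def)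
      then have "X \<in> seq_ideal R"
        by (rule X[OF is_ideal_seq_ideal[OF R(1)]])
      with R(3) show False
        by (simp add: seq_ideal_def)
    qed
    with C show "X \<in> seq_ideal T"
      by (simp add: seq_ideal_def)
  qed
qed

end

section \<open>Sequence estimates\<close>

lemma arith_mean_le_iff:
  "arith_mean \<xi> n \<le> C * arith_mean \<eta> n \<longleftrightarrow> (\<Sum>j<Suc n. \<xi> j) \<le> C * (\<Sum>j<Suc n. \<eta> j)"
  unfolding arith_mean_def lessThan_Suc_atMost[symmetric]
  by (simp add: divide_le_cancel del: sum.lessThan_Suc)

lemma sum_le_split:
  assumes "\<eta> \<in> c0_star"
  shows "(\<Sum>j<n. \<eta> j) \<le> real m * \<eta> 0 + real n * \<eta> m"
proof -
  have "(\<Sum>j<n. \<eta> j) \<le> (\<Sum>j<n. (if j < m then \<eta> 0 else 0) + \<eta> m)"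
    using c0_starD(1)[OF assms, of m] c0_starD(2)[OF assms]
    by (intro sum_mono) (auto simp: not_less add_increasing2)
  also have "\<dots> = real (card {j. j < n \<and> j < m}) * \<eta> 0 + real n * \<eta> m"
    by (simp add: sum.distrib sum.If_cases Int_def lessThan_def)
  also have "real (card {j. j < n \<and> j < m}) * \<eta> 0 \<le> real m * \<eta> 0"
    using card_mono[of "{..<m}" "{j. j < n \<and> j < m}"] c0_starD(1)[OF assms, of 0]
    by (intro mult_right_mono) auto
  finally show ?thesis
    by simp
qed

text \<open>Cesaro: the sum is split at an index N where \<eta> is already small, and the share of
  the first N terms vanishes after division by the length.\<close>

lemma c0_star_arith_mean:
  assumes "\<eta> \<in> c0_star"
  shows "arith_mean \<eta> \<in> c0_star"
proof (rule c0_starI)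
  show "0 \<le> arith_mean \<eta> n" for n
    by (rule arith_mean_nonneg[OF assms])
  show "arith_mean \<eta> (Suc n) \<le> arith_mean \<eta> n" for n
  proof -
    have "\<eta> (Suc n) \<le> arith_mean \<eta> n"
      using c0_starD(2)[OF assms, of n "Suc n"] le_arith_mean[OF assms, of n] by simp
    then show ?thesis
      by (simp add: arith_mean_def field_simps)
  qed
  show "arith_mean \<eta> \<longlonglongrightarrow> 0"
  proof (rule LIMSEQ_I)
    fix r :: real
    assume r: "r > 0"
    obtain N where "\<forall>n\<ge>N. norm (\<eta> n - 0) < r / 2"
      using LIMSEQ_D[OF c0_starD(3)[OF assms], of "r / 2"] r by auto
    then have N: "\<eta> N < r / 2"
      using c0_starD(1)[OF assms, of N] by force
    have "(\<lambda>n. real N * \<eta> 0 / real (Suc n)) \<longlonglongrightarrow> 0"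
      by real_asymp
    from LIMSEQ_D[OF this, of "r / 2"] r obtain M
      where M: "\<And>n. n \<ge> M \<Longrightarrow> norm (real N * \<eta> 0 / real (Suc n)) < r / 2"
      by auto
    have "norm (arith_mean \<eta> n - 0) < r" if "n \<ge> M" for n
    proof -
      have "arith_mean \<eta> n = (\<Sum>j<Suc n. \<eta> j) / real (Suc n)"
        by (simp add: arith_mean_def lessThan_Suc_atMost[symmetric] del: sum.lessThan_Suc)
      also have "\<dots> \<le> (real N * \<eta> 0 + real (Suc n) * \<eta> N) / real (Suc n)"
        by (intro divide_right_mono sum_le_split assms) simp
      also have "\<dots> = real N * \<eta> 0 / real (Suc n) + \<eta> N"
        by (simp add: add_divide_distrib del: of_nat_Suc)
      also have "\<dots> < r"
        using M[OF that] N abs_ge_self[of "real N * \<eta> 0 / real (Suc n)"]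
        unfolding real_norm_def by linarith
      finally show ?thesis
        using arith_mean_nonneg[OF assms, of n] by simp
    qed
    then show "\<exists>M. \<forall>n\<ge>M. norm (arith_mean \<eta> n - 0) < r"
      by blast
  qed
qed

text \<open>Each quotient \<open>j div m\<close> occurs at most m times. Dilations thus cost only a
  factor in partial sums, so the arithmetic mean of a principal ideal is controlled by the mean of
  its generator alone.\<close>

lemma sum_div_le:
  assumes \<pi>: "\<pi> \<in> c0_star" and m: "m > 0"
  shows "(\<Sum>j<n. \<pi> (j div m)) \<le> real m * (\<Sum>j<n. \<pi> j)"
proof -
  have "(\<Sum>j<n. \<pi> (j div m)) = (\<Sum>i<n. \<Sum>j\<in>{j \<in> {..<n}. j div m = i}. \<pi> (j div m))"
    by (rule sum.group[symmetric]) (use m in \<open>auto intro: le_less_trans[OF div_le_dividend]\<close>)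
  also have "\<dots> = (\<Sum>i<n. real (card {j \<in> {..<n}. j div m = i}) * \<pi> i)"
    by (intro sum.cong refl) simp
  also have "\<dots> \<le> (\<Sum>i<n. real m * \<pi> i)"
  proof (intro sum_mono mult_right_mono c0_starD(1)[OF \<pi>])
    fix i
    have "{j \<in> {..<n}. j div m = i} \<subseteq> {i * m..<i * m + m}"
      using m by (auto simp: dividend_less_div_times) 
        (metis add.commute dividend_less_div_times mult.commute)
    then have "card {j \<in> {..<n}. j div m = i} \<le> card {i * m..<i * m + m}"
      by (intro card_mono) auto
    then show "real (card {j \<in> {..<n}. j div m = i}) \<le> real m"
      by simp
  qed
  finally show ?thesis
    by (simp add: sum_distrib_left)
qed

lemma am_set_principalD:
  assumes \<pi>: "\<pi> \<in> c0_star" and \<xi>: "\<xi> \<in> am_set (principal_set \<pi>)"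
  shows "\<exists>C\<ge>0. \<forall>n. \<xi> n \<le> C * arith_mean \<pi> n"
proof -
  obtain \<theta> D where 1: "\<xi> \<in> c0_star" "\<theta> \<in> principal_set \<pi>" "D \<ge> 0" "\<forall>n. \<xi> n \<le> D * arith_mean \<theta> n"
    using am_setD[OF charset_principal_set[OF \<pi>] \<xi>] am_set_c0[OF \<xi>] by blast
  obtain E m where 2: "E \<ge> 0" "m > 0" "\<forall>n. \<theta> n \<le> E * \<pi> (n div m)"
    using principal_setD[OF \<pi> 1(2)] principal_set_c0[OF 1(2)] by blast
  have "arith_mean \<theta> n \<le> (E * real m) * arith_mean \<pi> n" for n
  proof -
    have "(\<Sum>j<Suc n. \<theta> j) \<le> (\<Sum>j<Suc n. E * \<pi> (j div m))"
      using 2(3) by (intro sum_mono) simp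
    also have "\<dots> = E * (\<Sum>j<Suc n. \<pi> (j div m))"
      by (simp only: sum_distrib_left)
    also have "\<dots> \<le> E * (real m * (\<Sum>j<Suc n. \<pi> j))"
      by (intro mult_left_mono sum_div_le \<pi> 2)
    finally show ?thesis
      unfolding arith_mean_le_iff by (simp only: mult.assoc)
  qed
  then have "D * arith_mean \<theta> n \<le> D * (E * real m * arith_mean \<pi> n)" for n
    by (intro mult_left_mono 1)
  then have "\<forall>n. \<xi> n \<le> (D * (E * real m)) * arith_mean \<pi> n"
    using 1(4) order_trans by (simp only: mult.assoc) blast
  with 1 2 show ?thesis
    by (intro exI[of _ "D * (E * real m)"]) simp
qed

lemma am_set_principal_subset:
  assumes \<pi>: "\<pi> \<in> c0_star" and \<eta>: "\<eta> \<in> S" and le: "\<And>n. arith_mean \<pi> n \<le> C * arith_mean \<eta> n"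
  shows "am_set (principal_set \<pi>) \<subseteq> am_set S"
proof
  fix \<xi>
  assume \<xi>: "\<xi> \<in> am_set (principal_set \<pi>)"
  obtain D where D: "\<xi> \<in> c0_star" "D \<ge> 0" "\<forall>n. \<xi> n \<le> D * arith_mean \<pi> n"
    using am_set_principalD[OF \<pi> \<xi>] am_set_c0[OF \<xi>] by blast
  show "\<xi> \<in> am_set S"
  proof (rule am_setI[OF D(1) \<eta>])
    show "\<xi> n \<le> (D * C) * arith_mean \<eta> n" for n
      using D(3)[rule_format, of n] mult_left_mono[OF le[of n] D(2)] by simp
  qed
qed

text \<open>Otherwise the bound would hold from some index on, and since \<zeta> is positive the
  finitely many earlier terms could be absorbed into the constant.\<close>

lemma not_principal_ex:
  assumes \<xi>: "\<xi> \<in> c0_star" and not: "\<xi> \<notin> principal_set \<zeta>" and pos: "\<And>n. \<zeta> n > 0" and m: "m > 0"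
  shows "\<exists>n\<ge>N. \<xi> n > K * \<zeta> (n div m)"
proof (rule ccontr)
  assume "\<not> ?thesis"
  then have le: "\<xi> n \<le> K * \<zeta> (n div m)" if "n \<ge> N" for n
    using that by force
  define C where "C = (\<Sum>n<N. \<xi> n / \<zeta> (n div m))"
  have nonneg: "\<xi> n / \<zeta> (n div m) \<ge> 0" for n
    using c0_starD(1)[OF \<xi>, of n] pos[of "n div m"] by simp
  then have C: "C \<ge> 0"
    by (simp add: C_def sum_nonneg)
  have "\<xi> n \<le> (max K 0 + C) * \<zeta> (n div m)" for n
  proof (cases "n < N")
    case True
    then have "\<xi> n / \<zeta> (n div m) \<le> C"
      unfolding C_def by (intro member_le_sum) (auto simp: nonneg)
    also have "C \<le> max K 0 + C"
      by simp
    finally show ?thesis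
      using pos[of "n div m"] by (simp add: field_simps)
  next
    case False
    have "\<xi> n \<le> K * \<zeta> (n div m)"
      using False by (intro le) simp
    also have "\<dots> \<le> (max K 0 + C) * \<zeta> (n div m)"
      using C less_imp_le[OF pos] by (intro mult_right_mono) auto
    finally show ?thesis .
  qed
  then have "\<xi> \<in> principal_set \<zeta>"
    by (rule principal_setI[OF \<xi> m])
  with not show False
    by simp
qed

text \<open>The sequence is constant on consecutive blocks. On the block starting at \<open>N'\<close> its value
  \<open>\<epsilon>'\<close> is taken as \<open>\<Psi> (\<epsilon> N')\<close>, where \<open>\<epsilon>\<close> is the value before: up to the point where
  \<open>\<Phi>\<close> exceeds \<open>\<epsilon> N'\<close> the partial sum at \<open>N'\<close> suffices, and beyond it the slope \<open>\<epsilon>'\<close> does.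
  Thus the partial sums dominate \<open>\<Phi>\<close> although \<open>N'\<close> may be chosen such that \<open>\<xi>\<close> is much
  larger than \<open>\<epsilon>'\<close> there.\<close>

lemma lacunary_sequence:
  fixes \<Phi> :: "nat \<Rightarrow> real" and \<Psi> :: "real \<Rightarrow> real"
  assumes \<Psi>_pos: "\<And>y. y > 0 \<Longrightarrow> \<Psi> y > 0" and \<Psi>_lim: "(\<Psi> \<longlongrightarrow> 0) at_top"
    and \<Phi>: "\<And>y n. y > 0 \<Longrightarrow> \<Phi> n \<le> max y (\<Psi> y * real n)" and \<Phi>_le: "\<And>n. \<Phi> n \<le> real n"
    and \<xi>: "\<And>\<epsilon> k N. \<epsilon> > 0 \<Longrightarrow> k > 0 \<Longrightarrow> \<exists>n\<ge>N. \<xi> n > real k * \<Psi> (\<epsilon> * real (n div k))"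
  shows "\<exists>\<eta>\<in>c0_star. \<eta> 0 = 1 \<and> (\<forall>n. \<Phi> n \<le> (\<Sum>j<n. \<eta> j)) \<and> \<xi> \<notin> principal_set \<eta>"
proof -
  have step: "\<exists>n. M < n div k \<and> \<Psi> (\<epsilon> * real (n div k)) \<le> \<epsilon> / 2 \<and> \<xi> n > real k * \<Psi> (\<epsilon> * real (n div k))"
    if pos: "\<epsilon> > 0" "k > 0" for \<epsilon> k M
  proof -
    have "(\<lambda>n. \<Psi> (\<epsilon> * real n)) \<longlonglongrightarrow> 0"
      using that
      by (intro filterlim_compose[OF \<Psi>_lim] filterlim_tendsto_pos_mult_at_top[OF tendsto_const]
          filterlim_real_sequentially)
    from LIMSEQ_D[OF this, of "\<epsilon> / 2"] that obtain L
      where L: "\<And>n. n \<ge> L \<Longrightarrow> norm (\<Psi> (\<epsilon> * real n) - 0) < \<epsilon> / 2"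
      by auto
    obtain n where n: "n \<ge> max L (Suc M) * k" "\<xi> n > real k * \<Psi> (\<epsilon> * real (n div k))"
      using \<xi>[OF pos] by blast
    have "n div k \<ge> max L (Suc M)"
      using n(1) that by (simp only: less_eq_div_iff_mult_less_eq)
    with L[of "n div k"] n(2) show ?thesis
      by (intro exI[of _ n]) auto
  qed
  \<comment> \<open>The pairs are (block value, block start). The first block starts at 0 with value
    1, which gives \<open>\<eta> 0 = 1\<close> and lets \<open>\<Phi>_le\<close> settle the
    domination there.\<close>
  define P where "P k z \<longleftrightarrow> 0 < fst z \<and> (k = 0 \<longrightarrow> z = (1 :: real, 0 :: nat))" for k :: nat and z
  \<comment> \<open>At stage k both the constant and the dilation are \<open>Suc k\<close>; every
    pair of a constant and a dilation is eventually exceeded by these. The halving forces the block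
    values to 0.\<close>
  define Q where "Q k z z' \<longleftrightarrow> snd z < snd z' \<and> fst z' \<le> fst z / 2 \<and> fst z' = \<Psi> (fst z * real (snd z')) \<and>
      (\<exists>n. n div Suc k = snd z' \<and> \<xi> n > real (Suc k) * fst z')" for k :: nat and z z' :: "real \<times> nat"
  have "\<exists>f. \<forall>k. P k (f k) \<and> Q k (f k) (f (Suc k))"
  proof (rule dependent_nat_choice)
    show "\<exists>z. P 0 z"
      by (simp add: P_def)
    fix z k
    assume "P k z"
    then have pos: "fst z > 0"
      by (simp add: P_def)
    from step[OF this, of "Suc k" "snd z"] obtain n
      where n: "snd z < n div Suc k" "\<Psi> (fst z * real (n div Suc k)) \<le> fst z / 2"
        "\<xi> n > real (Suc k) * \<Psi> (fst z * real (n div Suc k))"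
      by blast
    have "\<Psi> (fst z * real (n div Suc k)) > 0"
      using pos n(1) by (intro \<Psi>_pos mult_pos_pos) (auto simp del: of_nat_Suc)
    with n show "\<exists>z'. P (Suc k) z' \<and> Q k z z'"
      by (intro exI[of _ "(\<Psi> (fst z * real (n div Suc k)), n div Suc k)"]) (auto simp: P_def Q_def simp del: of_nat_Suc)
  qed
  then obtain f where PQ: "\<And>k. P k (f k)" "\<And>k. Q k (f k) (f (Suc k))"
    by blast
  define \<epsilon> where "\<epsilon> k = fst (f k)" for k
  define N where "N k = snd (f k)" for k
  have \<epsilon>_pos: "\<epsilon> k > 0" for k
    using PQ(1)[of k] by (simp add: P_def \<epsilon>_def)
  have 0: "\<epsilon> 0 = 1" "N 0 = 0"
    using PQ(1)[of 0] by (simp_all add: P_def \<epsilon>_def N_def)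
  have N_less: "N k < N (Suc k)" and \<epsilon>_half: "\<epsilon> (Suc k) \<le> \<epsilon> k / 2"
    and \<epsilon>_Suc: "\<epsilon> (Suc k) = \<Psi> (\<epsilon> k * real (N (Suc k)))"
    and ex: "\<exists>n. n div Suc k = N (Suc k) \<and> \<xi> n > real (Suc k) * \<epsilon> (Suc k)" for k
    using PQ(2)[of k] unfolding Q_def \<epsilon>_def N_def by blast+
  have N_mono: "strict_mono N"
    by (simp add: strict_mono_Suc_iff N_less)
  have \<epsilon>_dec: "\<epsilon> (Suc k) \<le> \<epsilon> k" for k
    using \<epsilon>_half[of k] \<epsilon>_pos[of k] by linarith
  have \<epsilon>_anti: "\<epsilon> j \<le> \<epsilon> i" if "i \<le> j" for i j
    by (rule lift_Suc_antimono_le[of \<epsilon>, OF \<epsilon>_dec that])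
  have "\<epsilon> k \<le> (1 / 2) ^ k" for k
  proof (induction k)
    case (Suc k)
    then show ?case
      using \<epsilon>_half[of k] by simp
  qed (simp add: 0)
  then have \<epsilon>_lim: "\<epsilon> \<longlonglongrightarrow> 0"
    by (intro tendsto_sandwich[OF _ _ tendsto_const LIMSEQ_realpow_zero[of "1 / 2"]] always_eventually)
      (auto intro: less_imp_le[OF \<epsilon>_pos])
  \<comment> \<open>The number of the block that contains j.\<close>
  define B where "B j = (LEAST k. j < N (Suc k))" for j
  have B_less: "j < N (Suc (B j))" for j
    unfolding B_def
  proof (rule LeastI)
    show "j < N (Suc j)"
      using strict_mono_imp_increasing[OF N_mono, of "Suc j"] by simp
  qed
  have B_le: "B j \<le> k" if "j < N (Suc k)" for j k
    unfolding B_def using that by (rule Least_le)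
  have B_ge: "N (B j) \<le> j" for j
  proof (cases "B j")
    case (Suc i)
    then show ?thesis
      using B_le[of j i] by force
  qed (simp add: 0)
  have B_mono: "B i \<le> B j" if "i \<le> j" for i j
    using B_less[of j] that by (intro B_le) simp
  have B_N: "B (N k) = k" for k
  proof (rule order_antisym)
    show "B (N k) \<le> k"
      by (rule B_le[OF N_less])
    have "N k < N (Suc (B (N k)))"
      by (rule B_less)
    then show "k \<le> B (N k)"
      using strict_mono_less[OF N_mono] by simp
  qed
  define \<eta> where "\<eta> j = \<epsilon> (B j)" for j
  have "filterlim B at_top sequentially"
    unfolding filterlim_at_top
  proof
    fix Z
    show "\<forall>\<^sub>F n in sequentially. Z \<le> B n"
      using B_mono[of "N Z"] B_N[of Z] by (intro eventually_sequentiallyI[of "N Z"]) simp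
  qed
  from filterlim_compose[OF \<epsilon>_lim this] have \<eta>: "\<eta> \<in> c0_star"
    unfolding \<eta>_def
    by (intro c0_starI) (auto intro: less_imp_le[OF \<epsilon>_pos] intro!: \<epsilon>_anti B_mono)
  have sum_ge: "\<epsilon> k * real n \<le> (\<Sum>j<n. \<eta> j)" if "n \<le> N (Suc k)" for k n
  proof -
    have "(\<Sum>j<n. \<epsilon> k) \<le> (\<Sum>j<n. \<eta> j)"
      using that by (intro sum_mono) (auto simp: \<eta>_def intro!: \<epsilon>_anti B_le)
    then show ?thesis
      by (simp add: mult.commute)
  qed
  have "\<Phi> n \<le> (\<Sum>j<n. \<eta> j)" for n
  proof (cases "B n")
    case 0
    then show ?thesis
      using sum_ge[of n 0] B_less[of n] \<Phi>_le[of n] \<open>\<epsilon> 0 = 1\<close> by simp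
  next
    case (Suc i)
    have 1: "\<epsilon> (Suc i) * real n \<le> (\<Sum>j<n. \<eta> j)"
      using sum_ge[of n "Suc i"] B_less[of n] Suc by simp
    have "\<epsilon> i * real (N (Suc i)) \<le> (\<Sum>j<N (Suc i). \<eta> j)"
      by (rule sum_ge) simp
    also have "\<dots> \<le> (\<Sum>j<n. \<eta> j)"
      using B_ge[of n] Suc c0_starD(1)[OF \<eta>] by (intro sum_mono2) auto
    finally have 2: "\<epsilon> i * real (N (Suc i)) \<le> (\<Sum>j<n. \<eta> j)" .
    have "\<epsilon> i * real (N (Suc i)) > 0"
      using \<epsilon>_pos[of i] N_less[of i] by simp
    from \<Phi>[OF this, of n] show ?thesis
      using 1 2 unfolding \<epsilon>_Suc[of i] by simp
  qed
  moreover have "\<xi> \<notin> principal_set \<eta>"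
  proof
    assume \<xi>\<eta>: "\<xi> \<in> principal_set \<eta>"
    obtain C m where C: "C \<ge> 0" "m > 0" "\<forall>n. \<xi> n \<le> C * \<eta> (n div m)"
      using principal_setD[OF \<eta> \<xi>\<eta>] principal_set_c0[OF \<xi>\<eta>] by blast
    obtain k' :: nat where k': "C \<le> real k'"
      using real_arch_simple by blast
    \<comment> \<open>A stage beyond both the constant and the dilation that are supposed to bound
      \<xi>.\<close>
    define k where "k = max k' m"
    have k: "C \<le> real (Suc k)" "m \<le> Suc k"
      using k' by (auto simp: k_def)
    obtain n where n: "n div Suc k = N (Suc k)" "\<xi> n > real (Suc k) * \<epsilon> (Suc k)"
      using ex by blast
    have "n div Suc k \<le> n div m"
      using k C by (intro div_le_mono2) auto
    then have "\<eta> (n div m) \<le> \<eta> (N (Suc k))"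
      using c0_starD(2)[OF \<eta>] n(1) by simp
    also have "\<dots> = \<epsilon> (Suc k)"
      by (simp add: \<eta>_def B_N)
    finally have "C * \<eta> (n div m) \<le> real (Suc k) * \<epsilon> (Suc k)"
      using k(1) C c0_starD(1)[OF \<eta>] by (intro mult_mono) auto
    with n(2) C(3)[rule_format, of n] show False
      by linarith
  qed
  moreover have "\<eta> 0 = 1"
    using B_N[of 0] by (simp add: \<eta>_def 0)
  ultimately show ?thesis
    using \<eta> by blast
qed

text \<open>The last hypothesis says that the first m terms account for at most half of g. The other
  half must come from terms bounded by \<open>\<eta> m\<close>, which explains the factor 2.\<close>

lemma value_ge_of_sum_ge:
  assumes \<eta>: "\<eta> \<in> c0_star" and "C > 0" and "g \<le> C * (\<Sum>j<n. \<eta> j)" and "2 * C * (real m * \<eta> 0) \<le> g"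
  shows "g \<le> 2 * C * real n * \<eta> m"
proof -
  have "g \<le> C * (real m * \<eta> 0 + real n * \<eta> m)"
    using assms(2) by (intro order_trans[OF assms(3)] mult_left_mono sum_le_split \<eta>) simp
  with assms(4) show ?thesis
    by (simp add: algebra_simps)
qed

definition om :: "real \<Rightarrow> nat \<Rightarrow> real" where
  "om p k = real (Suc k) powr (- p)"

lemma omega_powr: "(\<lambda>k. omega k powr p) = om p"
  by (rule ext) (simp add: omega_def om_def powr_minus_divide powr_divide add.commute)

lemma om_pos: "om p k > 0"
  by (simp add: om_def)

lemma om_c0:
  assumes "p > 0"
  shows "om p \<in> c0_star"
proof (rule c0_starI)
  show "om p \<longlonglongrightarrow> 0"
    unfolding om_def using assms by real_asymp
qed (use assms in \<open>auto simp: om_def intro!: powr_mono2'\<close>)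

text \<open>The comparison with an integral in telescoping form: (1 - p)(n + 1)^(-p) \<le> (n +
  1)^(1-p) - n^(1-p). After division by (n + 1)^(1-p) this is the weighted mean inequality for n/(n
  + 1) and 1 with weights 1 - p and p.\<close>

lemma sum_om_le:
  assumes "0 < p" "p < 1"
  shows "(\<Sum>j<n. om p j) \<le> real n powr (1 - p) / (1 - p)"
proof (induction n)
  case (Suc n)
  have "real n powr (1 - p) + (1 - p) * real (Suc n) powr (- p) \<le> real (Suc n) powr (1 - p)"
  proof (cases "n = 0")
    case False
    have "(real n / real (Suc n)) powr (1 - p) * 1 powr p \<le> (1 - p) * (real n / real (Suc n)) + p * 1"
      using assms False by (intro Youngs_inequality_0) auto
    also have "\<dots> = 1 - (1 - p) / real (Suc n)"
      by (simp add: field_simps)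
    finally have "real n powr (1 - p) \<le> (1 - (1 - p) / real (Suc n)) * real (Suc n) powr (1 - p)"
      by (simp add: powr_divide divide_le_eq mult.commute del: of_nat_Suc)
    also have "\<dots> = real (Suc n) powr (1 - p) - (1 - p) * (real (Suc n) powr (1 - p) / real (Suc n))"
      by (simp add: left_diff_distrib)
    also have "real (Suc n) powr (1 - p) / real (Suc n) = real (Suc n) powr (- p)"
      using powr_diff[of "real (Suc n)" "1 - p" 1] by simp
    finally show ?thesis
      by simp
  qed (use assms in simp)
  then have "om p n \<le> (real (Suc n) powr (1 - p) - real n powr (1 - p)) / (1 - p)"
    using assms by (simp add: om_def field_simps)
  with Suc show ?case
    by (simp add: diff_divide_distrib)
qed simp

lemma sum_om_1: "(\<Sum>j<n. om 1 j) = harm n"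
  by (simp add: harm_altdef om_def powr_minus)

lemma ln_le_sum_om_1: "ln (real n + 1) \<le> (\<Sum>j<n. om 1 j)"
  by (simp add: sum_om_1 ln_le_harm)

lemma sum_om_1_le: "(\<Sum>j<Suc n. om 1 j) \<le> 1 + ln (real (Suc n))"
  unfolding sum_om_1 using decseq_harm_diff_ln decseqD[of _ 0 n] by (fastforce simp: harm_expand)

section \<open>The three ranges of the exponent\<close>

text \<open>All its nonempty partial sums are 1, so its arithmetic mean is the harmonic sequence,
  the smallest order that the mean of a nonzero sequence can have.\<close>

definition unit_seq :: "nat \<Rightarrow> real" where
  "unit_seq n = (if n = 0 then 1 else 0)"

lemma unit_seq_fin: "unit_seq \<in> fin_seqs"
proof -
  have "unit_seq \<longlonglongrightarrow> 0"
    by (rule tendsto_eventually) (auto simp: unit_seq_def eventually_sequentially intro!: exI[of _ 1])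
  then have "unit_seq \<in> c0_star"
    by (intro c0_starI) (auto simp: unit_seq_def)
  then show ?thesis
    unfolding fin_seqs_def by (auto simp: unit_seq_def intro!: exI[of _ 1])
qed

lemma sum_unit_seq: "(\<Sum>j<Suc n. unit_seq j) = 1"
  by (simp add: unit_seq_def sum.If_cases lessThan_Suc_atMost del: sum.lessThan_Suc sum.atMost_Suc)

lemma am_set_om_subset_fin:
  assumes "p > 1"
  shows "am_set (principal_set (om p)) \<subseteq> am_set fin_seqs"
proof (rule am_set_principal_subset[OF om_c0 unit_seq_fin])
  fix n
  have "summable (\<lambda>n. real n powr (- p))"
    using assms by (simp add: summable_real_powr_iff)
  then have "summable (om p)"
    unfolding om_def by (subst summable_Suc_iff)
  then have "(\<Sum>j<Suc n. om p j) \<le> suminf (om p)"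
    by (rule sum_le_suminf) (auto intro: less_imp_le[OF om_pos])
  then show "arith_mean (om p) n \<le> suminf (om p) * arith_mean unit_seq n"
    unfolding arith_mean_le_iff sum_unit_seq by simp
qed (use assms in simp)

text \<open>The domination in terms of partial sums. It is applied with \<xi> equal to \<pi> itself,
  or to the mean of \<pi> when the exponent is 1. Enlarging the constant to at least 1 keeps later
  divisions by it safe.\<close>

lemma am_set_om_element:
  assumes R: "charset R" and sub: "am_set (principal_set \<pi>) \<subseteq> am_set R"
    and \<pi>: "\<pi> \<in> c0_star" and \<xi>: "\<xi> \<in> c0_star" and le: "\<And>n. \<xi> n \<le> arith_mean \<pi> n"
  shows "\<exists>\<eta>\<in>R. \<exists>C\<ge>1. \<forall>n. \<xi> n * real (Suc n) \<le> C * (\<Sum>j<Suc n. \<eta> j)"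
proof -
  have "\<xi> \<in> am_set (principal_set \<pi>)"
    by (rule am_setI[OF \<xi> self_in_principal_set[OF \<pi>], of 1]) (simp add: le)
  then have \<xi>R: "\<xi> \<in> am_set R"
    using sub by blast
  obtain \<eta> C where \<eta>: "\<eta> \<in> R" "C \<ge> 0" "\<And>n. \<xi> n \<le> C * arith_mean \<eta> n"
    using am_setD[OF R \<xi>R] by blast
  have "\<xi> n * real (Suc n) \<le> (C + 1) * (\<Sum>j<Suc n. \<eta> j)" for n
  proof -
    have "\<xi> n \<le> (C + 1) * arith_mean \<eta> n"
      using \<eta>(3)[of n] arith_mean_nonneg[OF charset_c0[OF R \<eta>(1)], of n] by (simp add: distrib_right)
    then show ?thesis
      unfolding arith_mean_def lessThan_Suc_atMost[symmetric]
      by (simp add: field_simps del: sum.lessThan_Suc)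
  qed
  with \<eta>(1,2) show ?thesis
    by (intro bexI[of _ \<eta>] exI[of _ "C + 1"]) auto
qed

text \<open>The set \<open>R\<close> contains a sequence with nonzero first term, and a dilation
  repeats this term as often as desired.\<close>

lemma fin_subset_of_am:
  assumes R: "charset R" and sub: "am_set (principal_set (om p)) \<subseteq> am_set R" and "p > 0"
  shows "fin_seqs \<subseteq> R"
proof
  fix \<xi>
  assume "\<xi> \<in> fin_seqs"
  then obtain N where \<xi>: "\<xi> \<in> c0_star" and N: "\<And>n. n \<ge> N \<Longrightarrow> \<xi> n = 0"
    by (auto simp: fin_seqs_def)
  note om = om_c0[OF \<open>p > 0\<close>]
  obtain \<eta> C where \<eta>: "\<eta> \<in> R" and le: "\<And>n. om p n * real (Suc n) \<le> C * (\<Sum>j<Suc n. \<eta> j)"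
    using am_set_om_element[OF R sub om om le_arith_mean[OF om]] by blast
  have "\<eta> 0 \<noteq> 0"
    using le[of 0] by (auto simp: om_def)
  then have pos: "\<eta> 0 > 0"
    using c0_starD(1)[OF charset_c0[OF R \<eta>], of 0] by simp
  \<comment> \<open>\<open>Suc N\<close> rather than \<open>N\<close> keeps the dilation positive
    when \<open>N = 0\<close>.\<close>
  show "\<xi> \<in> R"
  proof (rule charset_scale[OF R charset_div[OF R \<eta>, of "Suc N"] \<xi>])
    show "\<xi> n \<le> (\<xi> 0 / \<eta> 0) * \<eta> (n div Suc N)" for n
    proof (cases "n < N")
      case True
      then show ?thesis
        using pos c0_starD(2)[OF \<xi>, of 0 n] by simp
    next
      case False
      have "0 \<le> (\<xi> 0 / \<eta> 0) * \<eta> (n div Suc N)"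
        using pos c0_starD(1)[OF \<xi>] c0_starD(1)[OF charset_c0[OF R \<eta>]] by simp
      with False N[of n] show ?thesis
        by simp
    qed
  qed simp
qed

lemma not_am_stable_fin: "\<not> am_set fin_seqs \<subseteq> fin_seqs"
proof
  assume "am_set fin_seqs \<subseteq> fin_seqs"
  moreover have "om 1 \<in> am_set fin_seqs"
  proof (rule am_setI[OF om_c0 unit_seq_fin])
    show "om 1 n \<le> 1 * arith_mean unit_seq n" for n
      using sum_unit_seq[of n]
      by (simp add: arith_mean_def om_def powr_minus lessThan_Suc_atMost divide_inverse
          del: sum.lessThan_Suc sum.atMost_Suc)
  qed simp
  ultimately have "om 1 \<in> fin_seqs"
    by blast
  then obtain N where "\<forall>n\<ge>N. om 1 n = 0"
    by (auto simp: fin_seqs_def)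
  then show False
    using om_pos[of 1 N] by simp
qed

section \<open>Exponents below 1\<close>

lemma principal_om_subset_of_am:
  assumes R: "charset R" and sub: "am_set (principal_set (om p)) \<subseteq> am_set R" and p: "0 < p" "p < 1"
  shows "principal_set (om (p / (1 - p))) \<subseteq> R"
proof -
  let ?q = "p / (1 - p)"
  note om = om_c0[OF p(1)]
  obtain \<eta> C where \<eta>: "\<eta> \<in> R" and C: "C \<ge> 1" and le: "\<And>n. om p n * real (Suc n) \<le> C * (\<Sum>j<Suc n. \<eta> j)"
    using am_set_om_element[OF R sub om om le_arith_mean[OF om]] by blast
  note \<eta>c = charset_c0[OF R \<eta>]
  have \<eta>0: "\<eta> 0 \<ge> 0"
    by (rule c0_starD(1)[OF \<eta>c])
  \<comment> \<open>\<open>A * real (Suc m)\<close> is at least twice the weighted contribution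
    \<open>C * (real m * \<eta> 0)\<close> of the first m terms. Adding 1 to \<open>\<eta> 0\<close>
    ensures A \<ge> 1.\<close>
  define A where "A = 2 * C * (\<eta> 0 + 1)"
  have "2 * C * (\<eta> 0 + 1) \<ge> 1 * 1"
    using C \<eta>0 by (intro mult_mono) auto
  then have A: "A \<ge> 1"
    by (simp add: A_def)
  define c where "c = A powr (- ?q) * 2 powr (- p) / (2 * C)"
  have c: "c > 0"
    using A C by (simp add: c_def)
  have main: "c * om ?q m \<le> \<eta> m" for m
  proof -
    define x where "x = A * real (Suc m)"
    have x: "x \<ge> 1"
      using mult_mono[of 1 A 1 "real (Suc m)"] A by (simp add: x_def)
    \<comment> \<open>The solution of y^(1-p) = x, that is, the length at which the lower bound for
      the partial sum reaches x. Rounding it up at most doubles it since y \<ge> 1, which produces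
      the factor 2^(-p) in \<open>c\<close>.\<close>
    define y where "y = x powr (1 / (1 - p))"
    have y1: "y \<ge> 1"
      using x p by (simp add: y_def ge_one_powr_ge_zero)
    obtain n where n: "y \<le> real (Suc n)" "real (Suc n) \<le> 2 * y"
    proof -
      have c: "\<lceil>y\<rceil> \<ge> 1"
        using y1 by linarith
      then have "nat \<lceil>y\<rceil> = Suc (nat (\<lceil>y\<rceil> - 1))"
        by linarith
      then have "real (Suc (nat (\<lceil>y\<rceil> - 1))) = of_int \<lceil>y\<rceil>"
        using c by linarith
      then show ?thesis
        using that[of "nat (\<lceil>y\<rceil> - 1)"] y1 ceiling_correct[of y] by linarith
    qed
    have pow: "om p n * real (Suc n) = real (Suc n) powr (1 - p)"
      using powr_add[of "real (Suc n)" "- p" 1] by (simp add: om_def)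
    have "x = y powr (1 - p)"
      using x p by (simp add: y_def powr_powr)
    also have "\<dots> \<le> real (Suc n) powr (1 - p)"
      using n(1) y1 p by (intro powr_mono2) auto
    finally have x_le: "x \<le> om p n * real (Suc n)"
      unfolding pow .
    have "2 * C * (real m * \<eta> 0) \<le> 2 * C * ((\<eta> 0 + 1) * real (Suc m))"
      using C \<eta>0 by (intro mult_left_mono) (auto simp: algebra_simps)
    also have "\<dots> = x"
      by (simp add: x_def A_def)
    finally have "om p n * real (Suc n) \<le> 2 * C * real (Suc n) * \<eta> m"
      using x_le C by (intro value_ge_of_sum_ge[OF \<eta>c _ le]) auto
    then have "om p n * real (Suc n) \<le> (2 * C * \<eta> m) * real (Suc n)"
      by (simp add: mult_ac)
    then have "om p n \<le> 2 * C * \<eta> m"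
      by (rule mult_right_le_imp_le) simp
    moreover have "(2 * y) powr (- p) \<le> om p n"
      unfolding om_def using n p by (intro powr_mono2') auto
    moreover have "(2 * y) powr (- p) = 2 * C * (c * om ?q m)"
    proof -
      have "y powr (- p) = x powr (- ?q)"
        using x p by (simp add: y_def powr_powr)
      also have "\<dots> = A powr (- ?q) * om ?q m"
        using A by (simp add: x_def powr_mult om_def)
      finally show ?thesis
        using y1 C by (simp add: powr_mult c_def)
    qed
    ultimately have "2 * C * (c * om ?q m) \<le> 2 * C * \<eta> m"
      by linarith
    then show ?thesis
      using C by simp
  qed
  have "om ?q \<in> R"
  proof (rule charset_scale[OF R \<eta> om_c0])
    show "om ?q n \<le> (1 / c) * \<eta> n" for n
      using main[of n] c by (simp add: field_simps)
  qed (use p in simp)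
  then show ?thesis
    by (rule principal_set_least[OF R])
qed

text \<open>The slope \<open>\<Psi>\<close> is dictated by n^(-p) = (n^(1-p))^(-q): as soon as
  n^(1-p) exceeds y, the line with slope y^(-q) lies above n^(1-p).\<close>

lemma ex_charset_avoiding_lt_1:
  assumes p: "0 < p" "p < 1" and \<xi>: "\<xi> \<in> c0_star" and not: "\<xi> \<notin> principal_set (om (p / (1 - p)))"
  shows "\<exists>R. charset R \<and> am_set (principal_set (om p)) \<subseteq> am_set R \<and> \<xi> \<notin> R"
proof -
  define q where "q = p / (1 - p)"
  have q: "q > 0" "(1 - p) * q = p"
    using p by (simp_all add: q_def)
  have "\<exists>\<eta>\<in>c0_star. \<eta> 0 = 1 \<and> (\<forall>n. real n powr (1 - p) \<le> (\<Sum>j<n. \<eta> j)) \<and> \<xi> \<notin> principal_set \<eta>"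
  proof (rule lacunary_sequence[where \<Psi> = "\<lambda>y. y powr (- q)"])
    show "((\<lambda>y. y powr (- q)) \<longlongrightarrow> 0) at_top"
      using q by real_asymp
    show "real n powr (1 - p) \<le> max y (y powr (- q) * real n)" if "y > 0" for y n
    proof (cases "real n powr (1 - p) \<le> y")
      case False
      then have n: "n > 0"
        using that by (cases "n = 0") auto
      have "real n powr (1 - p) = real n powr (- p) * real n"
        using n powr_add[of "real n" "- p" 1] by simp
      also have "real n powr (- p) = (real n powr (1 - p)) powr (- q)"
        using q by (simp add: powr_powr)
      also have "\<dots> \<le> y powr (- q)"
        using that False q by (intro powr_mono2') auto
      finally show ?thesis
        by (simp add: mult_right_mono)
    qed simp
    show "real n powr (1 - p) \<le> real n" for n
    proof (cases "n = 0")
      case False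
      then show ?thesis
        using powr_mono[of "1 - p" 1 "real n"] p by simp
    qed simp
    fix \<epsilon> :: real and k N :: nat
    assume \<epsilon>: "\<epsilon> > 0" and k: "k > 0"
    \<comment> \<open>For n \<ge> k one has n + 1 \<le> 2 k (n div k), so replacing \<epsilon> (n
      div k) by \<epsilon> (n + 1)/(2 k) costs exactly this constant.\<close>
    define K where "K = real k * (\<epsilon> / (2 * real k)) powr (- q)"
    obtain n where n: "n \<ge> max N k" "\<xi> n > K * om q (n div 1)"
      using not_principal_ex[OF \<xi> not[folded q_def] om_pos, of 1 "max N k" K] by auto
    have "Suc n \<le> 2 * k * (n div k)"
    proof -
      have "n div k \<ge> 1"
        using n(1) k by (simp add: Suc_le_eq div_greater_zero_iff)
      then have "k \<le> k * (n div k)"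
        by simp
      moreover have "n mod k < k"
        using k by simp
      ultimately show ?thesis
        using mult_div_mod_eq[of k n] by linarith
    qed
    then have "real (Suc n) \<le> real (2 * k * (n div k))"
      by (rule of_nat_mono)
    then have "(\<epsilon> / (2 * real k)) * real (Suc n) \<le> (\<epsilon> / (2 * real k)) * real (2 * k * (n div k))"
      using \<epsilon> by (intro mult_left_mono) auto
    also have "\<dots> = \<epsilon> * real (n div k)"
      using k by simp
    finally have "(\<epsilon> * real (n div k)) powr (- q) \<le> ((\<epsilon> / (2 * real k)) * real (Suc n)) powr (- q)"
      using q \<epsilon> k by (intro powr_mono2') (auto simp del: of_nat_Suc)
    also have "\<dots> = (\<epsilon> / (2 * real k)) powr (- q) * om q n"
      using \<epsilon> by (subst powr_mult) (auto simp: om_def)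
    finally have "real k * (\<epsilon> * real (n div k)) powr (- q) \<le> K * om q n"
      unfolding K_def mult.assoc by (intro mult_left_mono) auto
    with n show "\<exists>n\<ge>N. \<xi> n > real k * (\<epsilon> * real (n div k)) powr (- q)"
      by (intro exI[of _ n]) auto
  qed simp
  then obtain \<eta> where \<eta>: "\<eta> \<in> c0_star" "\<And>n. real n powr (1 - p) \<le> (\<Sum>j<n. \<eta> j)" "\<xi> \<notin> principal_set \<eta>"
    by blast
  have "am_set (principal_set (om p)) \<subseteq> am_set (principal_set \<eta>)"
  proof (rule am_set_principal_subset[OF om_c0[OF p(1)] self_in_principal_set[OF \<eta>(1)]])
    fix n
    have "(\<Sum>j<Suc n. om p j) \<le> real (Suc n) powr (1 - p) / (1 - p)"
      by (rule sum_om_le[OF p])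
    also have "\<dots> \<le> (\<Sum>j<Suc n. \<eta> j) / (1 - p)"
      using p by (intro divide_right_mono \<eta>) simp
    finally show "arith_mean (om p) n \<le> (1 / (1 - p)) * arith_mean \<eta> n"
      unfolding arith_mean_le_iff by simp
  qed
  with \<eta> charset_principal_set show ?thesis
    by blast
qed

section \<open>The exponent 1\<close>

text \<open>Up to constants and dilations this is e^(-n): the estimates below place it between
  e^(-n-1) and 2 e^(-n/2), with n the shifted index.\<close>

definition exp_seq :: "nat \<Rightarrow> real" where
  "exp_seq k = real (k + 1) / exp (real (k + 1))"

lemma exp_seq_c0: "exp_seq \<in> c0_star"
proof (rule c0_starI)
  show "0 \<le> exp_seq n" for n
    by (simp add: exp_seq_def)
  show "exp_seq \<longlonglongrightarrow> 0"
    unfolding exp_seq_def by real_asymp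
  show "exp_seq (Suc n) \<le> exp_seq n" for n
  proof -
    have "real n + 2 \<le> (real n + 1) * exp 1"
    proof -
      have "real n + 2 \<le> (real n + 1) * 2"
        by simp
      also have "\<dots> \<le> (real n + 1) * exp 1"
        using exp_ge_add_one_self[of 1] by (intro mult_left_mono) auto
      finally show ?thesis .
    qed
    then have "(real n + 2) / exp (real n + 1 + 1) \<le> (real n + 1) * exp 1 / exp (real n + 1 + 1)"
      by (intro divide_right_mono) auto
    also have "\<dots> = (real n + 1) / exp (real n + 1)"
      unfolding exp_add[of "real n + 1" 1] by simp
    finally show ?thesis
      by (simp add: exp_seq_def add_ac)
  qed
qed

lemma exp_seq_le: "exp_seq n \<le> 2 * exp (- real n / 2)"
proof -
  have "x \<le> 2 * exp (x / 2)" for x :: real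
    using exp_ge_add_one_self[of "x / 2"] by linarith
  then have "exp_seq n \<le> 2 * exp (real (n + 1) / 2) / exp (real (n + 1))"
    unfolding exp_seq_def by (rule divide_right_mono) simp
  also have "\<dots> = 2 * exp (- real (n + 1) / 2)"
  proof -
    have "exp (x / 2) / exp x = exp (- x / 2)" for x :: real
      unfolding exp_diff[symmetric] by (rule arg_cong[of _ _ exp]) simp
    then show ?thesis
      by (simp only: times_divide_eq_right[symmetric])
  qed
  also have "\<dots> \<le> 2 * exp (- real n / 2)"
    by simp
  finally show ?thesis .
qed

lemma exp_seq_ge: "exp (- real (n + 1)) \<le> exp_seq n"
proof -
  have "1 / exp (real (n + 1)) \<le> real (n + 1) / exp (real (n + 1))"
    by (intro divide_right_mono) auto
  then show ?thesis
    by (simp only: exp_seq_def exp_minus inverse_eq_divide)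
qed

text \<open>Here n is of order e^x with x = A (m + 1), so that the logarithm reaches twice the
  contribution of the first m terms. The resulting rate A depends on \<eta> and is removed by a
  dilation at the end.\<close>

lemma principal_exp_subset_of_am:
  assumes R: "charset R" and sub: "am_set (principal_set (om 1)) \<subseteq> am_set R"
  shows "principal_set exp_seq \<subseteq> R"
proof -
  have om: "om 1 \<in> c0_star"
    by (rule om_c0) simp
  obtain \<eta> C where \<eta>: "\<eta> \<in> R" and C: "C \<ge> 1"
    and le: "\<And>n. arith_mean (om 1) n * real (Suc n) \<le> C * (\<Sum>j<Suc n. \<eta> j)"
    using am_set_om_element[OF R sub om c0_star_arith_mean[OF om] order_refl] by blast
  note \<eta>c = charset_c0[OF R \<eta>]
  have \<eta>0: "\<eta> 0 \<ge> 0"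
    by (rule c0_starD(1)[OF \<eta>c])
  have le_ln: "ln (real (Suc n)) \<le> C * (\<Sum>j<Suc n. \<eta> j)" for n
  proof -
    have "ln (real (Suc n)) \<le> ln (real (Suc n) + 1)"
      by simp
    also have "\<dots> \<le> (\<Sum>j<Suc n. om 1 j)"
      by (rule ln_le_sum_om_1)
    also have "\<dots> = arith_mean (om 1) n * real (Suc n)"
      by (simp add: arith_mean_def lessThan_Suc_atMost del: sum.lessThan_Suc sum.atMost_Suc)
    finally show ?thesis
      using le[of n] by linarith
  qed
  define A where "A = 2 * C * (\<eta> 0 + 1)"
  have A: "A > 0"
    using C \<eta>0 by (simp add: A_def)
  have main: "exp (- A * real (Suc m)) / 2 \<le> \<eta> m" for m
  proof -
    define x where "x = A * real (Suc m)"
    \<comment> \<open>The bound x \<ge> 2 C lets the logarithm on the left cancel against 2 C below,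
      leaving a pure exponential bound for \<open>\<eta> m\<close>.\<close>
    have "2 * C * 1 \<le> 2 * C * ((\<eta> 0 + 1) * real (Suc m))"
      using C \<eta>0 mult_mono[of 1 "\<eta> 0 + 1" 1 "real (Suc m)"] by (intro mult_left_mono) auto
    then have x: "2 * C \<le> x"
      by (simp add: x_def A_def mult.assoc)
    have y1: "exp x \<ge> 1"
      using x C by simp
    obtain n where n: "exp x \<le> real (Suc n)" "real (Suc n) \<le> 2 * exp x"
    proof -
      have c: "\<lceil>exp x\<rceil> \<ge> 1"
        using y1 by linarith
      then have "nat \<lceil>exp x\<rceil> = Suc (nat (\<lceil>exp x\<rceil> - 1))"
        by linarith
      then have "real (Suc (nat (\<lceil>exp x\<rceil> - 1))) = of_int \<lceil>exp x\<rceil>"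
        using c by linarith
      then show ?thesis
        using that[of "nat (\<lceil>exp x\<rceil> - 1)"] y1 ceiling_correct[of "exp x"] by linarith
    qed
    have "x = ln (exp x)"
      by simp
    also have "\<dots> \<le> ln (real (Suc n))"
      using n(1) by (subst ln_le_cancel_iff) auto
    finally have x_le: "x \<le> ln (real (Suc n))" .
    have "2 * C * (real m * \<eta> 0) \<le> 2 * C * ((\<eta> 0 + 1) * real (Suc m))"
      using C \<eta>0 by (intro mult_left_mono) (auto simp: algebra_simps)
    also have "\<dots> = x"
      by (simp add: x_def A_def)
    finally have "ln (real (Suc n)) \<le> 2 * C * real (Suc n) * \<eta> m"
      using x_le C by (intro value_ge_of_sum_ge[OF \<eta>c _ le_ln]) auto
    then have "2 * C * 1 \<le> 2 * C * (real (Suc n) * \<eta> m)"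
      using x x_le by (simp only: mult.assoc)
    then have "1 \<le> real (Suc n) * \<eta> m"
      using C mult_le_cancel_left_pos[of "2 * C" 1 "real (Suc n) * \<eta> m"] by simp
    also have "\<dots> \<le> (2 * exp x) * \<eta> m"
      using n(2) c0_starD(1)[OF \<eta>c] by (rule mult_right_mono)
    finally have "1 / (2 * exp x) \<le> \<eta> m"
      by (simp add: pos_divide_le_eq mult.commute)
    then have "exp (- x) / 2 \<le> \<eta> m"
      by (simp add: exp_minus inverse_eq_divide mult.commute)
    then show ?thesis
      by (simp only: x_def mult_minus_left)
  qed
  \<comment> \<open>Dilating by k divides the rate A by k, bringing it down to at most the 1/2 of
    \<open>exp_seq_le\<close>.\<close>
  obtain k :: nat where k: "2 * A \<le> real k"
    using real_arch_simple by blast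
  then have k0: "k > 0"
    using A by (cases "k = 0") auto
  have "exp_seq \<in> R"
  proof (rule charset_scale[OF R charset_div[OF R \<eta> k0] exp_seq_c0])
    fix n
    have "real k * real (n div k) \<le> real n"
      using of_nat_mono[OF times_div_less_eq_dividend[of k n], where 'a = real] by simp
    moreover have "2 * A * real (n div k) \<le> real k * real (n div k)"
      using k by (rule mult_right_mono) simp
    ultimately have "A * real (Suc (n div k)) \<le> real n / 2 + A"
      by (simp add: algebra_simps)
    then have "exp (- real n / 2) * exp (- A) \<le> exp (- A * real (Suc (n div k)))"
      by (simp add: exp_add[symmetric] del: of_nat_Suc)
    also have "\<dots> \<le> 2 * \<eta> (n div k)"
      using main[of "n div k"] by simp
    finally have "exp A * (exp (- real n / 2) * exp (- A)) \<le> exp A * (2 * \<eta> (n div k))"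
      by (rule mult_left_mono) simp
    moreover have "exp A * (exp (- real n / 2) * exp (- A)) = exp (- real n / 2)"
      by (simp flip: exp_add)
    ultimately have "exp (- real n / 2) \<le> exp A * (2 * \<eta> (n div k))"
      by (simp only:)
    with exp_seq_le[of n] show "exp_seq n \<le> (4 * exp A) * \<eta> (n div k)"
      by simp
  qed
  then show ?thesis
    by (rule principal_set_least[OF R])
qed

text \<open>The slope e^(-y/2) replaces e^(-y), which would give only n e^(-y) \<ge> 1 where ln n >
  y. With the halved rate the line is at least 2 sqrt(n) there, and ln n \<le> 2 sqrt(n). Halving
  the rate is harmless because of dilations.\<close>

lemma ex_charset_avoiding_eq_1:
  assumes \<xi>: "\<xi> \<in> c0_star" and not: "\<xi> \<notin> principal_set exp_seq"
  shows "\<exists>R. charset R \<and> am_set (principal_set (om 1)) \<subseteq> am_set R \<and> \<xi> \<notin> R"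
proof -
  have "\<exists>\<eta>\<in>c0_star. \<eta> 0 = 1 \<and> (\<forall>n. ln (real n) \<le> (\<Sum>j<n. \<eta> j)) \<and> \<xi> \<notin> principal_set \<eta>"
  proof (rule lacunary_sequence[where \<Psi> = "\<lambda>y. 2 * exp (- y / 2)"])
    show "((\<lambda>y::real. 2 * exp (- y / 2)) \<longlongrightarrow> 0) at_top"
      by real_asymp
    show "ln (real n) \<le> max y (2 * exp (- y / 2) * real n)" if "y > 0" for y n
    proof (cases "ln (real n) \<le> y")
      case False
      then have n: "n > 0"
        using that by (cases "n = 0") auto
      have "ln (real n) / 2 \<le> exp (ln (real n) / 2)"
        using exp_ge_add_one_self[of "ln (real n) / 2"] by linarith
      also have "\<dots> = exp (- ln (real n) / 2) * exp (ln (real n))"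
        by (simp add: exp_add[symmetric])
      also have "\<dots> = exp (- ln (real n) / 2) * real n"
        using n by simp
      also have "\<dots> \<le> exp (- y / 2) * real n"
        using False by (intro mult_right_mono) auto
      finally show ?thesis
        by simp
    qed simp
    show "ln (real n) \<le> real n" for n
      using ln_le_minus_one[of "real n"] by (cases "n = 0") auto
    fix \<epsilon> :: real and k N :: nat
    assume \<epsilon>: "\<epsilon> > 0" and k: "k > 0"
    define K where "K = 2 * real k * exp (\<epsilon> / 2 + 1)"
    \<comment> \<open>The dilation that slows \<open>exp_seq\<close> below the rate \<epsilon>/(2 k)
      of the slope. Rounding in the two integer quotients is responsible for \<epsilon>/2 + 1 in the
      exponent of \<open>K\<close>.\<close>
    obtain m :: nat where m: "2 * real k / \<epsilon> \<le> real m"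
      using real_arch_simple by blast
    have "2 * real k / \<epsilon> > 0"
      using \<epsilon> k by simp
    then have m0: "m > 0"
      using m by (cases "m = 0") auto
    have pos: "exp_seq n > 0" for n
      by (simp add: exp_seq_def add_pos_nonneg)
    obtain n where n: "n \<ge> N" "\<xi> n > K * exp_seq (n div m)"
      using not_principal_ex[OF \<xi> not pos m0] by blast
    have "real (n div m) \<le> real n / real m"
      by (rule of_nat_div_le_of_nat)
    also have "\<dots> \<le> real n / (2 * real k / \<epsilon>)"
      using m \<epsilon> k m0 by (intro divide_left_mono) auto
    finally have 1: "real (n div m) \<le> \<epsilon> * real n / (2 * real k)"
      by (simp add: mult.commute)
    have "real n / real k \<le> real (n div k) + 1"
    proof -
      have "n \<le> k * (n div k) + k"
        using mult_div_mod_eq[of k n] mod_less_divisor[OF k, of n] by linarith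
      then have "real n \<le> real (k * (n div k) + k)"
        by (rule of_nat_mono)
      then show ?thesis
        using k by (simp add: pos_divide_le_eq algebra_simps)
    qed
    then have "\<epsilon> / 2 * (real n / real k) \<le> \<epsilon> / 2 * (real (n div k) + 1)"
      using \<epsilon> by (intro mult_left_mono) auto
    then have "- (\<epsilon> * real (n div k)) / 2 \<le> \<epsilon> / 2 + 1 + - real (n div m + 1)"
      using 1 by (simp add: algebra_simps)
    then have "exp (- (\<epsilon> * real (n div k)) / 2) \<le> exp (\<epsilon> / 2 + 1) * exp (- real (n div m + 1))"
      unfolding exp_add[symmetric] exp_le_cancel_iff .
    also have "\<dots> \<le> exp (\<epsilon> / 2 + 1) * exp_seq (n div m)"
      by (intro mult_left_mono exp_seq_ge) simp
    finally have "2 * real k * exp (- (\<epsilon> * real (n div k)) / 2) \<le>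
        2 * real k * (exp (\<epsilon> / 2 + 1) * exp_seq (n div m))"
      by (intro mult_left_mono) auto
    then show "\<exists>n\<ge>N. \<xi> n > real k * (2 * exp (- (\<epsilon> * real (n div k)) / 2))"
      using n by (intro exI[of _ n]) (auto simp: K_def mult_ac)
  qed simp
  then obtain \<eta> where \<eta>: "\<eta> \<in> c0_star" "\<eta> 0 = 1" "\<And>n. ln (real n) \<le> (\<Sum>j<n. \<eta> j)" "\<xi> \<notin> principal_set \<eta>"
    by blast
  have "am_set (principal_set (om 1)) \<subseteq> am_set (principal_set \<eta>)"
  proof (rule am_set_principal_subset[OF om_c0 self_in_principal_set[OF \<eta>(1)]])
    fix n
    \<comment> \<open>The harmonic sums are bounded by 1 plus the logarithm; the constant 1, which
      the logarithm cannot cover for small n, is supplied by \<open>\<eta> 0 = 1\<close>.\<close>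
    have "(\<Sum>j\<in>{0}. \<eta> j) \<le> (\<Sum>j<Suc n. \<eta> j)"
      by (rule sum_mono2) (auto simp: c0_starD(1)[OF \<eta>(1)])
    then have "1 \<le> (\<Sum>j<Suc n. \<eta> j)"
      using \<eta>(2) by simp
    then have "(\<Sum>j<Suc n. om 1 j) \<le> 2 * (\<Sum>j<Suc n. \<eta> j)"
      using sum_om_1_le[of n] \<eta>(3)[of "Suc n"] by linarith
    then show "arith_mean (om 1) n \<le> 2 * arith_mean \<eta> n"
      unfolding arith_mean_le_iff .
  qed simp
  with \<eta> charset_principal_set show ?thesis
    by blast
qed

text \<open>The arithmetic mean of a nonzero ideal contains \<omega>. A bound of \<omega> by a
  dilation of \<open>exp_seq\<close>, read at the multiples of m, would keep a null sequence above
  1.\<close>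

lemma not_am_stable_exp: "\<not> am_set (principal_set exp_seq) \<subseteq> principal_set exp_seq"
proof
  assume sub: "am_set (principal_set exp_seq) \<subseteq> principal_set exp_seq"
  have "om 1 \<in> am_set (principal_set exp_seq)"
  proof (rule am_setI[OF om_c0 self_in_principal_set[OF exp_seq_c0]])
    fix n
    have "exp_seq 0 \<le> (\<Sum>j\<le>n. exp_seq j)"
      using sum_mono2[of "{..n}" "{0}" exp_seq] c0_starD(1)[OF exp_seq_c0] by simp
    then have "1 \<le> exp 1 * (\<Sum>j\<le>n. exp_seq j)"
      by (simp add: exp_seq_def field_simps)
    then have "1 / real (Suc n) \<le> exp 1 * (\<Sum>j\<le>n. exp_seq j) / real (Suc n)"
      by (rule divide_right_mono) simp
    then show "om 1 n \<le> exp 1 * arith_mean exp_seq n"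
      by (simp add: arith_mean_def om_def powr_minus divide_inverse)
  qed simp
  with sub have mem: "om 1 \<in> principal_set exp_seq"
    by blast
  obtain C m where C: "C \<ge> 0" "m > 0" "\<And>n. om 1 n \<le> C * exp_seq (n div m)"
    using principal_setD[OF exp_seq_c0 mem] by blast
  have "1 \<le> C * (real (Suc (j * m)) * exp_seq j)" for j
  proof -
    have "real (Suc (j * m)) * om 1 (j * m) \<le> real (Suc (j * m)) * (C * exp_seq j)"
      using C(3)[of "j * m"] C(2) by (intro mult_left_mono) auto
    moreover have "real (Suc (j * m)) * om 1 (j * m) = 1"
      by (simp add: om_def powr_minus del: of_nat_Suc)
    ultimately show ?thesis
      by (simp only: mult.left_commute)
  qed
  moreover have "(\<lambda>j. C * (real (Suc (j * m)) * exp_seq j)) \<longlonglongrightarrow> 0"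
    unfolding exp_seq_def of_nat_Suc of_nat_mult by real_asymp
  ultimately have "(1::real) \<le> 0"
    by (intro LIMSEQ_le_const) auto
  then show False
    by simp
qed

section \<open>Stability of the powers\<close>

text \<open>Dilating a power sequence only changes the constant, so membership in its principal set
  is an ordinary O-bound. The reason is n + 1 \<le> m (n div m + 1).\<close>

lemma om_div_le:
  assumes "q > 0" "m > 0"
  shows "om q (n div m) \<le> real m powr q * om q n"
proof -
  have "n < m * (n div m) + m"
    using mult_div_mod_eq[of m n] mod_less_divisor[OF assms(2), of n] by linarith
  then have "Suc n \<le> Suc (n div m) * m"
    by (simp add: algebra_simps)
  then have "real (Suc n) \<le> real (Suc (n div m) * m)"
    by (rule of_nat_mono)
  then have "real (Suc n) / real m \<le> real (Suc (n div m))"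
    using assms(2) by (subst pos_divide_le_eq) (simp_all only: of_nat_mult of_nat_0_less_iff)
  then have "om q (n div m) \<le> (real (Suc n) / real m) powr (- q)"
    unfolding om_def using assms by (intro powr_mono2') auto
  also have "\<dots> = real m powr q * om q n"
    by (subst powr_divide) (simp_all add: om_def powr_minus divide_inverse mult.commute del: of_nat_Suc)
  finally show ?thesis .
qed

lemma am_stable_om:
  assumes q: "0 < q" "q < 1"
  shows "am_set (principal_set (om q)) \<subseteq> principal_set (om q)"
proof
  fix \<xi>
  assume \<xi>: "\<xi> \<in> am_set (principal_set (om q))"
  obtain C where C: "C \<ge> 0" "\<And>n. \<xi> n \<le> C * arith_mean (om q) n"
    using am_set_principalD[OF om_c0[OF q(1)] \<xi>] by blast
  have mean: "arith_mean (om q) n \<le> om q n / (1 - q)" for n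
  proof -
    have "arith_mean (om q) n = (\<Sum>j<Suc n. om q j) / real (Suc n)"
      by (simp add: arith_mean_def lessThan_Suc_atMost del: sum.lessThan_Suc sum.atMost_Suc)
    also have "\<dots> \<le> (real (Suc n) powr (1 - q) / (1 - q)) / real (Suc n)"
      by (intro divide_right_mono sum_om_le q) simp
    also have "\<dots> = om q n / (1 - q)"
      using powr_diff[of "real (Suc n)" "1 - q" 1] by (simp add: om_def)
    finally show ?thesis .
  qed
  show "\<xi> \<in> principal_set (om q)"
  proof (rule principal_setI[OF am_set_c0[OF \<xi>], of 1])
    show "\<xi> n \<le> (C / (1 - q)) * om q (n div 1)" for n
      using C(2)[of n] mult_left_mono[OF mean[of n] C(1)] by simp
  qed simp
qed

text \<open>The mean of the sequence is not of its own order: partial sums would be bounded by a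
  multiple of (n + 1)^(1-q), which tends to 0 for q > 1 although the first term is 1, and is
  constant for q = 1 although harmonic sums are unbounded.\<close>

lemma not_am_stable_om:
  assumes q: "q \<ge> 1"
  shows "\<not> am_set (principal_set (om q)) \<subseteq> principal_set (om q)"
proof
  assume sub: "am_set (principal_set (om q)) \<subseteq> principal_set (om q)"
  have om: "om q \<in> c0_star"
    using q by (intro om_c0) simp
  have "arith_mean (om q) \<in> am_set (principal_set (om q))"
    by (rule am_setI[OF c0_star_arith_mean[OF om] self_in_principal_set[OF om], of 1]) simp
  with sub have mem: "arith_mean (om q) \<in> principal_set (om q)"
    by blast
  obtain C m where C: "C \<ge> 0" "m > 0" "\<And>n. arith_mean (om q) n \<le> C * om q (n div m)"
    using principal_setD[OF om mem] by blast
  define D where "D = C * real m powr q"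
  have le: "(\<Sum>j<Suc n. om q j) \<le> D * real (Suc n) powr (1 - q)" for n
  proof -
    have "arith_mean (om q) n \<le> D * om q n"
      using C(3)[of n] mult_left_mono[OF om_div_le[of q m n] C(1)] C(2) q by (simp add: D_def)
    then have "(\<Sum>j<Suc n. om q j) / real (Suc n) \<le> D * om q n"
      by (simp add: arith_mean_def lessThan_Suc_atMost del: sum.lessThan_Suc sum.atMost_Suc)
    then have "(\<Sum>j<Suc n. om q j) \<le> D * (om q n * real (Suc n))"
      by (simp add: divide_le_eq mult.assoc del: sum.lessThan_Suc of_nat_Suc)
    also have "om q n * real (Suc n) = real (Suc n) powr (1 - q)"
      using powr_add[of "real (Suc n)" "- q" 1] by (simp add: om_def)
    finally show ?thesis .
  qed
  show False
  proof (cases "q = 1")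
    case True
    have "ln (real n) \<le> D" for n
    proof (cases "n = 0")
      case False
      have "ln (real n) \<le> ln (real (Suc n) + 1)"
        using False by simp
      also have "\<dots> \<le> (\<Sum>j<Suc n. om q j)"
        unfolding True by (rule ln_le_sum_om_1)
      also have "\<dots> \<le> D"
        using le[of n] True by simp
      finally show ?thesis .
    qed (simp add: D_def C)
    moreover have "filterlim (\<lambda>n. ln (real n)) at_top sequentially"
      by real_asymp
    then have "\<forall>\<^sub>F n in sequentially. ln (real n) > D"
      by (simp add: filterlim_at_top_dense)
    then obtain n where "ln (real n) > D"
      by (auto simp: eventually_sequentially)
    ultimately show False
      using leD by blast
  next
    case False
    with q have "q > 1"
      by simp
    have "1 \<le> D * real (Suc n) powr (1 - q)" for n
    proof -
      have "(\<Sum>j\<in>{0}. om q j) \<le> (\<Sum>j<Suc n. om q j)"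
        by (rule sum_mono2) (auto intro: less_imp_le[OF om_pos])
      then show ?thesis
        using le[of n] by (simp add: om_def)
    qed
    moreover have "(\<lambda>n. D * real (Suc n) powr (1 - q)) \<longlonglongrightarrow> 0"
      using \<open>q > 1\<close> by real_asymp
    ultimately have "(1::real) \<le> 0"
      by (intro LIMSEQ_le_const) auto
    then show False
      by simp
  qed
qed

section \<open>The hat ideals of the powers\<close>

context onb
begin

lemma omega_pow_eq: "p > 0 \<Longrightarrow> omega_pow e p = seq_ideal (principal_set (om p))"
  by (simp add: omega_pow_def omega_powr principal_ideal_eq om_c0)

lemma hat_omega_gt_1:
  assumes "p > 1"
  shows "hat_ideal (omega_pow e p) = seq_ideal fin_seqs"
proof -
  have p: "p > 0"
    using assms by simp
  show ?thesis
    unfolding omega_pow_eq[OF p]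
    by (rule hat_ideal_eq[OF charset_principal_set[OF om_c0[OF p]]])
      \<comment> \<open>For this range \<open>fin_seqs\<close> itself satisfies the domination, so
        it serves as \<open>R\<close> for every \<xi>.\<close>
      (use fin_subset_of_am[OF _ _ p] am_set_om_subset_fin[OF assms] charset_fin_seqs in blast)+
qed

lemma hat_omega_1: "hat_ideal (omega_pow e 1) = seq_ideal (principal_set exp_seq)"
proof -
  have om: "om 1 \<in> c0_star"
    by (rule om_c0) simp
  show ?thesis
    unfolding omega_pow_eq[OF zero_less_one]
    by (rule hat_ideal_eq[OF charset_principal_set[OF om] principal_exp_subset_of_am ex_charset_avoiding_eq_1])
qed

lemma hat_omega_lt_1:
  assumes p: "0 < p" "p < 1"
  shows "hat_ideal (omega_pow e p) = seq_ideal (principal_set (om (p / (1 - p))))"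
  unfolding omega_pow_eq[OF p(1)]
  by (rule hat_ideal_eq[OF charset_principal_set[OF om_c0[OF p(1)]] principal_om_subset_of_am[OF _ _ p]
        ex_charset_avoiding_lt_1[OF p]])

end

theorem corollary6p16:
  fixes e :: "nat \<Rightarrow> 'h::complex_hilbert" and p :: real
  assumes "separable_space (euclidean :: 'h topology)"
    and "infinite_dimensional TYPE('h)"
    and "orthonormal_basis e"
    and "p > 0"
  shows "(p > 1 \<longrightarrow> hat_ideal (omega_pow e p) = finite_rank_ops) \<and>
    (p = 1 \<longrightarrow> hat_ideal (omega_pow e p) =
       principal_ideal e (\<lambda>k. real (k + 1) / exp (real (k + 1)))) \<and>
    (p < 1 \<longrightarrow> (\<forall>p'::real. 1 / p - 1 / p' = 1 \<longrightarrow>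
       hat_ideal (omega_pow e p) = omega_pow e p')) \<and>
    (am_stable (hat_ideal (omega_pow e p)) \<longleftrightarrow> p < 1 / 2)"
proof -
  interpret onb e
    by unfold_locales (rule assms(3))
  consider (gt) "p > 1" | (eq) "p = 1" | (lt) "p < 1"
    by linarith
  then show ?thesis
  proof cases
    case gt
    have "hat_ideal (omega_pow e p) = (finite_rank_ops :: ('h \<Rightarrow>\<^sub>L 'h) set)"
      by (simp add: hat_omega_gt_1[OF gt] finite_rank_ops_eq seq_ideal_def)
    moreover have "\<not> am_stable (hat_ideal (omega_pow e p))"
      unfolding hat_omega_gt_1[OF gt] am_stable_seq_ideal[OF charset_fin_seqs] by (rule not_am_stable_fin)
    ultimately show ?thesis
      using gt by simp
  next
    case eq
    have "hat_ideal (omega_pow e p) = principal_ideal e exp_seq"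
      by (simp add: eq hat_omega_1 principal_ideal_eq[OF exp_seq_c0])
    moreover have "exp_seq = (\<lambda>k. real (k + 1) / exp (real (k + 1)))"
      by (rule ext) (rule exp_seq_def)
    moreover have "\<not> am_stable (hat_ideal (omega_pow e p))"
      unfolding eq hat_omega_1 am_stable_seq_ideal[OF charset_principal_set[OF exp_seq_c0]]
      by (rule not_am_stable_exp)
    ultimately show ?thesis
      using eq by simp
  next
    case lt
    let ?q = "p / (1 - p)"
    have q: "?q > 0"
      using lt assms(4) by simp
    have hat: "hat_ideal (omega_pow e p) = seq_ideal (principal_set (om ?q))"
      by (rule hat_omega_lt_1[OF assms(4) lt])
    have "hat_ideal (omega_pow e p) = omega_pow e p'" if "1 / p - 1 / p' = 1" for p'
    proof -
      have "1 / p' = (1 - p) / p"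
        using that assms(4) by (simp add: field_simps)
      \<comment> \<open>Inversion is an involution also at 0, so no separate argument that
        \<open>p'\<close> is nonzero is necessary.\<close>
      then have "p' = ?q"
        by (metis inverse_divide inverse_eq_divide inverse_inverse_eq)
      then show ?thesis
        by (simp add: hat omega_pow_eq[OF q])
    qed
    moreover have "am_stable (hat_ideal (omega_pow e p)) \<longleftrightarrow> ?q < 1"
      unfolding hat am_stable_seq_ideal[OF charset_principal_set[OF om_c0[OF q]]]
      using am_stable_om[OF q] not_am_stable_om[of ?q] by (meson not_less)
    moreover have "?q < 1 \<longleftrightarrow> p < 1 / 2"
      using lt by (auto simp: field_simps)
    ultimately show ?thesis
      using lt by simp
  qed
qed

end
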